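(* Let $C$ be a finitely generated, strongly connected extended Choquet cone, and let $X$, $V_C$, $V_C^+$ and the pairing $(\cdot,\cdot)\colon C\times V_C^+\to[0,\infty]$ be as defined in the context. Then the pairing is bilinear (additive and homogeneous for positive scalars in each variable). Moreover, the map $x\mapsto (x,\cdot)$, from $C$ to $\mathrm{Hom}(V_C^+,[0,\infty])$, is an isomorphism of extended Choquet cones.
   Context: A cone is an abelian monoid $(C,+)$ with a scalar multiplication $(0,\infty)\times C\to C$ that is additive in each variable and satisfies $s(tx)=(st)x$ and $1\cdot x=x$ (cancellation is not assumed). The algebraic preorder: $x\le y$ iff $x+z=y$ for some $z\in C$; $C$ is algebraically ordered if this is a partial order. A topological cone has a topology making addition and scalar multiplication $(0,\infty)\times C\to C$ jointly continuous. An extended Choquet cone is an algebraically ordered topological cone $C$ that is a lattice under the algebraic order with addition distributing over $\wedge$ and $\vee$, and whose topology is compact, Hausdorff and locally convex (has a basis of open convex sets). Such cones are complete lattices. An isomorphism of extended Choquet cones is a linear homeomorphism. $\mathrm{Idem}(C)=\{w\in C:2w=w\}$. For $x\in C$, $\epsilon(x)$ denotes the support idempotent of $x$: the maximum of $\{z\in C:x+z=x\}$ (it exists and is idempotent). For $w\in\mathrm{Idem}(C)$, $C_w=\{x\in C:\epsilon(x)=w\}$, a cancellative cone with zero element $w$. $C$ is strongly connected if $\{x\in C:x\le w\}$ is connected for every $w\in\mathrm{Idem}(C)$. $C$ is finitely generated if there is a finite set $Z\subseteq C$ such that every $x\in C$ is of the form $\sum_{i=1}^n\alpha_iz_i$ with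 $\alpha_i\in(0,\infty)$, $z_i\in Z$. Construction of $X$. For $w\in \mathrm{Idem}(C)$ and $x\in C_w$, an extension of $x$ is $z\in C$ with $z+w=x$; there is a minimum extension $\tilde x=\inf\{z\in C:z+w=x\}$, which is itself an extension of $x$. An element $x\in C_w\setminus\{w\}$ generates an extreme ray of $C_w$ if $x=y+z$ with $y,z\in C_w$ implies that each of $y,z$ is $w$ or a positive multiple of $x$. Let $X_w$ be the set of minimum extensions of all elements $x\in C_w\setminus\{w\}$ generating an extreme ray of $C_w$. The set $\bigcup_{w\in\mathrm{Idem}(C)}X_w$ is closed under multiplication by positive scalars; $X$ is obtained by choosing one representative from each ray in this union. Each $y\in C$ has a unique representation (up to reordering) $y=\sum_{i=1}^n\alpha_ix_i+w$ with $n\ge 0$, $x_i\in X$ pairwise distinct, $\alpha_i\in(0,\infty)$, and $w\in\mathrm{Idem}(C)$ such that $\epsilon(x_i)\le w$ and $x_i\nleq w$ for all $i$. For $w\in\mathrm{Idem}(C)$ let $O_w=\{x\in X:x\nleq w\}$ and $P_w=\{x\in O_w:\epsilon(x)\le w\}$. A function $f\colon X\to\mathbb{R}$ is positive if there exists $w\in\mathrm{Idem}(C)$ such that $f(x)=0$ for $x\in X\setminus O_w$ and $f(x)>0$ for $x\in P_w$; such $w$ is unique and is denoted $\mathrm{supp}(f)$. $V_C$ is the vector space of all functions $X\to\mathbb{R}$ and $V_C^+$ its set of positive functions, which is closed under addition and positive scalars and contains $0$. Pairing: for $y\in C$ with the representation $y=\sum_{i=1}^n\alpha_ix_i+w$ above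 and $f\in V_C^+$, put $(y,f)=\sum_{i=1}^n\alpha_if(x_i)$ if $w\le\mathrm{supp}(f)$, and $(y,f)=\infty$ otherwise. $\mathrm{Hom}(V_C^+,[0,\infty])$ is the set of monoid morphisms $V_C^+\to[0,\infty]$ (these are automatically homogeneous), with pointwise operations and the topology of pointwise convergence. *)

theory Defs
  imports "HOL-Analysis.Analysis" "HOL-Algebra.Module"
begin

section \<open>Cones and extended Choquet cones\<close>

text \<open>
  The additive monoid and the scalar multiplication are those of the record of HOL-Algebra
  modules.  As there, the ring multiplication and unit of the record play no role; \<open>t \<odot> x\<close> is
  relevant only for \<open>t > 0\<close>.
\<close>

record 'a top_cone = "(real, 'a) module" +
  ctop :: "'a topology"

locale abstract_cone = abelian_monoid C for C :: "(real, 'a, 'm) module_scheme" (structure) +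
  assumes scale_closed: "\<lbrakk>0 < t; x \<in> carrier C\<rbrakk> \<Longrightarrow> t \<odot> x \<in> carrier C"
    and scale_add_right: "\<lbrakk>0 < t; x \<in> carrier C; y \<in> carrier C\<rbrakk> \<Longrightarrow> t \<odot> (x \<oplus> y) = t \<odot> x \<oplus> t \<odot> y"
    and scale_add_left: "\<lbrakk>0 < s; 0 < t; x \<in> carrier C\<rbrakk> \<Longrightarrow> (s + t) \<odot> x = s \<odot> x \<oplus> t \<odot> x"
    and scale_scale: "\<lbrakk>0 < s; 0 < t; x \<in> carrier C\<rbrakk> \<Longrightarrow> s \<odot> (t \<odot> x) = (s * t) \<odot> x"
    and scale_one: "x \<in> carrier C \<Longrightarrow> 1 \<odot> x = x"

text \<open>The algebraic preorder, as an order structure of HOL-Algebra.\<close>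

definition alg_order :: "('a, 'm) ring_scheme \<Rightarrow> 'a gorder" where
  "alg_order C = \<lparr>carrier = carrier C, eq = (=), le = (\<lambda>x y. \<exists>z\<in>carrier C. x \<oplus>\<^bsub>C\<^esub> z = y)\<rparr>"

abbreviation cone_le :: "'a \<Rightarrow> ('a, 'm) ring_scheme \<Rightarrow> 'a \<Rightarrow> bool" (\<open>(_ \<preceq>[_] _)\<close> [51, 0, 51] 50) where
  "x \<preceq>[C] y \<equiv> x \<sqsubseteq>\<^bsub>alg_order C\<^esub> y"

locale topological_cone = abstract_cone C for C :: "('a, 'm) top_cone_scheme" (structure) +
  assumes topspace_ctop: "topspace (ctop C) = carrier C"
    and continuous_add:
      "continuous_map (prod_topology (ctop C) (ctop C)) (ctop C) (\<lambda>(x, y). x \<oplus> y)"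
    and continuous_scale:
      "continuous_map (prod_topology (top_of_set {0<..}) (ctop C)) (ctop C) (\<lambda>(t, x). t \<odot> x)"

definition cone_convex :: "(real, 'a, 'm) module_scheme \<Rightarrow> 'a set \<Rightarrow> bool" where
  "cone_convex C S \<longleftrightarrow>
     (\<forall>x\<in>S. \<forall>y\<in>S. \<forall>t. 0 < t \<and> t < 1 \<longrightarrow> t \<odot>\<^bsub>C\<^esub> x \<oplus>\<^bsub>C\<^esub> (1 - t) \<odot>\<^bsub>C\<^esub> y \<in> S)"

locale extended_choquet_cone = topological_cone C for C :: "('a, 'm) top_cone_scheme" (structure) +
  assumes alg_lattice: "lattice (alg_order C)"
    and add_meet_distrib:
      "\<lbrakk>x \<in> carrier C; y \<in> carrier C; z \<in> carrier C\<rbrakk> \<Longrightarrow>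
        x \<oplus> (y \<sqinter>\<^bsub>alg_order C\<^esub> z) = (x \<oplus> y) \<sqinter>\<^bsub>alg_order C\<^esub> (x \<oplus> z)"
    and add_join_distrib:
      "\<lbrakk>x \<in> carrier C; y \<in> carrier C; z \<in> carrier C\<rbrakk> \<Longrightarrow>
        x \<oplus> (y \<squnion>\<^bsub>alg_order C\<^esub> z) = (x \<oplus> y) \<squnion>\<^bsub>alg_order C\<^esub> (x \<oplus> z)"
    and compact_ctop: "compact_space (ctop C)"
    and Hausdorff_ctop: "Hausdorff_space (ctop C)"
    and locally_convex:
      "\<lbrakk>openin (ctop C) U; x \<in> U\<rbrakk> \<Longrightarrow>
        \<exists>V. openin (ctop C) V \<and> cone_convex C V \<and> x \<in> V \<and> V \<subseteq> U"

definition choquet_cone_iso ::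
    "('a, 'm) top_cone_scheme \<Rightarrow> ('b, 'n) top_cone_scheme \<Rightarrow> ('a \<Rightarrow> 'b) \<Rightarrow> bool" where
  "choquet_cone_iso C D h \<longleftrightarrow>
     extended_choquet_cone C \<and> extended_choquet_cone D \<and>
     homeomorphic_map (ctop C) (ctop D) h \<and>
     (\<forall>x\<in>carrier C. \<forall>y\<in>carrier C. h (x \<oplus>\<^bsub>C\<^esub> y) = h x \<oplus>\<^bsub>D\<^esub> h y) \<and>
     (\<forall>t>0. \<forall>x\<in>carrier C. h (t \<odot>\<^bsub>C\<^esub> x) = t \<odot>\<^bsub>D\<^esub> h x)"


section \<open>Idempotents and finiteness conditions\<close>

definition idems :: "(real, 'a, 'm) module_scheme \<Rightarrow> 'a set" where
  "idems C = {w \<in> carrier C. 2 \<odot>\<^bsub>C\<^esub> w = w}"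

definition supp_idem :: "('a, 'm) ring_scheme \<Rightarrow> 'a \<Rightarrow> 'a" where
  "supp_idem C x = (THE e. greatest (alg_order C) e {z \<in> carrier C. x \<oplus>\<^bsub>C\<^esub> z = x})"

definition cone_at :: "('a, 'm) ring_scheme \<Rightarrow> 'a \<Rightarrow> 'a set" where
  "cone_at C w = {x \<in> carrier C. supp_idem C x = w}"

definition strongly_connected :: "('a, 'm) top_cone_scheme \<Rightarrow> bool" where
  "strongly_connected C \<longleftrightarrow>
     (\<forall>w\<in>idems C. connectedin (ctop C) {x \<in> carrier C. x \<preceq>[C] w})"

definition finitely_generated :: "(real, 'a, 'm) module_scheme \<Rightarrow> bool" where
  "finitely_generated C \<longleftrightarrow>
     (\<exists>Z. finite Z \<and> Z \<subseteq> carrier C \<and>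
        (\<forall>x\<in>carrier C. \<exists>n (\<alpha> :: nat \<Rightarrow> real) z.
           (\<forall>i\<in>{1..n}. 0 < \<alpha> i \<and> z i \<in> Z) \<and> x = (\<Oplus>\<^bsub>C\<^esub>i\<in>{1..n}. \<alpha> i \<odot>\<^bsub>C\<^esub> z i)))"


section \<open>Extreme rays and minimum extensions\<close>

definition min_extension :: "('a, 'm) ring_scheme \<Rightarrow> 'a \<Rightarrow> 'a \<Rightarrow> 'a" where
  "min_extension C w x = \<Sqinter>\<^bsub>alg_order C\<^esub> {z \<in> carrier C. z \<oplus>\<^bsub>C\<^esub> w = x}"

definition extreme_in :: "(real, 'a, 'm) module_scheme \<Rightarrow> 'a \<Rightarrow> 'a \<Rightarrow> bool" where
  "extreme_in C w x \<longleftrightarrow> x \<in> cone_at C w - {w} \<and>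
     (\<forall>y\<in>cone_at C w. \<forall>z\<in>cone_at C w. x = y \<oplus>\<^bsub>C\<^esub> z \<longrightarrow>
        (y = w \<or> (\<exists>t>0. y = t \<odot>\<^bsub>C\<^esub> x)) \<and> (z = w \<or> (\<exists>t>0. z = t \<odot>\<^bsub>C\<^esub> x)))"

definition extreme_extensions :: "(real, 'a, 'm) module_scheme \<Rightarrow> 'a set" where
  "extreme_extensions C = (\<Union>w\<in>idems C. min_extension C w ` {x. extreme_in C w x})"

text \<open>\<open>X\<close> contains exactly one element of each ray of \<open>extreme_extensions C\<close>.\<close>

definition ray_representatives :: "(real, 'a, 'm) module_scheme \<Rightarrow> 'a set \<Rightarrow> bool" where
  "ray_representatives C X \<longleftrightarrow> X \<subseteq> extreme_extensions C \<and>
     (\<forall>y\<in>extreme_extensions C. \<exists>!x. x \<in> X \<and> (\<exists>t>0. x = t \<odot>\<^bsub>C\<^esub> y))"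

text \<open>
  \<open>y = (\<Oplus>x\<in>S. \<alpha> x \<odot> x) \<oplus> w\<close> is the representation of \<open>y\<close>; a finite subset \<open>S\<close> of \<open>X\<close> stands
  for the pairwise distinct \<open>x\<^sub>1, \<dots>, x\<^sub>n\<close>.  The values of \<open>\<alpha>\<close> outside \<open>S\<close> are irrelevant.
\<close>

definition representation ::
    "(real, 'a, 'm) module_scheme \<Rightarrow> 'a set \<Rightarrow> 'a \<Rightarrow> 'a set \<Rightarrow> ('a \<Rightarrow> real) \<Rightarrow> 'a \<Rightarrow> bool" where
  "representation C X y S \<alpha> w \<longleftrightarrow>
     finite S \<and> S \<subseteq> X \<and> (\<forall>x\<in>S. 0 < \<alpha> x) \<and> w \<in> idems C \<and>
     (\<forall>x\<in>S. supp_idem C x \<preceq>[C] w \<and> \<not> x \<preceq>[C] w) \<and>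
     y = (\<Oplus>\<^bsub>C\<^esub>x\<in>S. \<alpha> x \<odot>\<^bsub>C\<^esub> x) \<oplus>\<^bsub>C\<^esub> w"


section \<open>Positive functions and the pairing\<close>

definition outer_set :: "('a, 'm) ring_scheme \<Rightarrow> 'a set \<Rightarrow> 'a \<Rightarrow> 'a set" where
  "outer_set C X w = {x \<in> X. \<not> x \<preceq>[C] w}"

definition pos_set :: "('a, 'm) ring_scheme \<Rightarrow> 'a set \<Rightarrow> 'a \<Rightarrow> 'a set" where
  "pos_set C X w = {x \<in> outer_set C X w. supp_idem C x \<preceq>[C] w}"

definition positive_at :: "(real, 'a, 'm) module_scheme \<Rightarrow> 'a set \<Rightarrow> ('a \<Rightarrow> real) \<Rightarrow> 'a \<Rightarrow> bool" where
  "positive_at C X f w \<longleftrightarrow> w \<in> idems C \<and>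
     (\<forall>x\<in>X - outer_set C X w. f x = 0) \<and> (\<forall>x\<in>pos_set C X w. 0 < f x)"

definition fun_supp :: "(real, 'a, 'm) module_scheme \<Rightarrow> 'a set \<Rightarrow> ('a \<Rightarrow> real) \<Rightarrow> 'a" where
  "fun_supp C X f = (THE w. positive_at C X f w)"

text \<open>The real functions on \<open>X\<close>, as extensional functions with pointwise operations.\<close>

definition fun_space :: "'a set \<Rightarrow> (real, 'a \<Rightarrow> real) module" where
  "fun_space X = \<lparr>carrier = X \<rightarrow>\<^sub>E UNIV, monoid.mult = undefined, one = undefined,
     zero = (\<lambda>x\<in>X. 0), add = (\<lambda>f g. \<lambda>x\<in>X. f x + g x), smult = (\<lambda>t f. \<lambda>x\<in>X. t * f x)\<rparr>"

definition pos_funs :: "(real, 'a, 'm) module_scheme \<Rightarrow> 'a set \<Rightarrow> (real, 'a \<Rightarrow> real) module" where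
  "pos_funs C X = (fun_space X)
     \<lparr>carrier := {f \<in> carrier (fun_space X). \<exists>w. positive_at C X f w}\<rparr>"

text \<open>
  The sum is nonnegative whenever \<open>f\<close> is positive and \<open>w \<preceq>[C] fun_supp C X f\<close>, so that
  \<^term>\<open>ennreal\<close> does not truncate.
\<close>

definition pairing ::
    "(real, 'a, 'm) module_scheme \<Rightarrow> 'a set \<Rightarrow> 'a \<Rightarrow> ('a \<Rightarrow> real) \<Rightarrow> ennreal" where
  "pairing C X y f = (THE r. \<exists>S \<alpha> w. representation C X y S \<alpha> w \<and>
     r = (if w \<preceq>[C] fun_supp C X f then ennreal (\<Sum>x\<in>S. \<alpha> x * f x) else \<infinity>))"

text \<open>
  The monoid morphisms from \<open>M\<close> to \<open>[0, \<infinity>]\<close>, as extensional functions, with pointwise operations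
  and the topology of pointwise convergence.
\<close>

definition hom_carrier :: "('b, 'm) ring_scheme \<Rightarrow> ('b \<Rightarrow> ennreal) set" where
  "hom_carrier M = {\<phi> \<in> carrier M \<rightarrow>\<^sub>E UNIV. \<phi> \<zero>\<^bsub>M\<^esub> = 0 \<and>
     (\<forall>f\<in>carrier M. \<forall>g\<in>carrier M. \<phi> (f \<oplus>\<^bsub>M\<^esub> g) = \<phi> f + \<phi> g)}"

definition hom_cone :: "('b, 'm) ring_scheme \<Rightarrow> ('b \<Rightarrow> ennreal) top_cone" where
  "hom_cone M = \<lparr>carrier = hom_carrier M, monoid.mult = undefined, one = undefined,
     zero = (\<lambda>f\<in>carrier M. 0), add = (\<lambda>\<phi> \<psi>. \<lambda>f\<in>carrier M. \<phi> f + \<psi> f),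
     smult = (\<lambda>t \<phi>. \<lambda>f\<in>carrier M. ennreal t * \<phi> f),
     ctop = subtopology (product_topology (\<lambda>_. euclidean) (carrier M)) (hom_carrier M)\<rparr>"

end

theory Submission
  imports Defs
begin

text \<open>
  Compactness makes \<open>\<epsilon>(x)\<close> the infimum of the ray through \<open>x\<close>; hence \<open>\<epsilon>\<close> is additive and
  \<open>x + z \<le> y + z\<close> implies \<open>x + \<epsilon>(z) \<le> y + \<epsilon>(z)\<close>.  A minimal generating set of \<open>C\<^sub>w\<close> consists of
  generators of extreme rays, and since addition distributes over meets the coefficient of \<open>x \<in> X\<close>
  in \<open>y\<close> is the largest \<open>t\<close> with \<open>t x \<le> y\<close>, so that every element has unique coordinates.

  A morphism \<open>\<phi> : V\<^sub>C\<^sup>+ \<rightarrow> [0, \<infinity>]\<close> is finite exactly on the functions whose support dominates some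
  idempotent \<open>w\<close>, and there it is the restriction of a linear functional on the functions vanishing
  on \<open>{x. x \<le> w}\<close>; positivity kills its coefficients outside \<open>P\<^sub>w\<close>.

  For the topology, \<open>(y, f) = (y + supp f, f)\<close>.  Among the \<open>z \<ge> w = supp f\<close>, those with
  \<open>(z, f) \<le> M\<close> form a continuous image of a compact polytope, and those with \<open>(z, f) \<ge> M\<close> form the
  sum of the compact simplex \<open>{z \<in> C\<^sub>w. (z, f) = M}\<close> and \<open>C\<close>; both sets are therefore closed.
  A continuous bijection from a compact space to a Hausdorff space is a
  homeomorphism, and the structure of the target cone is transported from \<open>C\<close>.
\<close>

section \<open>Cones and their algebraic order\<close>

text \<open>The obstacle throughout is the lack of cancellation and of a scalar \<open>0\<close>: as
  \<open>t\<close> tends to \<open>0\<close>, the multiples of \<open>x\<close> tend to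
  \<open>\<epsilon> x\<close>, not to \<open>\<zero>\<close>. Hence statements about
  \<open>x\<close> are made modulo an idempotent \<open>w\<close> above \<open>\<epsilon> x\<close>,
  that is, after adding \<open>w\<close>; there the rays behave as in an ordinary cancellative cone.

  An element of \<open>X\<close> is by construction minimal and extreme at a single idempotent
  \<open>v\<close>. It has to be used at every \<open>w\<close> with
  \<open>\<epsilon> x \<preceq> w\<close> and \<open>\<not> x \<preceq> w\<close>. The transfer goes
  through \<open>\<epsilon> x\<close>, which lies below both \<open>v\<close> and \<open>w\<close>:
  a splitting of \<open>x\<close> into summands is already proportional modulo
  \<open>\<epsilon> x\<close>.

  On the side of functions, morphisms are additive only on positive functions. The values on point
  masses are therefore read off as differences of values on functions of support exactly
  \<open>w\<close>. A positive function with support \<open>w\<close> is unconstrained on the part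
  of \<open>O_w\<close> outside \<open>P_w\<close>; this freedom forces the coefficients there to
  vanish.\<close>

context abstract_cone
begin

section \<open>Scalars extended by zero, and finite combinations\<close>

abbreviation le :: "'a \<Rightarrow> 'a \<Rightarrow> bool" (infix \<open>\<preceq>\<close> 50) where
  "x \<preceq> y \<equiv> x \<preceq>[C] y"

text \<open>Nonpositive scalars give \<open>\<zero>\<close>, so that sums can run over a fixed set
  such as \<open>X\<close> with vanishing coefficients. This choice is algebraic: the limit of
  \<open>t \<star> x\<close> at \<open>0\<close> is \<open>\<epsilon> x\<close>, and
  \<open>\<star>\<close> is in general not continuous there.\<close>

definition scale0 :: "real \<Rightarrow> 'a \<Rightarrow> 'a" (infixr \<open>\<star>\<close> 70) where
  "t \<star> x = (if 0 < t then t \<odot> x else \<zero>)"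

abbreviation comb :: "('a \<Rightarrow> real) \<Rightarrow> 'a set \<Rightarrow> 'a" where
  "comb a S \<equiv> (\<Oplus>x\<in>S. a x \<star> x)"

lemma scale0_pos: "0 < t \<Longrightarrow> t \<star> x = t \<odot> x"
  by (simp add: scale0_def)

lemma scale0_nonpos: "\<not> 0 < t \<Longrightarrow> t \<star> x = \<zero>"
  by (simp add: scale0_def)

lemma scale0_0 [simp]: "0 \<star> x = \<zero>"
  by (simp add: scale0_def)

text \<open>The cone laws do not mention \<open>t \<odot> \<zero>\<close>. It is neutral because
  every \<open>y\<close> is \<open>t\<close> times \<open>(1/t) \<odot> y\<close>, and neutral
  elements are unique.\<close>

lemma scale_zero:
  assumes "0 < t" shows "t \<odot> \<zero> = \<zero>"
proof -
  have *: "t \<odot> \<zero> \<oplus> y = y" if y: "y \<in> carrier C" for y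
  proof -
    have "t \<odot> \<zero> \<oplus> t \<odot> ((1/t) \<odot> y) = t \<odot> ((1/t) \<odot> y)"
      using assms y by (subst scale_add_right[symmetric]) (auto simp: scale_closed)
    moreover have "t \<odot> ((1/t) \<odot> y) = y"
      using assms y by (simp add: scale_scale scale_one)
    ultimately show ?thesis by simp
  qed
  have "t \<odot> \<zero> \<in> carrier C" using assms by (simp add: scale_closed)
  then show ?thesis using *[of \<zero>] by simp
qed

lemma scale0_closed [simp]: "x \<in> carrier C \<Longrightarrow> t \<star> x \<in> carrier C"
  by (simp add: scale0_def scale_closed)

lemma scale0_zero [simp]: "t \<star> \<zero> = \<zero>"
  by (simp add: scale0_def scale_zero)

lemma scale0_1 [simp]: "x \<in> carrier C \<Longrightarrow> 1 \<star> x = x"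
  by (simp add: scale0_def scale_one)

lemma scale0_add_right:
  "\<lbrakk>x \<in> carrier C; y \<in> carrier C\<rbrakk> \<Longrightarrow> t \<star> (x \<oplus> y) = t \<star> x \<oplus> t \<star> y"
  by (simp add: scale0_def scale_add_right)

lemma scale0_add_left:
  "\<lbrakk>0 \<le> s; 0 \<le> t; x \<in> carrier C\<rbrakk> \<Longrightarrow> (s + t) \<star> x = s \<star> x \<oplus> t \<star> x"
  by (auto simp: scale0_def scale_add_left scale_closed add_nonneg_pos)

lemma scale0_scale0:
  "\<lbrakk>0 \<le> s; 0 \<le> t; x \<in> carrier C\<rbrakk> \<Longrightarrow> s \<star> (t \<star> x) = (s * t) \<star> x"
  by (auto simp: scale0_def scale_scale scale_zero zero_less_mult_iff)

lemma scale0_inverse: "\<lbrakk>0 < t; x \<in> carrier C\<rbrakk> \<Longrightarrow> (1 / t) \<star> (t \<star> x) = x"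
  by (simp add: scale0_scale0)

lemma comb_closed [simp]: "S \<subseteq> carrier C \<Longrightarrow> comb a S \<in> carrier C"
  by (intro finsum_closed) auto

lemma comb_scale0:
  assumes "S \<subseteq> carrier C" "0 \<le> t" "\<And>x. x \<in> S \<Longrightarrow> 0 \<le> a x"
  shows "t \<star> comb a S = comb (\<lambda>x. t * a x) S"
proof (cases "finite S")
  case True
  then show ?thesis using assms
  proof (induction S)
    case (insert x F)
    then show ?case
      by (simp add: Pi_def subset_eq scale0_add_right scale0_scale0)
  qed simp
next
  case False
  then show ?thesis by (simp add: finsum_infinite)
qed

lemma comb_add:
  assumes "S \<subseteq> carrier C" "\<And>x. x \<in> S \<Longrightarrow> 0 \<le> a x" "\<And>x. x \<in> S \<Longrightarrow> 0 \<le> b x"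
  shows "comb a S \<oplus> comb b S = comb (\<lambda>x. a x + b x) S"
proof -
  have "comb (\<lambda>x. a x + b x) S = (\<Oplus>x\<in>S. a x \<star> x \<oplus> b x \<star> x)"
    using assms by (intro finsum_cong') (auto simp: scale0_add_left)
  also have "\<dots> = comb a S \<oplus> comb b S"
    using assms by (intro finsum_addf) auto
  finally show ?thesis by simp
qed

lemma comb_cong:
  "\<lbrakk>S \<subseteq> carrier C; \<And>x. x \<in> S \<Longrightarrow> a x = b x\<rbrakk> \<Longrightarrow> comb a S = comb b S"
  by (intro finsum_cong') auto

lemma comb_mono_neutral:
  assumes "finite T" "T \<subseteq> carrier C" "S \<subseteq> T" "\<And>x. x \<in> T - S \<Longrightarrow> a x = 0"
  shows "comb a T = comb a S"
proof -
  have "comb a (S \<union> (T - S)) = comb a S \<oplus> comb a (T - S)"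
    using assms by (intro finsum_Un_disjoint) (auto intro: finite_subset)
  moreover have "comb a (T - S) = (\<Oplus>x\<in>T-S. \<zero>)"
    using assms by (intro finsum_cong') auto
  ultimately show ?thesis
    using assms by (simp add: Un_absorb1)
qed

lemma comb_remove:
  assumes "finite S" "S \<subseteq> carrier C" "x \<in> S"
  shows "comb a S = a x \<star> x \<oplus> comb a (S - {x})"
proof -
  have "comb a (insert x (S - {x})) = a x \<star> x \<oplus> comb a (S - {x})"
    using assms by (intro finsum_insert) auto
  then show ?thesis using assms by (simp add: insert_absorb)
qed

lemma comb_single:
  assumes "finite S" "S \<subseteq> carrier C" "x \<in> S"
  shows "comb (\<lambda>y. if y = x then t else 0) S = t \<star> x"
  using assms comb_mono_neutral[of S "{x}" "\<lambda>y. if y = x then t else 0"]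
  by (auto simp: Pi_def subset_eq finsum_insert)

section \<open>The algebraic preorder\<close>

lemma le_iff: "x \<preceq> y \<longleftrightarrow> (\<exists>z\<in>carrier C. x \<oplus> z = y)"
  by (simp add: alg_order_def)

lemma leI: "\<lbrakk>z \<in> carrier C; x \<oplus> z = y\<rbrakk> \<Longrightarrow> x \<preceq> y"
  by (auto simp: le_iff)

lemma leE:
  assumes "x \<preceq> y" obtains z where "z \<in> carrier C" "y = x \<oplus> z"
  using assms by (auto simp: le_iff)

lemma le_refl: "x \<in> carrier C \<Longrightarrow> x \<preceq> x"
  by (rule leI[of \<zero>]) auto

lemma zero_le: "x \<in> carrier C \<Longrightarrow> \<zero> \<preceq> x"
  by (rule leI) auto

lemma le_add1: "\<lbrakk>x \<in> carrier C; y \<in> carrier C\<rbrakk> \<Longrightarrow> x \<preceq> x \<oplus> y"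
  by (rule leI) auto

lemma le_add2: "\<lbrakk>x \<in> carrier C; y \<in> carrier C\<rbrakk> \<Longrightarrow> y \<preceq> x \<oplus> y"
  by (rule leI[of x]) (auto simp: a_comm)

lemma le_trans [trans]:
  assumes "x \<preceq> y" "y \<preceq> z" "x \<in> carrier C" shows "x \<preceq> z"
proof -
  obtain a b where "a \<in> carrier C" "y = x \<oplus> a" "b \<in> carrier C" "z = y \<oplus> b"
    using assms by (metis leE)
  then show ?thesis using assms by (intro leI[of "a \<oplus> b"]) (auto simp: a_assoc)
qed

lemma add_mono:
  assumes "x \<preceq> x'" "y \<preceq> y'" "x \<in> carrier C" "y \<in> carrier C"
  shows "x \<oplus> y \<preceq> x' \<oplus> y'"
proof -
  obtain a b where "a \<in> carrier C" "x' = x \<oplus> a" "b \<in> carrier C" "y' = y \<oplus> b"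
    using assms by (metis leE)
  then show ?thesis using assms by (intro leI[of "a \<oplus> b"]) (auto simp: a_ac)
qed

lemma scale0_mono:
  assumes "x \<preceq> y" "x \<in> carrier C" shows "t \<star> x \<preceq> t \<star> y"
proof -
  obtain a where "a \<in> carrier C" "y = x \<oplus> a"
    using assms by (metis leE)
  then show ?thesis using assms by (intro leI[of "t \<star> a"]) (auto simp: scale0_add_right)
qed

lemma scale0_mono_left:
  assumes "s \<le> t" "0 \<le> s" "x \<in> carrier C" shows "s \<star> x \<preceq> t \<star> x"
  using assms scale0_add_left[of s "t - s" x] by (intro leI[of "(t - s) \<star> x"]) auto

lemma scale0_le_iff:
  assumes "0 < t" "x \<in> carrier C" "y \<in> carrier C"
  shows "t \<star> x \<preceq> y \<longleftrightarrow> x \<preceq> (1 / t) \<star> y"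
  using assms scale0_mono[of "t \<star> x" y "1 / t"] scale0_mono[of x "(1 / t) \<star> y" t]
  by (auto simp: scale0_scale0)

section \<open>Idempotents and the elements below them\<close>

lemma idems_iff: "w \<in> idems C \<longleftrightarrow> w \<in> carrier C \<and> w \<oplus> w = w"
  using scale_add_left[of 1 1 w] by (auto simp: idems_def scale_one)

lemma idems_closed: "w \<in> idems C \<Longrightarrow> w \<in> carrier C"
  by (simp add: idems_def)

lemma idems_add:
  assumes "v \<in> idems C" "w \<in> idems C" shows "v \<oplus> w \<in> idems C"
proof -
  have "(v \<oplus> w) \<oplus> (v \<oplus> w) = (v \<oplus> v) \<oplus> (w \<oplus> w)"
    using assms unfolding idems_iff by (metis a_assoc a_comm a_closed)
  then show ?thesis using assms by (simp add: idems_iff)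
qed

lemma zero_idems: "\<zero> \<in> idems C"
  by (simp add: idems_iff)

end

locale ordered_cone = abstract_cone C for C :: "(real, 'a, 'm) module_scheme" (structure) +
  assumes le_antisym: "\<lbrakk>x \<preceq> y; y \<preceq> x; x \<in> carrier C; y \<in> carrier C\<rbrakk> \<Longrightarrow> x = y"
begin

lemma le_idem_absorb:
  assumes "w \<in> idems C" "x \<in> carrier C" "x \<preceq> w" shows "x \<oplus> w = w"
proof (rule le_antisym)
  have "x \<oplus> w \<preceq> w \<oplus> w" using assms by (intro add_mono le_refl) (auto simp: idems_closed)
  then show "x \<oplus> w \<preceq> w" using assms by (simp add: idems_iff)
qed (use assms in \<open>auto simp: idems_closed le_add2\<close>)

lemma idem_lub:
  assumes "w \<in> idems C" "x \<preceq> w" "y \<preceq> w" "x \<in> carrier C" "y \<in> carrier C"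
  shows "x \<oplus> y \<preceq> w"
  using add_mono[of x w y w] assms by (auto simp: idems_iff)

text \<open>Sums of elements below an idempotent stay below it, which settles integer multiples; a
  real multiple is dominated by an integer one.\<close>

lemma scale0_le_idem:
  assumes w: "w \<in> idems C" and x: "x \<preceq> w" "x \<in> carrier C"
  shows "t \<star> x \<preceq> w"
proof (cases "0 < t")
  case True
  have *: "real (Suc n) \<star> x \<preceq> w" for n
  proof (induction n)
    case (Suc n)
    have "real (Suc (Suc n)) \<star> x = real (Suc n) \<star> x \<oplus> x"
      using scale0_add_left[of "real (Suc n)" 1 x] x by simp
    then show ?case using Suc w x by (simp add: idem_lub)
  qed (use x in simp)
  obtain n where "t \<le> real n" using real_arch_simple by blast
  then have "t \<star> x \<preceq> real (Suc n) \<star> x"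
    using x True by (intro scale0_mono_left) auto
  then show ?thesis using * le_trans x by (meson scale0_closed)
qed (use w in \<open>auto simp: scale0_def zero_le idems_closed\<close>)

lemma scale0_le_idem_iff:
  assumes w: "w \<in> idems C" and x: "x \<in> carrier C" and "0 < t"
  shows "t \<star> x \<preceq> w \<longleftrightarrow> x \<preceq> w"
  using scale0_le_idem[OF w, of x t] scale0_le_idem[OF w, of "t \<star> x" "1 / t"] assms
  by (auto simp: scale0_scale0)

lemma scale0_idem:
  assumes w: "w \<in> idems C" and "0 < t" shows "t \<star> w = w"
proof (rule le_antisym)
  have 1: "s \<star> w \<preceq> w" if "0 < s" for s
    using w by (intro scale0_le_idem le_refl) (auto simp: idems_closed)
  then show "t \<star> w \<preceq> w" using assms by blast
  show "w \<preceq> t \<star> w"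
    using scale0_le_iff[of "1/t" w w] 1[of "1/t"] assms by (simp add: idems_closed)
qed (use w in \<open>auto simp: idems_closed\<close>)

lemma comb_le_idem:
  assumes "w \<in> idems C" "S \<subseteq> carrier C" "\<And>x. x \<in> S \<Longrightarrow> 0 < a x \<Longrightarrow> x \<preceq> w"
  shows "comb a S \<preceq> w"
proof (cases "finite S")
  case True
  then show ?thesis using assms
  proof (induction S)
    case (insert x F)
    have "a x \<star> x \<preceq> w"
      using insert.prems scale0_le_idem[of w x "a x"]
      by (cases "0 < a x") (auto simp: scale0_def zero_le idems_closed)
    then show ?case using insert
      by (simp add: Pi_def subset_eq idem_lub)
  qed (simp add: zero_le idems_closed)
next
  case False
  then show ?thesis using assms by (simp add: finsum_infinite zero_le idems_closed)
qed

lemma scale0_le_comb: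
  assumes "finite S" "S \<subseteq> carrier C" "x \<in> S"
  shows "a x \<star> x \<preceq> comb a S"
proof -
  have "S - {x} \<subseteq> carrier C" "x \<in> carrier C" using assms by auto
  then show ?thesis using comb_remove[OF assms, of a] by (simp add: le_add1)
qed

end

section \<open>Support idempotents and minimum extensions\<close>

sublocale extended_choquet_cone \<subseteq> ordered_cone C
proof
  interpret L: lattice "alg_order C" by (rule alg_lattice)
  fix x y assume "x \<preceq> y" "y \<preceq> x" "x \<in> carrier C" "y \<in> carrier C"
  then show "x = y"
    using L.le_antisym[of x y] by (simp add: alg_order_def)
qed

context extended_choquet_cone
begin

section \<open>Meets in the algebraic order\<close>

abbreviation cone_meet :: "'a \<Rightarrow> 'a \<Rightarrow> 'a" (infixl \<open>\<sqinter>\<^sub>C\<close> 70) where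
  "x \<sqinter>\<^sub>C y \<equiv> x \<sqinter>\<^bsub>alg_order C\<^esub> y"

lemma carrier_alg_order: "carrier (alg_order C) = carrier C"
  by (simp add: alg_order_def)

lemma meet_closed [simp]:
  assumes "x \<in> carrier C" "y \<in> carrier C" shows "x \<sqinter>\<^sub>C y \<in> carrier C"
proof -
  interpret L: lattice "alg_order C" by (rule alg_lattice)
  show ?thesis using L.meet_closed[of x y] assms by (simp add: carrier_alg_order)
qed

lemma meet_le:
  assumes "x \<in> carrier C" "y \<in> carrier C" shows "x \<sqinter>\<^sub>C y \<preceq> x" "x \<sqinter>\<^sub>C y \<preceq> y"
proof -
  interpret L: lattice "alg_order C" by (rule alg_lattice)
  show "x \<sqinter>\<^sub>C y \<preceq> x" "x \<sqinter>\<^sub>C y \<preceq> y"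
    using L.meet_left[of x y] L.meet_right[of x y] assms by (simp_all add: carrier_alg_order)
qed

lemma meet_greatest:
  assumes "z \<preceq> x" "z \<preceq> y" "x \<in> carrier C" "y \<in> carrier C" "z \<in> carrier C"
  shows "z \<preceq> x \<sqinter>\<^sub>C y"
proof -
  interpret L: lattice "alg_order C" by (rule alg_lattice)
  show ?thesis using L.meet_le[of z x y] assms by (simp add: carrier_alg_order)
qed

lemma le_meet_iff:
  assumes "x \<in> carrier C" "y \<in> carrier C" "z \<in> carrier C"
  shows "z \<preceq> x \<sqinter>\<^sub>C y \<longleftrightarrow> z \<preceq> x \<and> z \<preceq> y"
proof
  assume le: "z \<preceq> x \<sqinter>\<^sub>C y"
  show "z \<preceq> x \<and> z \<preceq> y"
    using le_trans[OF le meet_le(1)] le_trans[OF le meet_le(2)] assms by (intro conjI) simp_all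
qed (use assms meet_greatest in auto)

lemma meet_self: "x \<in> carrier C \<Longrightarrow> x \<sqinter>\<^sub>C x = x"
  by (intro le_antisym meet_le meet_greatest le_refl meet_closed)

lemma meet_add_distrib_right:
  assumes "x \<in> carrier C" "y \<in> carrier C" "z \<in> carrier C"
  shows "(y \<sqinter>\<^sub>C z) \<oplus> x = (y \<oplus> x) \<sqinter>\<^sub>C (z \<oplus> x)"
  using add_meet_distrib[of x y z] assms by (simp add: a_comm)

text \<open>By distributivity the right-hand side is the meet of \<open>u \<oplus> b\<close> and
  \<open>a \<oplus> b\<close>, both above \<open>u\<close>. It replaces a summand by its meet with
  \<open>u\<close>, which is how disjoint summands get discarded in
  \<open>le_comb_disjoint\<close>.\<close>

lemma le_add_meet:
  assumes "u \<preceq> a \<oplus> b" "u \<in> carrier C" "a \<in> carrier C" "b \<in> carrier C"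
  shows "u \<preceq> (u \<sqinter>\<^sub>C a) \<oplus> b"
  using assms by (subst meet_add_distrib_right) (auto intro: meet_greatest le_add1)

lemma idems_meet:
  assumes "v \<in> idems C" "w \<in> idems C" shows "v \<sqinter>\<^sub>C w \<in> idems C"
proof -
  have "(v \<sqinter>\<^sub>C w) \<oplus> (v \<sqinter>\<^sub>C w) \<preceq> v \<sqinter>\<^sub>C w"
    using assms meet_le[of v w] by (intro meet_greatest idem_lub) (auto simp: idems_closed)
  then have "(v \<sqinter>\<^sub>C w) \<oplus> (v \<sqinter>\<^sub>C w) = v \<sqinter>\<^sub>C w"
    using assms by (intro le_antisym) (auto simp: idems_closed le_add1)
  then show ?thesis using assms by (simp add: idems_iff idems_closed)
qed

section \<open>Closed sets obtained from compactness\<close>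

lemma topspace_C [simp]: "topspace (ctop C) = carrier C"
  by (rule topspace_ctop)

lemma continuous_map_add:
  assumes "continuous_map T (ctop C) f" "continuous_map T (ctop C) g"
  shows "continuous_map T (ctop C) (\<lambda>t. f t \<oplus> g t)"
proof -
  have "continuous_map T (prod_topology (ctop C) (ctop C)) (\<lambda>t. (f t, g t))"
    using assms by (simp add: continuous_map_pairedI)
  from continuous_map_compose[OF this continuous_add] show ?thesis
    by (simp add: o_def)
qed

lemma continuous_map_add_const:
  "a \<in> carrier C \<Longrightarrow> continuous_map (ctop C) (ctop C) (\<lambda>z. z \<oplus> a)"
  by (intro continuous_map_add) (auto simp: continuous_map_id[unfolded id_def])

lemma closedin_preimage:
  assumes "continuous_map (ctop C) (ctop C) f" "closedin (ctop C) B"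
  shows "closedin (ctop C) {x \<in> carrier C. f x \<in> B}"
  using closedin_continuous_map_preimage[OF assms] by simp

lemma compactin_imp_closed: "compactin (ctop C) K \<Longrightarrow> closedin (ctop C) K"
  by (rule compactin_imp_closedin[OF Hausdorff_ctop])

lemma compactin_carrier: "compactin (ctop C) (carrier C)"
  using compact_ctop by (simp add: compact_space_def)

lemma closedin_add:
  assumes "compactin (ctop C) K" "compactin (ctop C) L"
  shows "closedin (ctop C) {x \<oplus> y | x y. x \<in> K \<and> y \<in> L}"
proof -
  have "compactin (prod_topology (ctop C) (ctop C)) (K \<times> L)"
    using assms by (simp add: compactin_Times)
  from image_compactin[OF this continuous_add]
  have "compactin (ctop C) ((\<lambda>(x, y). x \<oplus> y) ` (K \<times> L))" .
  moreover have "(\<lambda>(x, y). x \<oplus> y) ` (K \<times> L) = {x \<oplus> y | x y. x \<in> K \<and> y \<in> L}"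
    by auto
  ultimately show ?thesis by (simp add: compactin_imp_closed)
qed

lemma closedin_above:
  assumes "a \<in> carrier C" shows "closedin (ctop C) {v \<in> carrier C. a \<preceq> v}"
proof -
  have "{v \<in> carrier C. a \<preceq> v} = {x \<oplus> y | x y. x \<in> {a} \<and> y \<in> carrier C}"
    using assms by (auto simp: le_iff)
  then show ?thesis
    using closedin_add[of "{a}" "carrier C"] assms compactin_carrier by simp
qed

text \<open>A projection of the closed set of pairs with sum \<open>a\<close>; compactness of the
  product makes the projection closed.\<close>

lemma closedin_below:
  assumes "a \<in> carrier C" shows "closedin (ctop C) {v \<in> carrier C. v \<preceq> a}"
proof -
  let ?T = "prod_topology (ctop C) (ctop C)"
  have "closedin (ctop C) {a}"
    using assms by (intro compactin_imp_closed) simp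
  from closedin_continuous_map_preimage[OF continuous_add this]
  have "closedin ?T {p \<in> topspace ?T. (case p of (x, y) \<Rightarrow> x \<oplus> y) \<in> {a}}" .
  then have "compactin ?T {p \<in> topspace ?T. (case p of (x, y) \<Rightarrow> x \<oplus> y) \<in> {a}}"
    using compact_ctop by (intro closedin_compact_space) (simp_all add: compact_space_prod_topology)
  from image_compactin[OF this continuous_map_fst]
  have "closedin (ctop C) (fst ` {p \<in> topspace ?T. (case p of (x, y) \<Rightarrow> x \<oplus> y) \<in> {a}})"
    by (rule compactin_imp_closed)
  moreover have "fst ` {p \<in> topspace ?T. (case p of (x, y) \<Rightarrow> x \<oplus> y) \<in> {a}}
      = {v \<in> carrier C. v \<preceq> a}" (is "?L = ?R")
  proof
    show "?L \<subseteq> ?R" by (auto simp: le_iff)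
    show "?R \<subseteq> ?L"
    proof
      fix v assume "v \<in> ?R"
      then obtain z where "v \<in> carrier C" "z \<in> carrier C" "v \<oplus> z = a" by (auto simp: le_iff)
      then show "v \<in> ?L" by (intro image_eqI[of _ _ "(v, z)"]) auto
    qed
  qed
  ultimately show ?thesis by simp
qed

lemma compact_fip:
  assumes "\<And>S. S \<in> U \<Longrightarrow> closedin (ctop C) S" "\<And>F. finite F \<Longrightarrow> F \<subseteq> U \<Longrightarrow> \<Inter>F \<noteq> {}"
  shows "\<Inter>U \<noteq> {}"
  using compact_ctop assms unfolding compact_space_fip by (elim allE[of _ U]) auto

text \<open>Finite intersection property: finitely many of the sets in \<open>U\<close> all contain
  every member of \<open>A\<close> below some \<open>c\<close> in \<open>A\<close>. A point common
  to all of \<open>U\<close> is a lower bound, dominates the other lower bounds, and is adherent to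
  \<open>A\<close>.\<close>

lemma directed_inf:
  assumes A: "A \<subseteq> carrier C" "A \<noteq> {}"
    and dir: "\<And>a b. a \<in> A \<Longrightarrow> b \<in> A \<Longrightarrow> \<exists>c\<in>A. c \<preceq> a \<and> c \<preceq> b"
  shows "\<exists>e\<in>carrier C. (\<forall>a\<in>A. e \<preceq> a) \<and> (\<forall>v\<in>carrier C. (\<forall>a\<in>A. v \<preceq> a) \<longrightarrow> v \<preceq> e)
     \<and> (\<forall>B. closedin (ctop C) B \<longrightarrow> A \<subseteq> B \<longrightarrow> e \<in> B)"
proof -
  define U where "U = (\<lambda>a. {v \<in> carrier C. v \<preceq> a}) ` A
    \<union> (\<lambda>u. {v \<in> carrier C. u \<preceq> v}) ` {u \<in> carrier C. \<forall>a\<in>A. u \<preceq> a}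
    \<union> {B. closedin (ctop C) B \<and> A \<subseteq> B}"
  have closed: "closedin (ctop C) S" if "S \<in> U" for S
    using that A by (auto simp: U_def intro: closedin_above closedin_below)
  have one: "\<exists>c\<in>A. \<forall>d\<in>A. d \<preceq> c \<longrightarrow> d \<in> S" if "S \<in> U" for S
    using that A by (auto simp: U_def)
  have fin: "\<exists>c\<in>A. \<forall>d\<in>A. d \<preceq> c \<longrightarrow> d \<in> \<Inter>F" if "finite F" "F \<subseteq> U" for F
    using that
  proof (induction F)
    case empty
    then show ?case using A by auto
  next
    case (insert S F)
    obtain c where c: "c \<in> A" "\<forall>d\<in>A. d \<preceq> c \<longrightarrow> d \<in> \<Inter>F"
      using insert by auto
    obtain c' where c': "c' \<in> A" "\<forall>d\<in>A. d \<preceq> c' \<longrightarrow> d \<in> S"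
      using one[of S] insert by auto
    obtain b where b: "b \<in> A" "b \<preceq> c" "b \<preceq> c'"
      using dir c c' by blast
    have "\<forall>d\<in>A. d \<preceq> b \<longrightarrow> d \<in> \<Inter>(insert S F)"
    proof (intro ballI impI)
      fix d assume d: "d \<in> A" "d \<preceq> b"
      then have "d \<preceq> c" "d \<preceq> c'"
        using b le_trans[of d b] A by auto
      then show "d \<in> \<Inter>(insert S F)" using c c' d by auto
    qed
    then show ?case using b by blast
  qed
  have "\<Inter>F \<noteq> {}" if F: "finite F" "F \<subseteq> U" for F
  proof -
    obtain c where "c \<in> A" "\<forall>d\<in>A. d \<preceq> c \<longrightarrow> d \<in> \<Inter>F"
      using fin[OF F] by (elim bexE)
    moreover have "c \<preceq> c" using \<open>c \<in> A\<close> A by (intro le_refl) (rule subsetD)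
    ultimately have "c \<in> \<Inter>F" by simp
    then show ?thesis by (metis empty_iff)
  qed
  then have "\<Inter>U \<noteq> {}"
    by (intro compact_fip[where U = U] closed)
  then obtain e where e: "\<And>S. S \<in> U \<Longrightarrow> e \<in> S" by blast
  obtain a where a: "a \<in> A" using A by blast
  have 1: "e \<in> carrier C \<and> e \<preceq> a" if "a \<in> A" for a
    using e[of "{v \<in> carrier C. v \<preceq> a}"] that by (auto simp: U_def)
  have 2: "u \<preceq> e" if "u \<in> carrier C" "\<forall>a\<in>A. u \<preceq> a" for u
    using e[of "{v \<in> carrier C. u \<preceq> v}"] that by (auto simp: U_def)
  have 3: "e \<in> B" if "closedin (ctop C) B" "A \<subseteq> B" for B
    using e[of B] that by (auto simp: U_def)
  show ?thesis using 1 2 3 a by blast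
qed

text \<open>Compactness gives the support idempotent as the infimum of the ray through \<open>x\<close>.\<close>

lemma supp_idem_exists:
  assumes x: "x \<in> carrier C"
  shows "\<exists>e. greatest (alg_order C) e {z \<in> carrier C. x \<oplus> z = x} \<and> e \<in> carrier C
    \<and> (\<forall>t>0. e \<preceq> t \<star> x) \<and> (\<forall>v\<in>carrier C. (\<forall>t>0. v \<preceq> t \<star> x) \<longrightarrow> v \<preceq> e)
    \<and> (\<forall>B. closedin (ctop C) B \<longrightarrow> (\<forall>t>0. \<exists>s>0. s \<le> t \<and> s \<star> x \<in> B) \<longrightarrow> e \<in> B)"
proof -
  have inf: "\<exists>e\<in>carrier C. (\<forall>a\<in>A. e \<preceq> a) \<and> (\<forall>v\<in>carrier C. (\<forall>a\<in>A. v \<preceq> a) \<longrightarrow> v \<preceq> e)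
     \<and> (\<forall>B. closedin (ctop C) B \<longrightarrow> A \<subseteq> B \<longrightarrow> e \<in> B)"
    if A: "A = (\<lambda>s. s \<star> x) ` I" "I \<noteq> {}" "I \<subseteq> {0<..}" for A I
  proof (rule directed_inf)
    show "\<exists>c\<in>A. c \<preceq> a \<and> c \<preceq> b" if "a \<in> A" "b \<in> A" for a b
    proof -
      from that(1) obtain s where s: "s \<in> I" "a = s \<star> x" unfolding A(1) by (rule imageE)
      from that(2) obtain t where t: "t \<in> I" "b = t \<star> x" unfolding A(1) by (rule imageE)
      note st = s(1) t(1) s(2) t(2)
      have "min s t \<star> x \<preceq> a" "min s t \<star> x \<preceq> b"
        using st subsetD[OF A(3) st(1)] subsetD[OF A(3) st(2)] x by (auto intro!: scale0_mono_left)
      then show ?thesis using st A by (metis imageI min_def)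
    qed
  qed (use A x in auto)
  obtain e where e: "e \<in> carrier C" "\<And>t. 0 < t \<Longrightarrow> e \<preceq> t \<star> x"
    "\<And>v. v \<in> carrier C \<Longrightarrow> (\<And>t. 0 < t \<Longrightarrow> v \<preceq> t \<star> x) \<Longrightarrow> v \<preceq> e"
    using inf[of "(\<lambda>s. s \<star> x) ` {0<..}" "{0<..}"] by auto
  \<comment> \<open>The multiples of \<open>x\<close> lying in \<open>B\<close> are cofinal towards
    \<open>0\<close>, so they have the same infimum as the whole ray; \<open>directed_inf\<close>
    applied to these multiples alone puts it into \<open>B\<close>.\<close>
  have cl: "e \<in> B" if B: "closedin (ctop C) B" "\<And>t. t > 0 \<Longrightarrow> \<exists>s>0. s \<le> t \<and> s \<star> x \<in> B" for B
  proof -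
    define I where "I = {s. 0 < s \<and> s \<star> x \<in> B}"
    have "I \<noteq> {}" using B(2)[of 1] by (auto simp: I_def)
    have "I \<subseteq> {0<..}" "(\<lambda>s. s \<star> x) ` I \<subseteq> B" by (auto simp: I_def)
    obtain e' where e'_inf: "e' \<in> carrier C" "\<forall>a\<in>(\<lambda>s. s \<star> x) ` I. e' \<preceq> a"
      "\<forall>B. closedin (ctop C) B \<longrightarrow> (\<lambda>s. s \<star> x) ` I \<subseteq> B \<longrightarrow> e' \<in> B"
      "\<forall>v\<in>carrier C. (\<forall>a\<in>(\<lambda>s. s \<star> x) ` I. v \<preceq> a) \<longrightarrow> v \<preceq> e'"
      using inf[of "(\<lambda>s. s \<star> x) ` I" I, OF refl \<open>I \<noteq> {}\<close> \<open>I \<subseteq> {0<..}\<close>]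
      by (elim bexE conjE) (rule that)
    then have e': "e' \<in> carrier C" "\<And>s. s \<in> I \<Longrightarrow> e' \<preceq> s \<star> x"
      "\<And>v. v \<in> carrier C \<Longrightarrow> (\<And>s. s \<in> I \<Longrightarrow> v \<preceq> s \<star> x) \<Longrightarrow> v \<preceq> e'" "e' \<in> B"
      using B(1) \<open>(\<lambda>s. s \<star> x) ` I \<subseteq> B\<close> by auto
    have "e' \<preceq> e"
    proof (rule e(3)[OF e'(1)])
      fix t :: real assume "0 < t"
      then obtain s where s: "0 < s" "s \<le> t" "s \<star> x \<in> B" using B(2) by blast
      then have "e' \<preceq> s \<star> x" using e'(2) by (simp add: I_def)
      moreover have "s \<star> x \<preceq> t \<star> x" using s x by (intro scale0_mono_left) auto
      ultimately show "e' \<preceq> t \<star> x" using e'(1) le_trans by blast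
    qed
    moreover have "e \<preceq> e'" using e' e by (auto simp: I_def)
    ultimately show ?thesis using e e' le_antisym by metis
  qed
  have abs: "x \<oplus> e = x"
  proof (rule le_antisym)
    \<comment> \<open>For \<open>r > 1\<close> the summand \<open>e\<close> is absorbed by
      \<open>(r - 1) \<star> x\<close>. The set \<open>T\<close> of all such \<open>r\<close> is
      closed in the positive reals, which gives the case \<open>r = 1\<close>.\<close>
    have "x \<oplus> e \<preceq> r \<star> x" if "1 < r" for r
    proof -
      have "x \<oplus> e \<preceq> x \<oplus> (r - 1) \<star> x"
        using e x that by (intro add_mono le_refl) auto
      then show ?thesis using scale0_add_left[of 1 "r - 1" x] x that by simp
    qed
    moreover
    define T where "T = {r \<in> topspace (top_of_set {0<..}). r \<odot> x \<in> {v \<in> carrier C. x \<oplus> e \<preceq> v}}"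
    have "continuous_map (top_of_set {0<..}) (ctop C) (\<lambda>r. case (r, x) of (t, x) \<Rightarrow> t \<odot> x)"
      using continuous_map_compose[OF _ continuous_scale, of "top_of_set {0<..}" "\<lambda>r. (r, x)"] x
      by (simp add: o_def continuous_map_pairedI)
    then have "closedin (top_of_set {0<..}) T"
      using closedin_continuous_map_preimage[OF _ closedin_above, of "top_of_set {0<..}" "\<lambda>r. r \<odot> x" "x \<oplus> e"] e x
      by (simp add: T_def)
    then obtain K where K: "closed K" "T = {0<..} \<inter> K" by (auto simp: closedin_closed)
    ultimately have "{1<..} \<subseteq> K" using x
      unfolding K(2)[symmetric]
      by (metis (no_types, lifting) IntE K(2) T_def greaterThan_iff less_trans mem_Collect_eq scale_closed scale0_pos subsetI topspace_euclidean_subtopology zero_less_one)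
    then have "closure {1::real<..} \<subseteq> K" using K by (intro closure_minimal)
    then have "1 \<in> K" by auto
    then have "1 \<in> T" using K by simp
    then show "x \<oplus> e \<preceq> x" using x by (simp add: T_def scale_one)
  qed (use e x in \<open>auto simp: le_add1\<close>)
  \<comment> \<open>An absorbed \<open>z\<close> can be absorbed any number of times, so all its
    multiples lie below \<open>x\<close>, and \<open>z\<close> lies below all multiples of
    \<open>x\<close>.\<close>
  have "z \<preceq> e" if z: "z \<in> carrier C" "x \<oplus> z = x" for z
  proof (rule e(3)[OF z(1)])
    fix t :: real assume "0 < t"
    have *: "x \<oplus> real n \<star> z = x" for n
    proof (induction n)
      case (Suc n)
      have "x \<oplus> real (Suc n) \<star> z = (x \<oplus> real n \<star> z) \<oplus> z"
        using scale0_add_left[of "real n" 1 z] x z by (simp add: a_assoc add.commute)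
      then show ?case using Suc z by simp
    qed (use x in simp)
    obtain n where "1 / t \<le> real n" using real_arch_simple by blast
    then have "(1/t) \<star> z \<preceq> real n \<star> z" using z \<open>0 < t\<close> by (intro scale0_mono_left) auto
    also have "real n \<star> z \<preceq> x" using *[of n] le_add2[of x "real n \<star> z"] x z by simp
    finally have "(1/t) \<star> z \<preceq> x" using z by simp
    then show "z \<preceq> t \<star> x"
      using scale0_le_iff[of "1/t" z x] \<open>0 < t\<close> x z by simp
  qed
  then have "greatest (alg_order C) e {z \<in> carrier C. x \<oplus> z = x}"
    using e abs by (auto simp: greatest_def carrier_alg_order)
  then show ?thesis using e cl by blast
qed

section \<open>Calculus of the support idempotent\<close>

abbreviation eps :: "'a \<Rightarrow> 'a" (\<open>\<epsilon>\<close>) where "\<epsilon> \<equiv> supp_idem C"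

lemma supp_idem_props:
  assumes x: "x \<in> carrier C"
  shows "greatest (alg_order C) (\<epsilon> x) {z \<in> carrier C. x \<oplus> z = x} \<and> \<epsilon> x \<in> carrier C
    \<and> (\<forall>t>0. \<epsilon> x \<preceq> t \<star> x) \<and> (\<forall>v\<in>carrier C. (\<forall>t>0. v \<preceq> t \<star> x) \<longrightarrow> v \<preceq> \<epsilon> x)
    \<and> (\<forall>B. closedin (ctop C) B \<longrightarrow> (\<forall>t>0. \<exists>s>0. s \<le> t \<and> s \<star> x \<in> B) \<longrightarrow> \<epsilon> x \<in> B)"
proof -
  from supp_idem_exists[OF x] obtain e where
    e: "greatest (alg_order C) e {z \<in> carrier C. x \<oplus> z = x}" "e \<in> carrier C"
      "(\<forall>t>0. e \<preceq> t \<star> x) \<and> (\<forall>v\<in>carrier C. (\<forall>t>0. v \<preceq> t \<star> x) \<longrightarrow> v \<preceq> e)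
    \<and> (\<forall>B. closedin (ctop C) B \<longrightarrow> (\<forall>t>0. \<exists>s>0. s \<le> t \<and> s \<star> x \<in> B) \<longrightarrow> e \<in> B)"
    by blast
  have "\<epsilon> x = e"
    unfolding supp_idem_def
  proof (rule the_equality)
    fix e' assume "greatest (alg_order C) e' {z \<in> carrier C. x \<oplus> z = x}"
    then show "e' = e" using e(1)
      by (intro le_antisym) (auto simp: greatest_def carrier_alg_order)
  qed (use e in blast)
  then show ?thesis using e by blast
qed

lemma supp_closed [simp]: "x \<in> carrier C \<Longrightarrow> \<epsilon> x \<in> carrier C"
  and supp_le_scale0: "x \<in> carrier C \<Longrightarrow> 0 < t \<Longrightarrow> \<epsilon> x \<preceq> t \<star> x"
  and supp_greatest: "\<lbrakk>x \<in> carrier C; v \<in> carrier C; \<And>t. 0 < t \<Longrightarrow> v \<preceq> t \<star> x\<rbrakk> \<Longrightarrow> v \<preceq> \<epsilon> x"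
  and supp_in_closed: "\<lbrakk>x \<in> carrier C; closedin (ctop C) B;
    \<And>t. 0 < t \<Longrightarrow> \<exists>s>0. s \<le> t \<and> s \<star> x \<in> B\<rbrakk> \<Longrightarrow> \<epsilon> x \<in> B"
  using supp_idem_props by blast+

lemma supp_absorb [simp]: "x \<in> carrier C \<Longrightarrow> x \<oplus> \<epsilon> x = x"
  using supp_idem_props[of x] by (auto simp: greatest_def)

lemma supp_max: "\<lbrakk>x \<in> carrier C; z \<in> carrier C; x \<oplus> z = x\<rbrakk> \<Longrightarrow> z \<preceq> \<epsilon> x"
  using supp_idem_props[of x] by (auto simp: greatest_def)

lemma supp_le: "x \<in> carrier C \<Longrightarrow> \<epsilon> x \<preceq> x"
  using supp_le_scale0[of x 1] by simp

lemma supp_idems [simp]: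
  assumes "x \<in> carrier C" shows "\<epsilon> x \<in> idems C"
proof -
  have "x \<oplus> (\<epsilon> x \<oplus> \<epsilon> x) = x"
    using assms by (simp add: a_assoc[symmetric])
  then have "\<epsilon> x \<oplus> \<epsilon> x \<preceq> \<epsilon> x" using assms by (simp add: supp_max)
  then have "\<epsilon> x \<oplus> \<epsilon> x = \<epsilon> x"
    using assms by (intro le_antisym) (auto simp: le_add1)
  then show ?thesis using assms by (simp add: idems_iff)
qed

lemma supp_of_idem [simp]:
  assumes "w \<in> idems C" shows "\<epsilon> w = w"
  using assms supp_max[of w w] supp_le[of w]
  by (intro le_antisym) (auto simp: idems_iff)

lemma supp_mono:
  assumes "x \<preceq> y" "x \<in> carrier C" "y \<in> carrier C" shows "\<epsilon> x \<preceq> \<epsilon> y"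
proof (rule supp_greatest)
  fix t :: real assume "0 < t"
  then have "\<epsilon> x \<preceq> t \<star> x" using assms by (intro supp_le_scale0)
  also have "t \<star> x \<preceq> t \<star> y" using assms by (intro scale0_mono)
  finally show "\<epsilon> x \<preceq> t \<star> y" using assms by simp
qed (use assms in auto)

text \<open>Two limits taken one after the other: \<open>\<epsilon> (x \<oplus> y)\<close> lies
  below \<open>t \<star> x \<oplus> s \<star> y\<close> for all positive \<open>s\<close> and
  \<open>t\<close>, and each of the two scalars is sent to \<open>0\<close> by
  \<open>supp_in_closed\<close>.\<close>

lemma supp_add:
  assumes x: "x \<in> carrier C" and y: "y \<in> carrier C" shows "\<epsilon> (x \<oplus> y) = \<epsilon> x \<oplus> \<epsilon> y"
proof (rule le_antisym)
  let ?v = "\<epsilon> (x \<oplus> y)"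
  have v: "?v \<in> carrier C" using x y by simp
  have closed: "closedin (ctop C) {u \<in> carrier C. u \<oplus> c \<in> {z \<in> carrier C. ?v \<preceq> z}}"
    if "c \<in> carrier C" for c
    using v that by (intro closedin_preimage continuous_map_add_const closedin_above)
  have 1: "?v \<preceq> t \<star> x \<oplus> s \<star> y" if "0 < s" "0 < t" for s t
  proof -
    have "?v \<preceq> min s t \<star> (x \<oplus> y)" using x y that by (intro supp_le_scale0) auto
    also have "min s t \<star> (x \<oplus> y) = min s t \<star> x \<oplus> min s t \<star> y"
      using x y by (simp add: scale0_add_right)
    also have "min s t \<star> x \<oplus> min s t \<star> y \<preceq> t \<star> x \<oplus> s \<star> y"
      using x y that by (intro add_mono scale0_mono_left) auto
    finally show ?thesis using v by simp
  qed
  have 2: "?v \<preceq> \<epsilon> x \<oplus> s \<star> y" if "0 < s" for s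
  proof -
    have "\<epsilon> x \<in> {u \<in> carrier C. u \<oplus> s \<star> y \<in> {z \<in> carrier C. ?v \<preceq> z}}"
      using x y 1[OF that] by (intro supp_in_closed[OF _ closed]) auto
    then show ?thesis by simp
  qed
  have "\<epsilon> y \<in> {u \<in> carrier C. u \<oplus> \<epsilon> x \<in> {z \<in> carrier C. ?v \<preceq> z}}"
    using x y 2 by (intro supp_in_closed[OF _ closed]) (auto simp: a_comm)
  then show "?v \<preceq> \<epsilon> x \<oplus> \<epsilon> y" using x y by (simp add: a_comm)
next
  show "\<epsilon> x \<oplus> \<epsilon> y \<preceq> \<epsilon> (x \<oplus> y)"
    using x y by (intro idem_lub supp_mono le_add1 le_add2) auto
qed (use x y in auto)

lemma supp_zero [simp]: "\<epsilon> \<zero> = \<zero>"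
  by (simp add: zero_idems)

lemma supp_scale0 [simp]:
  assumes "x \<in> carrier C" "0 < t" shows "\<epsilon> (t \<star> x) = \<epsilon> x"
proof (rule le_antisym)
  have *: "s \<star> t \<star> x = (s * t) \<star> x" if "0 < s" for s
    using assms that by (simp add: scale0_scale0)
  have "\<epsilon> (t \<star> x) \<preceq> s \<star> x" if "0 < s" for s
    using supp_le_scale0[of "t \<star> x" "s / t"] *[of "s / t"] assms that by simp
  then show "\<epsilon> (t \<star> x) \<preceq> \<epsilon> x" using assms by (intro supp_greatest) auto
  show "\<epsilon> x \<preceq> \<epsilon> (t \<star> x)"
    using assms * by (intro supp_greatest) (auto simp: supp_le_scale0)
qed (use assms in auto)

lemma supp_comb_le:
  assumes w: "w \<in> idems C" and S: "S \<subseteq> carrier C" "\<And>x. x \<in> S \<Longrightarrow> 0 < a x \<Longrightarrow> \<epsilon> x \<preceq> w"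
  shows "\<epsilon> (comb a S) \<preceq> w"
proof (cases "finite S")
  case True
  then show ?thesis using S
  proof (induction S)
    case (insert x F)
    have "\<epsilon> (a x \<star> x) \<preceq> w"
      using insert.prems w by (cases "0 < a x") (simp_all add: scale0_nonpos zero_le idems_closed)
    then show ?case using insert w
      by (simp add: Pi_def subset_eq supp_add idem_lub)
  qed (use w in \<open>simp add: zero_le idems_closed\<close>)
next
  case False
  then show ?thesis using w by (simp add: finsum_infinite zero_le idems_closed)
qed

lemma supp_comb_add:
  assumes "w \<in> idems C" "S \<subseteq> carrier C" "\<And>x. x \<in> S \<Longrightarrow> 0 < a x \<Longrightarrow> \<epsilon> x \<preceq> w"
  shows "\<epsilon> (comb a S \<oplus> w) = w"
proof -
  have "\<epsilon> (comb a S) \<preceq> w" using assms by (rule supp_comb_le)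
  then show ?thesis
    using assms by (simp add: supp_add idems_closed le_idem_absorb)
qed

text \<open>Otherwise the closed complement of \<open>U\<close> would contain arbitrarily small
  multiples of \<open>x\<close>, hence \<open>\<epsilon> x\<close>. This is the convergence of the
  ray to \<open>\<epsilon> x\<close>.\<close>

lemma scale0_small_in_open:
  assumes "x \<in> carrier C" "openin (ctop C) U" "\<epsilon> x \<in> U"
  shows "\<exists>t>0. \<forall>s. 0 < s \<and> s \<le> t \<longrightarrow> s \<star> x \<in> U"
proof (rule ccontr)
  assume "\<not> ?thesis"
  then have *: "\<exists>s>0. s \<le> t \<and> s \<star> x \<notin> U" if "0 < t" for t using that by blast
  have "\<epsilon> x \<in> carrier C - U"
  proof (rule supp_in_closed)
    show "closedin (ctop C) (carrier C - U)"
      using assms by (simp add: closedin_def openin_subset Diff_Diff_Int Int_absorb1 flip: topspace_C)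
  qed (use * assms in auto)
  then show False using assms by blast
qed

text \<open>Iterating the hypothesis gives \<open>n\<close> copies of \<open>x\<close> plus one
  \<open>z\<close> below \<open>n\<close> copies of \<open>y\<close> plus one \<open>z\<close>.
  Division by \<open>n\<close> shrinks the single \<open>z\<close>: on the left it still dominates
  \<open>\<epsilon> z\<close>, on the right it converges to \<open>\<epsilon> z\<close>.\<close>

lemma le_cancel:
  assumes x: "x \<in> carrier C" and y: "y \<in> carrier C" and z: "z \<in> carrier C"
    and le: "x \<oplus> z \<preceq> y \<oplus> z"
  shows "x \<oplus> \<epsilon> z \<preceq> y \<oplus> \<epsilon> z"
proof -
  have *: "real n \<star> x \<oplus> z \<preceq> real n \<star> y \<oplus> z" for n
  proof (induction n)
    case (Suc n)
    have "real (Suc n) \<star> x \<oplus> z = real n \<star> x \<oplus> (x \<oplus> z)"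
      using scale0_add_left[of "real n" 1 x] x z by (simp add: a_assoc add.commute)
    also have "real n \<star> x \<oplus> (x \<oplus> z) \<preceq> real n \<star> x \<oplus> (y \<oplus> z)"
      using x y z by (intro add_mono[OF le_refl le]) auto
    also have "real n \<star> x \<oplus> (y \<oplus> z) = (real n \<star> x \<oplus> z) \<oplus> y"
      using x y z by (simp add: a_ac)
    also have "(real n \<star> x \<oplus> z) \<oplus> y \<preceq> (real n \<star> y \<oplus> z) \<oplus> y"
      using x y z by (intro add_mono[OF Suc le_refl]) auto
    also have "(real n \<star> y \<oplus> z) \<oplus> y = real (Suc n) \<star> y \<oplus> z"
      using scale0_add_left[of "real n" 1 y] y z by (simp add: a_ac add.commute)
    finally show ?case using x y z by simp
  qed (use z le_refl in simp)
  have **: "x \<oplus> \<epsilon> z \<preceq> y \<oplus> t \<star> z" if "0 < t" for t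
  proof -
    obtain n where n: "1 / t \<le> real n" "0 < n"
    proof -
      obtain n where "1 / t \<le> real n" using real_arch_simple by blast
      then show ?thesis using that[of "Suc n"] by simp
    qed
    have "x \<oplus> \<epsilon> z \<preceq> x \<oplus> (1 / real n) \<star> z"
      using x z n by (intro add_mono le_refl supp_le_scale0) auto
    also have "x \<oplus> (1 / real n) \<star> z = (1 / real n) \<star> (real n \<star> x \<oplus> z)"
      using x z n by (simp add: scale0_add_right scale0_scale0)
    also have "\<dots> \<preceq> (1 / real n) \<star> (real n \<star> y \<oplus> z)"
      using x z by (intro scale0_mono *) auto
    also have "\<dots> = y \<oplus> (1 / real n) \<star> z"
      using y z n by (simp add: scale0_add_right scale0_scale0)
    also have "\<dots> \<preceq> y \<oplus> t \<star> z"
      using y z n that by (intro add_mono le_refl scale0_mono_left) (auto simp: field_simps)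
    finally show ?thesis using x z by simp
  qed
  have "\<epsilon> z \<in> {u \<in> carrier C. u \<oplus> y \<in> {v \<in> carrier C. x \<oplus> \<epsilon> z \<preceq> v}}"
    using x y z ** by (intro supp_in_closed[OF _ closedin_preimage[OF continuous_map_add_const closedin_above]])
      (auto simp: a_comm)
  then show ?thesis using y z by (simp add: a_comm)
qed

text \<open>If \<open>r < s\<close>, then \<open>r \<star> x \<oplus> w\<close>, whose support
  idempotent is \<open>w\<close>, can be cancelled. What remains is
  \<open>(s - r) \<star> x \<preceq> w\<close>, against \<open>\<not> x \<preceq> w\<close>.\<close>

lemma scale0_add_idem_le_cancel:
  assumes x: "x \<in> carrier C" and w: "w \<in> idems C" and "\<epsilon> x \<preceq> w" "\<not> x \<preceq> w"
    and le: "s \<star> x \<oplus> w \<preceq> r \<star> x \<oplus> w" and "0 \<le> r" "0 \<le> s"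
  shows "s \<le> r"
proof (rule ccontr)
  assume "\<not> s \<le> r"
  have wC: "w \<in> carrier C" using w by (rule idems_closed)
  let ?z = "r \<star> x \<oplus> w"
  have "\<epsilon> (r \<star> x) \<preceq> w"
    using assms wC by (cases "r = 0") (auto simp: zero_le)
  then have ez: "\<epsilon> ?z = w"
    using w x wC by (simp add: supp_add le_idem_absorb)
  have "(s - r) \<star> x \<oplus> ?z = s \<star> x \<oplus> w"
    using scale0_add_left[of "s - r" r x] assms \<open>\<not> s \<le> r\<close> wC by (simp add: a_assoc)
  then have "(s - r) \<star> x \<oplus> \<epsilon> ?z \<preceq> \<zero> \<oplus> \<epsilon> ?z"
    using le x wC by (intro le_cancel) auto
  then have "(s - r) \<star> x \<oplus> w \<preceq> w" using ez wC by simp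
  then have "(s - r) \<star> x \<preceq> w"
    using le_add1[of "(s - r) \<star> x" w] le_trans x wC by (metis scale0_closed)
  then show False
    using \<open>\<not> s \<le> r\<close> \<open>\<not> x \<preceq> w\<close> scale0_le_idem_iff[OF w x, of "s - r"] by simp
qed

text \<open>The up-sets are closed, and a finite sum lies in any finitely many of them. The top
  element will be the support of the zero function.\<close>

lemma exists_top: "\<exists>w\<in>carrier C. \<forall>x\<in>carrier C. x \<preceq> w"
proof -
  have "\<Inter>((\<lambda>u. {v \<in> carrier C. u \<preceq> v}) ` carrier C) \<noteq> {}"
  proof -
    have *: "\<exists>c\<in>carrier C. \<forall>S\<in>F. c \<in> S"
      if "finite F" "F \<subseteq> (\<lambda>u. {v \<in> carrier C. u \<preceq> v}) ` carrier C" for F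
      using that
    proof (induction F)
      case (insert S F)
      then obtain c u where "c \<in> carrier C" "\<forall>S\<in>F. c \<in> S" "u \<in> carrier C" "S = {v \<in> carrier C. u \<preceq> v}"
        by auto
      moreover have "c \<oplus> u \<in> S'" if "S' \<in> F" for S'
      proof -
        have "S' \<in> (\<lambda>u. {v \<in> carrier C. u \<preceq> v}) ` carrier C"
          using insert.prems(1) that by (auto simp only: subset_iff insert_iff)
        then obtain u' where u': "u' \<in> carrier C" "S' = {v \<in> carrier C. u' \<preceq> v}"
          by (rule imageE)
        then have "u' \<preceq> c" using \<open>\<forall>S\<in>F. c \<in> S\<close> that by auto
        then show ?thesis using u' le_trans[OF _ le_add1] \<open>c \<in> carrier C\<close> \<open>u \<in> carrier C\<close> by auto
      qed
      ultimately show ?case by (intro bexI[of _ "c \<oplus> u"]) (auto simp: le_add2)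
    qed auto
    then have "\<Inter>F \<noteq> {}"
      if "finite F" "F \<subseteq> (\<lambda>u. {v \<in> carrier C. u \<preceq> v}) ` carrier C" for F
    proof -
      from *[OF that] obtain c where "\<forall>S\<in>F. c \<in> S" by (rule bexE)
      then have "c \<in> \<Inter>F" by simp
      then show ?thesis by (metis empty_iff)
    qed
    then show ?thesis by (rule compact_fip[rotated]) (auto simp: closedin_above)
  qed
  then obtain w where "\<And>u. u \<in> carrier C \<Longrightarrow> w \<in> carrier C \<and> u \<preceq> w" by blast
  then show ?thesis using zero_closed by blast
qed

lemma exists_top_idem: "\<exists>w\<in>idems C. \<forall>x\<in>carrier C. x \<preceq> w"
proof -
  obtain w where w: "w \<in> carrier C" "\<forall>x\<in>carrier C. x \<preceq> w" using exists_top by blast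
  then have "w \<oplus> w = w" by (intro le_antisym) (auto simp: le_add1)
  then show ?thesis using w by (auto simp: idems_iff)
qed

text \<open>The extensions form a closed set, the preimage of a point, and are stable under meets
  because addition distributes over them. Hence their infimum is again an extension.\<close>

lemma min_extension_props:
  assumes w: "w \<in> idems C" and x: "x \<in> carrier C" "\<epsilon> x = w"
  defines "m \<equiv> min_extension C w x"
  shows "m \<in> carrier C" "m \<oplus> w = x" "\<And>z. z \<in> carrier C \<Longrightarrow> z \<oplus> w = x \<Longrightarrow> m \<preceq> z"
proof -
  let ?A = "{z \<in> carrier C. z \<oplus> w = x}"
  have wC: "w \<in> carrier C" using w by (rule idems_closed)
  have closed: "closedin (ctop C) ?A"
    using closedin_preimage[OF continuous_map_add_const[OF wC], of "{x}"] x
    by (simp add: compactin_imp_closed)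
  have ne: "x \<in> ?A" using supp_absorb[of x] x by auto
  have "\<exists>e\<in>carrier C. (\<forall>a\<in>?A. e \<preceq> a) \<and> (\<forall>v\<in>carrier C. (\<forall>a\<in>?A. v \<preceq> a) \<longrightarrow> v \<preceq> e)
     \<and> (\<forall>B. closedin (ctop C) B \<longrightarrow> ?A \<subseteq> B \<longrightarrow> e \<in> B)"
  proof (rule directed_inf)
    fix a b assume "a \<in> ?A" "b \<in> ?A"
    then have "a \<sqinter>\<^sub>C b \<in> ?A \<and> a \<sqinter>\<^sub>C b \<preceq> a \<and> a \<sqinter>\<^sub>C b \<preceq> b"
      using wC by (auto simp: meet_add_distrib_right meet_self meet_le)
    then show "\<exists>c\<in>?A. c \<preceq> a \<and> c \<preceq> b" by blast
  qed (use ne in auto)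
  then obtain e where "\<forall>a\<in>?A. e \<preceq> a" "\<forall>B. closedin (ctop C) B \<longrightarrow> ?A \<subseteq> B \<longrightarrow> e \<in> B"
    by (elim bexE conjE)
  then have e: "e \<in> ?A" "\<And>a. a \<in> ?A \<Longrightarrow> e \<preceq> a"
    using closed by (simp_all only: subset_refl simp_thms Ball_def)
  have e_greatest: "greatest (alg_order C) e (Lower (alg_order C) ?A)"
    using e by (auto simp: greatest_def Lower_def carrier_alg_order)
  have "m = e"
    unfolding m_def min_extension_def Lattice.inf_def
  proof (rule some_equality[where P = "\<lambda>g. greatest (alg_order C) g (Lower (alg_order C) ?A)", OF e_greatest])
    fix e' assume "greatest (alg_order C) e' (Lower (alg_order C) ?A)"
    then show "e' = e"
      using e_greatest by (intro le_antisym) (auto simp: greatest_def Lower_def carrier_alg_order)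
  qed
  then show "m \<in> carrier C" "m \<oplus> w = x" "\<And>z. z \<in> carrier C \<Longrightarrow> z \<oplus> w = x \<Longrightarrow> m \<preceq> z"
    using e by auto
qed

end

section \<open>Extreme rays\<close>

context extended_choquet_cone
begin

section \<open>Arithmetic modulo an idempotent\<close>

lemma add_cancel:
  assumes "x \<in> carrier C" "y \<in> carrier C" "z \<in> carrier C" "x \<oplus> z = y \<oplus> z"
  shows "x \<oplus> \<epsilon> z = y \<oplus> \<epsilon> z"
  using assms by (intro le_antisym le_cancel) (auto simp: le_refl)

lemma idem_sum_absorb:
  assumes "w \<in> idems C" "a \<in> carrier C" "b \<in> carrier C"
  shows "(a \<oplus> w) \<oplus> (b \<oplus> w) = (a \<oplus> b) \<oplus> w"
proof -
  have wC: "w \<in> carrier C" and ww: "w \<oplus> w = w" using assms by (auto simp: idems_iff)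
  have "(a \<oplus> w) \<oplus> (b \<oplus> w) = (a \<oplus> b) \<oplus> (w \<oplus> w)"
    using wC assms by (metis a_assoc a_comm a_closed)
  then show ?thesis by (simp add: ww)
qed

lemma scale0_add_idem:
  assumes "w \<in> idems C" "a \<in> carrier C" "0 < t"
  shows "t \<star> (a \<oplus> w) = t \<star> a \<oplus> w"
  using assms by (simp add: scale0_add_right scale0_idem idems_closed)

lemma add_le_cong:
  assumes "v \<preceq> w" "v \<in> idems C" "w \<in> idems C" "a \<oplus> v = b \<oplus> v" "a \<in> carrier C" "b \<in> carrier C"
  shows "a \<oplus> w = b \<oplus> w"
proof -
  have vC: "v \<in> carrier C" "w \<in> carrier C" using assms by (auto simp: idems_closed)
  have "v \<oplus> w = w" using assms vC by (simp add: le_idem_absorb)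
  then show ?thesis using assms vC by (metis a_assoc)
qed

lemma supp_add_idem:
  assumes "w \<in> idems C" "a \<in> carrier C" "\<epsilon> a \<preceq> w" shows "\<epsilon> (a \<oplus> w) = w"
  using assms by (simp add: supp_add idems_closed le_idem_absorb)

section \<open>Extreme elements seen from other idempotents\<close>

lemma extreme_extensionD:
  assumes "y \<in> extreme_extensions C"
  obtains v where "v \<in> idems C" "y \<in> carrier C" "\<epsilon> y \<preceq> v" "\<not> y \<preceq> v" "extreme_in C v (y \<oplus> v)"
    "\<And>z. z \<in> carrier C \<Longrightarrow> z \<oplus> v = y \<oplus> v \<Longrightarrow> y \<preceq> z"
proof -
  obtain v x where v: "v \<in> idems C" "extreme_in C v x" "y = min_extension C v x"
    using assms by (auto simp: extreme_extensions_def)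
  then have x: "x \<in> carrier C" "\<epsilon> x = v" "x \<noteq> v"
    by (auto simp: extreme_in_def cone_at_def)
  note y = min_extension_props[OF v(1) x(1,2), folded v(3)]
  have "y \<preceq> x" using le_add1[of y v] y v by (simp add: idems_closed)
  then have "\<epsilon> y \<preceq> v" using supp_mono[of y x] x y by simp
  moreover have "\<not> y \<preceq> v"
    using le_idem_absorb[of v y] v x y by auto
  ultimately show ?thesis using that v y by auto
qed

lemma extreme_extensions_closed: "y \<in> extreme_extensions C \<Longrightarrow> y \<in> carrier C"
  by (elim extreme_extensionD)

lemma extreme_not_le_supp:
  assumes "y \<in> extreme_extensions C" shows "\<not> y \<preceq> \<epsilon> y"
  using assms by (elim extreme_extensionD) (meson le_trans)

text \<open>The gain is proportionality modulo \<open>\<epsilon> y\<close> instead of the larger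
  \<open>v\<close> where \<open>y\<close> is extreme. Modulo \<open>v\<close>, the summands are
  \<open>s\<close> and \<open>t\<close> times \<open>y\<close> with \<open>s + t = 1\<close>.
  Minimality of \<open>y\<close> lifts this to \<open>s \<star> y \<preceq> a\<close> and
  \<open>t \<star> y \<preceq> b\<close>. The two remainders are absorbed by \<open>y\<close>, so
  they lie below \<open>\<epsilon> y\<close>.\<close>

lemma extreme_split:
  assumes y: "y \<in> extreme_extensions C" and "y = a \<oplus> b" and a: "a \<in> carrier C" and b: "b \<in> carrier C"
  obtains s t where "0 \<le> s" "0 \<le> t" "s + t = 1"
    "a \<oplus> \<epsilon> y = s \<star> y \<oplus> \<epsilon> y" "b \<oplus> \<epsilon> y = t \<star> y \<oplus> \<epsilon> y"
proof -
  obtain v where v: "v \<in> idems C" "y \<in> carrier C" "\<epsilon> y \<preceq> v" "\<not> y \<preceq> v" "extreme_in C v (y \<oplus> v)"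
    "\<And>z. z \<in> carrier C \<Longrightarrow> z \<oplus> v = y \<oplus> v \<Longrightarrow> y \<preceq> z"
    by (rule extreme_extensionD[OF y]) blast
  have vC: "v \<in> carrier C" using v by (simp add: idems_closed)
  have in_cone: "c \<oplus> v \<in> cone_at C v" if "c \<in> carrier C" "c \<preceq> y" for c
  proof -
    have "\<epsilon> c \<preceq> \<epsilon> y" using that v by (intro supp_mono)
    then have "\<epsilon> c \<preceq> v" using v that le_trans by (metis supp_closed)
    then show ?thesis using that v vC by (simp add: cone_at_def supp_add_idem)
  qed
  have "a \<preceq> y" "b \<preceq> y" using assms by (auto simp: le_add1 le_add2)
  moreover have sum: "y \<oplus> v = (a \<oplus> v) \<oplus> (b \<oplus> v)"
    using assms v by (simp add: idem_sum_absorb)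
  ultimately have "(a \<oplus> v = v \<or> (\<exists>t>0. a \<oplus> v = t \<odot> (y \<oplus> v))) \<and> (b \<oplus> v = v \<or> (\<exists>t>0. b \<oplus> v = t \<odot> (y \<oplus> v)))"
    using v(5) in_cone[OF a] in_cone[OF b] unfolding extreme_in_def by blast
  moreover have ray: "\<exists>s\<ge>0. c \<oplus> v = s \<star> y \<oplus> v"
    if "c \<oplus> v = v \<or> (\<exists>t>0. c \<oplus> v = t \<odot> (y \<oplus> v))" for c
    using that
  proof
    assume "c \<oplus> v = v" then show ?thesis using vC by (intro exI[of _ 0]) simp
  next
    assume "\<exists>t>0. c \<oplus> v = t \<odot> (y \<oplus> v)"
    then obtain t where "t > 0" "c \<oplus> v = t \<odot> (y \<oplus> v)" by blast
    then show ?thesis using scale0_add_idem[of v y t] v by (intro exI[of _ t]) (simp add: scale0_pos)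
  qed
  ultimately have "\<exists>s\<ge>0. a \<oplus> v = s \<star> y \<oplus> v" "\<exists>t\<ge>0. b \<oplus> v = t \<star> y \<oplus> v"
    by (simp_all only: simp_thms)
  then obtain s t where st: "0 \<le> s" "0 \<le> t" "a \<oplus> v = s \<star> y \<oplus> v" "b \<oplus> v = t \<star> y \<oplus> v"
    by (elim exE conjE)
  have "(s \<star> y \<oplus> v) \<oplus> (t \<star> y \<oplus> v) = (s + t) \<star> y \<oplus> v"
    using st(1,2) v(1,2) by (simp add: idem_sum_absorb scale0_add_left)
  then have eq: "(s + t) \<star> y \<oplus> v = 1 \<star> y \<oplus> v"
    unfolding scale0_1[OF v(2)] sum st(3,4) by (rule sym)
  have "s + t \<le> 1"
    by (rule scale0_add_idem_le_cancel[OF v(2) v(1) v(3,4)]) (use st v(2) vC in \<open>auto simp: eq le_refl\<close>)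
  moreover have "1 \<le> s + t"
    by (rule scale0_add_idem_le_cancel[OF v(2) v(1) v(3,4)]) (use st v(2) vC in \<open>auto simp: eq le_refl\<close>)
  ultimately have st1: "s + t = 1" by simp
  \<comment> \<open>After division by \<open>r\<close>, the element \<open>c\<close> becomes an
    extension of \<open>y \<oplus> v\<close>, and \<open>y\<close> is the least one.\<close>
  have ray_le: "r \<star> y \<preceq> c" if "c \<in> carrier C" "c \<oplus> v = r \<star> y \<oplus> v" "0 \<le> r" for c r
  proof (cases "r = 0")
    case False
    then have r: "0 < r" using that by simp
    have "(1 / r) \<star> c \<oplus> v = (1 / r) \<star> (c \<oplus> v)"
      by (rule scale0_add_idem[symmetric]) (use that(1) v(1) r in auto)
    also have "\<dots> = (1 / r) \<star> (r \<star> y \<oplus> v)" by (simp only: that(2))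
    also have "\<dots> = y \<oplus> v"
      using v(1,2) r by (simp add: scale0_add_idem scale0_inverse)
    finally have "y \<preceq> (1 / r) \<star> c" using v(6)[of "(1 / r) \<star> c"] that by simp
    then show ?thesis using r that v by (simp add: scale0_le_iff)
  qed (use that in \<open>simp add: zero_le\<close>)
  obtain a' where a': "a' \<in> carrier C" "a = s \<star> y \<oplus> a'"
    using ray_le[OF a st(3,1)] by (rule leE)
  obtain b' where b': "b' \<in> carrier C" "b = t \<star> y \<oplus> b'"
    using ray_le[OF b st(4,2)] by (rule leE)
  have "y = (s \<star> y \<oplus> a') \<oplus> (t \<star> y \<oplus> b')" by (rule assms(2)[unfolded a'(2) b'(2)])
  also have "\<dots> = (s \<star> y \<oplus> t \<star> y) \<oplus> (a' \<oplus> b')" using a'(1) b'(1) v(2) by (simp add: a_ac)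
  also have "s \<star> y \<oplus> t \<star> y = y" using st(1,2) st1 v(2) scale0_add_left[of s t y] by simp
  finally have eq: "y = y \<oplus> (a' \<oplus> b')" .
  have le: "a' \<oplus> b' \<preceq> \<epsilon> y"
    by (rule supp_max[OF v(2) _ eq[symmetric]]) (use a'(1) b'(1) in auto)
  then have "a' \<preceq> \<epsilon> y" "b' \<preceq> \<epsilon> y"
    using a'(1) b'(1) le_trans[OF le_add1 le] le_trans[OF le_add2 le] by auto
  then have "a \<oplus> \<epsilon> y = s \<star> y \<oplus> \<epsilon> y" "b \<oplus> \<epsilon> y = t \<star> y \<oplus> \<epsilon> y"
    unfolding a'(2) b'(2) using a'(1) b'(1) v(2) by (simp_all add: a_assoc le_idem_absorb)
  then show ?thesis by (rule that[OF st(1,2) st1])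
qed

text \<open>Divided by \<open>r\<close>, the element \<open>m\<close> is a summand of
  \<open>y\<close>, so \<open>extreme_split\<close> applies to it.\<close>

lemma below_extreme:
  assumes y: "y \<in> extreme_extensions C" and m: "m \<preceq> r \<star> y" "m \<in> carrier C" "0 < r"
    and w: "w \<in> idems C" "\<epsilon> y \<preceq> w"
  shows "\<exists>s\<ge>0. m \<oplus> w = s \<star> y \<oplus> w"
proof -
  have yC: "y \<in> carrier C" using y by (rule extreme_extensions_closed)
  have "(1/r) \<star> m \<preceq> y" using m yC by (simp add: scale0_le_iff)
  then obtain c where c: "c \<in> carrier C" "y = (1/r) \<star> m \<oplus> c" by (rule leE)
  obtain s t where s: "0 \<le> s" "0 \<le> t" "s + t = 1" "(1/r) \<star> m \<oplus> \<epsilon> y = s \<star> y \<oplus> \<epsilon> y"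
    by (rule extreme_split[OF y c(2) scale0_closed[OF m(2)] c(1)])
  then have "(1/r) \<star> m \<oplus> w = s \<star> y \<oplus> w"
    using m yC by (intro add_le_cong[OF w(2) supp_idems[OF yC] w(1) s(4)]) auto
  then have "r \<star> ((1/r) \<star> m \<oplus> w) = r \<star> (s \<star> y \<oplus> w)" by simp
  then have "m \<oplus> w = (r * s) \<star> y \<oplus> w"
    using w m s yC by (simp add: scale0_add_idem scale0_scale0)
  then show ?thesis using s m by (intro exI[of _ "r * s"]) simp
qed

text \<open>Minimality passes from the defining idempotent \<open>v\<close> to every admissible
  \<open>w\<close>. The meet \<open>m\<close> of \<open>z\<close> and \<open>y\<close> is a summand
  of \<open>y\<close>, hence \<open>s \<star> y\<close> modulo \<open>\<epsilon> y\<close>.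
  Comparison modulo \<open>w\<close> forces \<open>s = 1\<close>, so \<open>m\<close> agrees with
  \<open>y\<close> modulo \<open>\<epsilon> y\<close> and thus modulo \<open>v\<close>, where
  minimality is known.\<close>

lemma extreme_minimal:
  assumes y: "y \<in> extreme_extensions C" and w: "w \<in> idems C" "\<epsilon> y \<preceq> w" "\<not> y \<preceq> w"
    and z: "z \<in> carrier C" "z \<oplus> w = y \<oplus> w"
  shows "y \<preceq> z"
proof -
  have wC: "w \<in> carrier C" using w by (simp add: idems_closed)
  obtain v where v: "v \<in> idems C" "y \<in> carrier C" "\<epsilon> y \<preceq> v" "\<not> y \<preceq> v" "extreme_in C v (y \<oplus> v)"
    "\<And>z. z \<in> carrier C \<Longrightarrow> z \<oplus> v = y \<oplus> v \<Longrightarrow> y \<preceq> z"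
    by (rule extreme_extensionD[OF y]) blast
  define m where "m = z \<sqinter>\<^sub>C y"
  have m: "m \<in> carrier C" "m \<preceq> z" "m \<preceq> y" "m \<oplus> w = y \<oplus> w"
    using z v wC by (auto simp: m_def meet_le meet_add_distrib_right meet_self)
  obtain c where c: "c \<in> carrier C" "y = m \<oplus> c" using m(3) by (rule leE)
  obtain s t where st: "0 \<le> s" "0 \<le> t" "s + t = 1" "m \<oplus> \<epsilon> y = s \<star> y \<oplus> \<epsilon> y"
    by (rule extreme_split[OF y c(2) m(1) c(1)])
  then have "s \<star> y \<oplus> w = 1 \<star> y \<oplus> w"
    using add_le_cong[OF w(2) _ w(1) st(4)] m v by simp
  then have "1 \<le> s"
    using scale0_add_idem_le_cancel[OF v(2) w, of 1 s] st v wC by (simp add: le_refl)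
  then have "s = 1" using st by simp
  then have "m \<oplus> \<epsilon> y = y \<oplus> \<epsilon> y" using st(4) v(2) by simp
  then have "m \<oplus> v = y \<oplus> v"
    by (rule add_le_cong[OF v(3) supp_idems[OF v(2)] v(1)]) (use m(1) v(2) in auto)
  then have "y \<preceq> m" by (rule v(6)[OF m(1)])
  then show ?thesis using m le_trans v by blast
qed

text \<open>After rescaling, each of \<open>x\<close> and \<open>y\<close> is, modulo
  \<open>w\<close>, a multiple of the other; minimality turns both congruences into
  inequalities.\<close>

lemma extreme_proportional:
  assumes x: "x \<in> extreme_extensions C" "\<epsilon> x \<preceq> w" "\<not> x \<preceq> w"
    and y: "y \<in> extreme_extensions C" "\<epsilon> y \<preceq> w" "\<not> y \<preceq> w"
    and w: "w \<in> idems C" and st: "0 < s" "0 < t" "s \<star> x \<oplus> w = t \<star> y \<oplus> w"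
  shows "\<exists>r>0. y = r \<odot> x"
proof -
  have C: "x \<in> carrier C" "y \<in> carrier C" "w \<in> carrier C"
    using x y w by (auto simp: idems_closed extreme_extensions_closed)
  have "(s/t) \<star> x \<oplus> w = (1/t) \<star> (s \<star> x \<oplus> w)" "x \<oplus> w = (1/s) \<star> (s \<star> x \<oplus> w)"
    using C w st(1,2) by (simp_all add: scale0_add_idem scale0_scale0)
  moreover have "(1/t) \<star> (t \<star> y \<oplus> w) = y \<oplus> w" "(1/s) \<star> (t \<star> y \<oplus> w) = (t/s) \<star> y \<oplus> w"
    using C w st(1,2) by (simp_all add: scale0_add_idem scale0_scale0)
  ultimately have "(s/t) \<star> x \<oplus> w = y \<oplus> w" "(t/s) \<star> y \<oplus> w = x \<oplus> w"
    using st(3) by simp_all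
  then have "y \<preceq> (s/t) \<star> x" "x \<preceq> (t/s) \<star> y"
    using extreme_minimal[OF y(1) w y(2,3)] extreme_minimal[OF x(1) w x(2,3)] C by auto
  then have "y = (s/t) \<star> x"
    using C st scale0_le_iff[of "s/t" x y] by (intro le_antisym) auto
  then show ?thesis using st by (intro exI[of _ "s/t"]) (simp add: scale0_pos)
qed

text \<open>Modulo \<open>w\<close> the meet lies on both rays. They are distinct by
  \<open>extreme_proportional\<close>, so the meet must be zero there.\<close>

lemma extreme_meet_le:
  assumes x: "x \<in> extreme_extensions C" "\<epsilon> x \<preceq> w" "\<not> x \<preceq> w"
    and y: "y \<in> extreme_extensions C" "\<epsilon> y \<preceq> w" "\<not> y \<preceq> w"
    and w: "w \<in> idems C" and np: "\<not> (\<exists>r>0. y = r \<odot> x)" and "0 < s" "0 < t"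
  shows "(s \<star> x) \<sqinter>\<^sub>C (t \<star> y) \<preceq> w"
proof -
  have C: "x \<in> carrier C" "y \<in> carrier C" "w \<in> carrier C"
    using x y w by (auto simp: idems_closed extreme_extensions_closed)
  define m where "m = (s \<star> x) \<sqinter>\<^sub>C (t \<star> y)"
  have m: "m \<in> carrier C" "m \<preceq> s \<star> x" "m \<preceq> t \<star> y"
    using C by (auto simp: m_def meet_le)
  obtain p where p: "0 \<le> p" "m \<oplus> w = p \<star> x \<oplus> w"
    using below_extreme[OF x(1) m(2,1) \<open>0 < s\<close> w x(2)] by blast
  obtain q where q: "0 \<le> q" "m \<oplus> w = q \<star> y \<oplus> w"
    using below_extreme[OF y(1) m(3,1) \<open>0 < t\<close> w y(2)] by blast
  have "p = 0 \<or> q = 0"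
    using extreme_proportional[OF x y w, of p q] np p q by force
  then have "m \<oplus> w = w" using p q C by auto
  then show ?thesis using le_add1[of m w] m C by (simp flip: m_def)
qed

text \<open>Each summand of \<open>comb a S\<close> is replaced by its meet with \<open>u\<close>
  through \<open>le_add_meet\<close>, and that meet is absorbed by \<open>w\<close>.\<close>

lemma le_comb_disjoint:
  assumes w: "w \<in> idems C" and u: "u \<in> carrier C" and "finite S" "S \<subseteq> carrier C" "B \<in> carrier C"
    and "\<And>y. y \<in> S \<Longrightarrow> u \<sqinter>\<^sub>C (a y \<star> y) \<preceq> w" and "u \<preceq> comb a S \<oplus> B"
  shows "u \<preceq> w \<oplus> B"
  using \<open>finite S\<close> assms(4-)
proof (induction S arbitrary: B)
  case empty
  then show ?case using le_trans[OF _ le_add2[of w B]] u w by (simp add: idems_closed)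
next
  case (insert y S)
  have C: "w \<in> carrier C" "y \<in> carrier C" "S \<subseteq> carrier C" "comb a S \<in> carrier C"
    using w insert.prems by (auto simp: idems_closed intro!: comb_closed)
  have "u \<preceq> a y \<star> y \<oplus> (comb a S \<oplus> B)"
    using insert C by (simp add: Pi_def subset_eq a_assoc)
  then have "u \<preceq> (u \<sqinter>\<^sub>C (a y \<star> y)) \<oplus> (comb a S \<oplus> B)"
    using insert C u by (intro le_add_meet) auto
  also have "\<dots> \<preceq> w \<oplus> (comb a S \<oplus> B)"
    using insert.prems C u by (intro add_mono[OF _ le_refl]) auto
  also have "\<dots> = comb a S \<oplus> (w \<oplus> B)" using C insert.prems by (simp add: a_lcomm)
  finally have "u \<preceq> w \<oplus> (w \<oplus> B)"
    using insert.prems C u by (intro insert.IH) auto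
  then show ?case using w C insert.prems by (simp add: idems_iff flip: a_assoc)
qed

text \<open>The terms on the other rays are disjoint from \<open>t \<star> x\<close> modulo
  \<open>w\<close> and can be deleted; cancellation on the ray of \<open>x\<close> compares what is
  left. The case \<open>x \<notin> S\<close> is included on purpose: it shows that no ray can be
  missing from a generating set.\<close>

lemma coordinate_le:
  assumes w: "w \<in> idems C" and S: "finite S" "S \<subseteq> extreme_extensions C"
    "\<And>y. y \<in> S \<Longrightarrow> \<epsilon> y \<preceq> w \<and> \<not> y \<preceq> w"
    and x: "x \<in> extreme_extensions C" "\<epsilon> x \<preceq> w" "\<not> x \<preceq> w"
    and np: "\<And>y. y \<in> S \<Longrightarrow> y \<noteq> x \<Longrightarrow> \<not> (\<exists>r>0. y = r \<odot> x)"
    and a: "\<And>y. y \<in> S \<Longrightarrow> 0 \<le> a y" and t: "t \<star> x \<preceq> comb a S \<oplus> w"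
  shows "t \<le> (if x \<in> S then a x else 0)"
proof (cases "0 < t")
  case True
  let ?b = "if x \<in> S then a x else 0"
  have C: "x \<in> carrier C" "S \<subseteq> carrier C" "w \<in> carrier C"
    using x S w by (auto simp: idems_closed extreme_extensions_closed)
  have "comb a S = comb a (S - {x}) \<oplus> ?b \<star> x"
  proof (cases "x \<in> S")
    case True
    then show ?thesis using S C comb_remove[of S x a] by (simp add: a_comm comb_closed subset_iff)
  qed (use C in \<open>simp add: comb_closed\<close>)
  moreover have "S - {x} \<subseteq> carrier C" using C by auto
  ultimately have "t \<star> x \<preceq> comb a (S - {x}) \<oplus> (?b \<star> x \<oplus> w)"
    using t C by (simp only: a_assoc comb_closed scale0_closed)
  moreover have "(t \<star> x) \<sqinter>\<^sub>C (a y \<star> y) \<preceq> w" if "y \<in> S - {x}" for y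
  proof (cases "0 < a y")
    case True
    then show ?thesis
      using that S np \<open>0 < t\<close> by (intro extreme_meet_le x w) auto
  next
    case False
    then have "(t \<star> x) \<sqinter>\<^sub>C (a y \<star> y) \<preceq> \<zero>"
      using meet_le(2)[of "t \<star> x" \<zero>] C by (simp add: scale0_nonpos)
    then show ?thesis using le_trans[OF _ zero_le] C that by (meson meet_closed scale0_closed DiffD1 subsetD)
  qed
  ultimately have "t \<star> x \<preceq> w \<oplus> (?b \<star> x \<oplus> w)"
    using S C by (intro le_comb_disjoint[OF w, of _ "S - {x}" _ a]) auto
  also have "w \<oplus> (?b \<star> x \<oplus> w) = ?b \<star> x \<oplus> w"
    using w C idem_sum_absorb[of w \<zero> "?b \<star> x"] by simp
  finally have "t \<star> x \<oplus> w \<preceq> (?b \<star> x \<oplus> w) \<oplus> w"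
    using C by (intro add_mono[OF _ le_refl]) auto
  then have "t \<star> x \<oplus> w \<preceq> ?b \<star> x \<oplus> w"
    using w C idem_sum_absorb[of w "?b \<star> x" \<zero>] by simp
  then show ?thesis
    using scale0_add_idem_le_cancel[OF C(1) w x(2,3)] True a by auto
qed (use a[of x] in auto)

section \<open>Cones generated modulo an idempotent\<close>

definition gen :: "'a \<Rightarrow> 'a set \<Rightarrow> 'a set" where
  "gen w H = {comb a H \<oplus> w | a. \<forall>x. 0 \<le> a x}"

lemma gen_add:
  assumes w: "w \<in> idems C" and H: "H \<subseteq> carrier C" and "y \<in> gen w H" "z \<in> gen w H"
  shows "y \<oplus> z \<in> gen w H"
proof -
  obtain a b where ab: "\<forall>x. 0 \<le> a x" "\<forall>x. 0 \<le> b x" "y = comb a H \<oplus> w" "z = comb b H \<oplus> w"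
    using assms by (auto simp: gen_def)
  then have "y \<oplus> z = comb (\<lambda>x. a x + b x) H \<oplus> w"
    using w H by (simp add: idem_sum_absorb flip: comb_add)
  then show ?thesis using ab unfolding gen_def by (intro CollectI exI[of _ "\<lambda>x. a x + b x"]) auto
qed

text \<open>The summand \<open>w\<close> in the conclusion serves the case \<open>s = 0\<close>:
  \<open>0 \<star> y\<close> is \<open>\<zero>\<close>, whereas the zero of \<open>gen w H\<close>
  is \<open>w\<close>.\<close>

lemma gen_scale:
  assumes w: "w \<in> idems C" and H: "H \<subseteq> carrier C" and "y \<in> gen w H" "0 \<le> s"
  shows "s \<star> y \<oplus> w \<in> gen w H"
proof -
  obtain a where a: "\<forall>x. 0 \<le> a x" "y = comb a H \<oplus> w"
    using assms by (auto simp: gen_def)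
  have "s \<star> y \<oplus> w = comb (\<lambda>x. s * a x) H \<oplus> w"
  proof (cases "s = 0")
    case True
    then show ?thesis using comb_scale0[of H 0 a] H a by simp
  next
    case False
    have "s \<star> y \<oplus> w = (s \<star> comb a H \<oplus> w) \<oplus> (\<zero> \<oplus> w)"
      using False a assms by (simp add: scale0_add_idem idems_closed)
    also have "\<dots> = (s \<star> comb a H \<oplus> \<zero>) \<oplus> w" using w H by (intro idem_sum_absorb) auto
    finally show ?thesis using H a assms by (simp add: comb_scale0)
  qed
  then show ?thesis using a assms unfolding gen_def by (intro CollectI exI[of _ "\<lambda>x. s * a x"]) auto
qed

lemma gen_idem:
  assumes "w \<in> idems C" "H \<subseteq> carrier C" shows "w \<in> gen w H"
proof -
  have "comb (\<lambda>x. 0) H = \<zero>" using assms by simp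
  then show ?thesis using assms unfolding gen_def
    by (intro CollectI exI[of _ "\<lambda>x. 0"]) (simp add: idems_closed)
qed

lemma gen_single:
  assumes "finite H" "H \<subseteq> carrier C" "x \<in> H" "0 \<le> t"
  shows "t \<star> x \<oplus> w \<in> gen w H"
  using assms comb_single[of H x t] unfolding gen_def
  by (intro CollectI exI[of _ "\<lambda>y. if y = x then t else 0"]) auto

lemma gen_trans:
  assumes w: "w \<in> idems C" and H: "H \<subseteq> carrier C" and G: "finite G" "G \<subseteq> carrier C"
    and gen: "\<And>g. g \<in> G \<Longrightarrow> g \<oplus> w \<in> gen w H" and a: "\<And>g. g \<in> G \<Longrightarrow> 0 \<le> a g"
  shows "comb a G \<oplus> w \<in> gen w H"
  using G gen a
proof (induction G)
  case empty
  then show ?case using w H by (simp add: gen_idem idems_closed)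
next
  case (insert g G)
  have C: "w \<in> carrier C" "g \<in> carrier C" "G \<subseteq> carrier C" "comb a G \<in> carrier C"
    using w insert.prems by (auto simp: idems_closed intro!: comb_closed)
  have "a g \<star> g \<oplus> w \<in> gen w H"
  proof (cases "a g = 0")
    case False
    then have "0 < a g" using insert.prems(3)[of g] by auto
    then have "a g \<star> (g \<oplus> w) \<oplus> w = (a g \<star> g \<oplus> w) \<oplus> (\<zero> \<oplus> w)" using C w by (simp add: scale0_add_idem)
    also have "\<dots> = a g \<star> g \<oplus> w" using C w by (subst idem_sum_absorb) auto
    finally show ?thesis using gen_scale[OF w H, of "g \<oplus> w" "a g"] insert.prems \<open>0 < a g\<close> by simp
  qed (use w H C in \<open>simp add: gen_idem\<close>)
  moreover have "comb a G \<oplus> w \<in> gen w H" using insert by auto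
  ultimately have "(a g \<star> g \<oplus> w) \<oplus> (comb a G \<oplus> w) \<in> gen w H"
    by (rule gen_add[OF w H])
  then show ?case
    using insert C w by (simp add: Pi_def subset_eq idem_sum_absorb)
qed

end

section \<open>Generation by extreme rays and coordinates\<close>

locale fg_choquet_cone = extended_choquet_cone C for C :: "('a, 'm) top_cone_scheme" (structure) +
  assumes fg: "finitely_generated C"
begin

text \<open>The given sum may use a generator several times; its coefficients are collected into one
  function on \<open>Z\<close>.\<close>

lemma finsum_generators:
  assumes "finite I" "finite Z" "Z \<subseteq> carrier C" "\<And>i. i \<in> I \<Longrightarrow> 0 < \<alpha> i \<and> z i \<in> Z"
  shows "\<exists>a. (\<forall>x. 0 \<le> a x) \<and> (\<Oplus>i\<in>I. \<alpha> i \<odot> z i) = comb a Z"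
  using assms(1,4)
proof (induction I)
  case empty
  have "comb (\<lambda>x. 0) Z = \<zero>" using assms by simp
  then show ?case by (intro exI[of _ "\<lambda>x. 0"]) simp
next
  case (insert i I)
  then obtain a where a: "\<forall>x. 0 \<le> a x" "(\<Oplus>i\<in>I. \<alpha> i \<odot> z i) = comb a Z" by auto
  let ?b = "\<lambda>x. (if x = z i then \<alpha> i else 0) + a x"
  have i: "0 < \<alpha> i" "z i \<in> Z" using insert.prems[of i] by auto
  have "(\<Oplus>i\<in>insert i I. \<alpha> i \<odot> z i) = \<alpha> i \<odot> z i \<oplus> (\<Oplus>i\<in>I. \<alpha> i \<odot> z i)"
    using insert.prems assms(3) by (intro finsum_insert insert.hyps) (auto simp: scale_closed subset_iff)
  also have "\<dots> = comb (\<lambda>x. if x = z i then \<alpha> i else 0) Z \<oplus> comb a Z"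
    using assms i a by (simp add: comb_single scale0_pos)
  also have "\<dots> = comb ?b Z"
    using assms i a by (intro comb_add) auto
  finally show ?case using a i by (intro exI[of _ ?b]) (auto intro: add_nonneg_nonneg less_imp_le)
qed

lemma finite_generators:
  obtains Z where "finite Z" "Z \<subseteq> carrier C"
    "\<And>x. x \<in> carrier C \<Longrightarrow> \<exists>a. (\<forall>z. 0 \<le> a z) \<and> x = comb a Z"
proof -
  obtain Z where Z: "finite Z" "Z \<subseteq> carrier C"
    "\<forall>x\<in>carrier C. \<exists>n (\<alpha> :: nat \<Rightarrow> real) z. (\<forall>i\<in>{1..n}. 0 < \<alpha> i \<and> z i \<in> Z) \<and> x = (\<Oplus>i\<in>{1..n}. \<alpha> i \<odot> z i)"
    using fg unfolding finitely_generated_def by (elim exE conjE)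
  show ?thesis
  proof (rule that[OF Z(1,2)])
    fix x assume "x \<in> carrier C"
    from bspec[OF Z(3) this] obtain n and \<alpha> :: "nat \<Rightarrow> real" and z where "\<forall>i\<in>{1..n}. 0 < \<alpha> i \<and> z i \<in> Z" "x = (\<Oplus>i\<in>{1..n}. \<alpha> i \<odot> z i)"
      by (elim exE conjE)
    then show "\<exists>a. (\<forall>z. 0 \<le> a z) \<and> x = comb a Z"
      using finsum_generators[OF _ Z(1,2), of "{1..n}" \<alpha> z] by simp
  qed
qed

text \<open>An idempotent is a combination of the generators below it, so it is determined by a
  subset of \<open>Z\<close>.\<close>

lemma finite_idems: "finite (idems C)"
proof -
  obtain Z where Z: "finite Z" "Z \<subseteq> carrier C"
    "\<And>x. x \<in> carrier C \<Longrightarrow> \<exists>a. (\<forall>z. 0 \<le> a z) \<and> x = comb a Z"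
    by (rule finite_generators) blast
  have le: "w \<preceq> w'" if w: "w \<in> idems C" "w' \<in> idems C" and eq: "{z \<in> Z. z \<preceq> w} = {z \<in> Z. z \<preceq> w'}" for w w'
  proof -
    obtain a where a: "\<forall>z. 0 \<le> a z" "w = comb a Z" using Z(3) w idems_closed by blast
    have "z \<preceq> w'" if z: "z \<in> Z" "0 < a z" for z
    proof -
      have "a z \<star> z \<preceq> w" using scale0_le_comb[OF Z(1,2) z(1), of a] a by simp
      then have "z \<preceq> w" using w z Z by (subst (asm) scale0_le_idem_iff) auto
      then show ?thesis using eq z by auto
    qed
    then have "comb a Z \<preceq> w'" using w Z by (intro comb_le_idem) auto
    then show ?thesis using a by simp
  qed
  have "inj_on (\<lambda>w. {z \<in> Z. z \<preceq> w}) (idems C)"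
  proof (rule inj_onI)
    fix w w' assume *: "w \<in> idems C" "w' \<in> idems C" "{z \<in> Z. z \<preceq> w} = {z \<in> Z. z \<preceq> w'}"
    show "w = w'"
      by (rule le_antisym[OF le[OF *] le[OF *(2,1) *(3)[symmetric]]]) (use * idems_closed in auto)
  qed
  moreover have "(\<lambda>w. {z \<in> Z. z \<preceq> w}) ` idems C \<subseteq> Pow Z" by auto
  ultimately show ?thesis using Z(1) by (meson finite_Pow_iff inj_on_finite)
qed

text \<open>The members of \<open>G\<close> need not lie in \<open>C_w\<close>; only their
  translates by \<open>w\<close> do. This way members of a generating set of \<open>C\<close> can be
  used unchanged.\<close>

definition generates :: "'a \<Rightarrow> 'a set \<Rightarrow> bool" where
  "generates w G \<longleftrightarrow> finite G \<and> G \<subseteq> {z \<in> carrier C. \<epsilon> z \<preceq> w} \<and> cone_at C w \<subseteq> gen w G"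

lemma exists_generates:
  assumes w: "w \<in> idems C" shows "\<exists>G. generates w G"
proof -
  obtain Z where Z: "finite Z" "Z \<subseteq> carrier C"
    "\<And>x. x \<in> carrier C \<Longrightarrow> \<exists>a. (\<forall>z. 0 \<le> a z) \<and> x = comb a Z"
    by (rule finite_generators) blast
  let ?G = "{z \<in> Z. \<epsilon> z \<preceq> w}"
  have "x \<in> gen w ?G" if "x \<in> cone_at C w" for x
  proof -
    have x: "x \<in> carrier C" "\<epsilon> x = w" using that by (auto simp: cone_at_def)
    then obtain a where a: "\<forall>z. 0 \<le> a z" "x = comb a Z" using Z(3) by blast
    have "comb a Z = comb a ?G"
    proof (rule comb_mono_neutral)
      fix z assume z: "z \<in> Z - ?G"
      then have zC: "z \<in> carrier C" using Z by auto
      show "a z = 0"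
      proof (rule ccontr)
        assume "a z \<noteq> 0"
        then have "0 < a z" using a by (simp add: less_le)
        have "a z \<star> z \<preceq> x" using scale0_le_comb[OF Z(1,2), of z a] z a by simp
        then have "\<epsilon> (a z \<star> z) \<preceq> \<epsilon> x" using x zC by (intro supp_mono) auto
        then show False using z zC x \<open>0 < a z\<close> by simp
      qed
    qed (use Z in auto)
    moreover have "x = x \<oplus> w" using supp_absorb[of x] x by simp
    ultimately show ?thesis using a unfolding gen_def by (intro CollectI exI[of _ a]) auto
  qed
  then show ?thesis using Z by (intro exI[of _ ?G]) (auto simp: generates_def)
qed

text \<open>A generating set of minimal cardinality consists of generators of extreme rays.\<close>

lemma exists_extreme_generates:
  assumes w: "w \<in> idems C"
  shows "\<exists>G. generates w G \<and> (\<forall>g\<in>G. extreme_in C w (g \<oplus> w))"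
proof -
  obtain G where G: "generates w G" and min: "\<And>H. generates w H \<Longrightarrow> card G \<le> card H"
    using ex_has_least_nat[of "generates w" _ card] exists_generates[OF w] by auto
  have GC: "finite G" "G \<subseteq> carrier C" "\<And>g. g \<in> G \<Longrightarrow> \<epsilon> g \<preceq> w" "cone_at C w \<subseteq> gen w G"
    using G by (auto simp: generates_def)
  have wC: "w \<in> carrier C" using w by (rule idems_closed)
  have "extreme_in C w (g \<oplus> w)" if g: "g \<in> G" for g
  proof -
    have gC: "g \<in> carrier C" using g GC by auto
    let ?H = "G - {g}"
    have HC: "finite ?H" "?H \<subseteq> carrier C" "card ?H < card G"
      using GC(1,2) g card_Diff1_less[OF GC(1) g] by auto
    \<comment> \<open>Otherwise \<open>g\<close> could be replaced by the remaining generators,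
      contradicting the minimal cardinality of \<open>G\<close>.\<close>
    have not_gen: "g \<oplus> w \<notin> gen w ?H"
    proof
      assume *: "g \<oplus> w \<in> gen w ?H"
      have "x \<in> gen w ?H" if x: "x \<in> cone_at C w" for x
      proof -
        obtain a where a: "\<forall>z. 0 \<le> a z" "x = comb a G \<oplus> w"
          using subsetD[OF GC(4) x] by (auto simp: gen_def)
        have "g' \<oplus> w \<in> gen w ?H" if "g' \<in> G" for g'
          using * gen_single[of ?H g' 1 w] that HC GC(2) by (cases "g' = g") auto
        then show ?thesis
          unfolding a(2) using w HC GC a by (intro gen_trans) auto
      qed
      then have "generates w ?H" using GC by (auto simp: generates_def)
      then show False using min HC(3) by (simp add: leD)
    qed
    have not_le: "\<not> g \<preceq> w"
      using not_gen gen_idem[OF w HC(2)] le_idem_absorb[OF w gC] by auto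
    have step: "u = w \<or> (\<exists>t>0. u = t \<odot> (g \<oplus> w))"
      if u: "u \<in> cone_at C w" and v: "v \<in> cone_at C w" and sum: "g \<oplus> w = u \<oplus> v" for u v
    proof -
      obtain a where a: "\<forall>z. 0 \<le> a z" "u = comb a G \<oplus> w"
        using subsetD[OF GC(4) u] by (auto simp: gen_def)
      obtain b where b: "\<forall>z. 0 \<le> b z" "v = comb b G \<oplus> w"
        using subsetD[OF GC(4) v] by (auto simp: gen_def)
      \<comment> \<open>\<open>?c\<close> is the total coefficient of \<open>g\<close> in the
        expansion of \<open>u \<oplus> v\<close>, and \<open>?R\<close> collects the other
        generators. The aim is that \<open>?R\<close> vanishes modulo \<open>w\<close>.\<close>
      let ?c = "a g + b g"
      let ?R = "comb (\<lambda>z. a z + b z) ?H"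
      have RC: "?R \<in> carrier C" using HC by simp
      have c0: "0 \<le> ?c" using a b by simp
      have "g \<oplus> w = comb (\<lambda>z. a z + b z) G \<oplus> w"
        unfolding sum a(2) b(2) using GC w a b by (simp add: idem_sum_absorb comb_add)
      then have eq: "g \<oplus> w = ?c \<star> g \<oplus> ?R \<oplus> w"
        by (simp only: comb_remove[OF GC(1,2) g])
      \<comment> \<open>If \<open>?c < 1\<close>, cancelling \<open>?c \<star> g\<close> and
        dividing by \<open>1 - ?c\<close> would express \<open>g\<close> through the other
        generators.\<close>
      have "\<not> ?c < 1"
      proof
        assume lt: "?c < 1"
        have "\<epsilon> (?c \<star> g) \<preceq> w"
          using c0 GC(3)[OF g] wC gC by (cases "?c = 0") (auto simp: zero_le)
        then have e: "\<epsilon> (?c \<star> g \<oplus> w) = w" using w gC by (intro supp_add_idem) auto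
        have "(1 - ?c) \<star> g \<oplus> (?c \<star> g \<oplus> w) = g \<oplus> w"
          using scale0_add_left[of "1 - ?c" ?c g] lt c0 gC wC by (simp add: a_assoc[symmetric])
        also have "\<dots> = ?R \<oplus> (?c \<star> g \<oplus> w)"
          unfolding eq using gC wC RC by (simp add: a_ac)
        finally have "(1 - ?c) \<star> g \<oplus> w = ?R \<oplus> w"
          using add_cancel[of "(1 - ?c) \<star> g" ?R "?c \<star> g \<oplus> w"] gC wC RC unfolding e by simp
        moreover have "?R \<oplus> w \<in> gen w ?H"
          using a b unfolding gen_def by (intro CollectI exI[of _ "\<lambda>z. a z + b z"]) auto
        ultimately have "(1 / (1 - ?c)) \<star> ((1 - ?c) \<star> g \<oplus> w) \<oplus> w \<in> gen w ?H"
          using lt by (intro gen_scale[OF w HC(2), where y = "(1 - ?c) \<star> g \<oplus> w"]) simp_all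
        moreover have "(1 / (1 - ?c)) \<star> ((1 - ?c) \<star> g \<oplus> w) \<oplus> w = g \<oplus> w"
          using lt w gC idem_sum_absorb[of w g \<zero>] wC
          by (simp add: scale0_add_idem scale0_scale0)
        ultimately show False using not_gen by simp
      qed
      \<comment> \<open>Now one copy of \<open>g\<close> is cancelled instead: the excess
        \<open>(?c - 1) \<star> g \<oplus> ?R\<close> is zero modulo \<open>w\<close>, and only the
        multiples of \<open>g\<close> survive in \<open>u\<close>.\<close>
      then have c1: "1 \<le> ?c" by simp
      have "\<epsilon> (g \<oplus> w) = w" using w gC GC(3)[OF g] by (intro supp_add_idem) auto
      moreover
      have "\<zero> \<oplus> (g \<oplus> w) = ((?c - 1) \<star> g \<oplus> ?R) \<oplus> (g \<oplus> w)"
      proof -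
        have "\<zero> \<oplus> (g \<oplus> w) = ?c \<star> g \<oplus> ?R \<oplus> w" unfolding eq[symmetric] using gC wC by simp
        also have "?c \<star> g = (?c - 1) \<star> g \<oplus> g"
          using scale0_add_left[of "?c - 1" 1 g] c1 gC by simp
        also have "(?c - 1) \<star> g \<oplus> g \<oplus> ?R \<oplus> w = ((?c - 1) \<star> g \<oplus> ?R) \<oplus> (g \<oplus> w)"
          using gC wC RC by (simp add: a_ac)
        finally show ?thesis .
      qed
      ultimately have "\<zero> \<oplus> w = ((?c - 1) \<star> g \<oplus> ?R) \<oplus> w"
        using add_cancel[of \<zero> "(?c - 1) \<star> g \<oplus> ?R" "g \<oplus> w"] gC wC RC by simp
      then have le: "(?c - 1) \<star> g \<oplus> ?R \<preceq> w"
        using le_add1[of "(?c - 1) \<star> g \<oplus> ?R" w] gC wC RC by simp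
      then have "(?c - 1) \<star> g \<preceq> w" "?R \<preceq> w"
        using le_trans[OF le_add1 le] le_trans[OF le_add2 le] gC RC by auto
      then have "comb a ?H \<preceq> w"
      proof -
        have "comb a ?H \<oplus> comb b ?H = ?R" using a b HC by (intro comb_add) auto
        then have "comb a ?H \<preceq> ?R" using le_add1[of "comb a ?H" "comb b ?H"] HC by simp
        then show ?thesis by (rule le_trans[OF _ \<open>?R \<preceq> w\<close> comb_closed[OF HC(2)]])
      qed
      have "u = a g \<star> g \<oplus> (comb a ?H \<oplus> w)"
        unfolding a(2) comb_remove[OF GC(1,2) g, of a] using gC HC wC by (simp add: a_assoc)
      then have u: "u = a g \<star> g \<oplus> w"
        using \<open>comb a ?H \<preceq> w\<close> w HC by (simp add: le_idem_absorb)
      show ?thesis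
      proof (cases "a g = 0")
        case False
        then have "0 < a g" using a by (simp add: less_le)
        then show ?thesis
          using u w gC by (intro disjI2 exI[of _ "a g"]) (simp add: scale0_add_idem flip: scale0_pos)
      qed (use u wC in simp)
    qed
    show ?thesis
      unfolding extreme_in_def
    proof (intro conjI ballI impI)
      have "g \<oplus> w \<noteq> w" using not_le le_add1[OF gC wC] by auto
      then show "g \<oplus> w \<in> cone_at C w - {w}"
        using w gC wC GC(3)[OF g] by (simp add: cone_at_def supp_add_idem)
      fix y z assume *: "y \<in> cone_at C w" "z \<in> cone_at C w" "g \<oplus> w = y \<oplus> z"
      show "y = w \<or> (\<exists>t>0. y = t \<odot> (g \<oplus> w))" by (rule step[OF *])
      show "z = w \<or> (\<exists>t>0. z = t \<odot> (g \<oplus> w))"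
        by (rule step[OF *(2,1)]) (use * in \<open>auto simp: cone_at_def a_comm\<close>)
    qed
  qed
  then show ?thesis using G by blast
qed

end

locale fg_choquet_cone_reps = fg_choquet_cone C for C :: "('a, 'm) top_cone_scheme" (structure) +
  fixes X :: "'a set"
  assumes reps: "ray_representatives C X"
begin

section \<open>Representatives of the extreme rays as generators\<close>

lemma X_extreme: "X \<subseteq> extreme_extensions C"
  using reps by (simp add: ray_representatives_def)

lemma X_carrier: "X \<subseteq> carrier C"
  using X_extreme extreme_extensions_closed by blast

lemma X_closed: "x \<in> X \<Longrightarrow> x \<in> carrier C"
  using X_carrier by blast

lemma X_not_proportional:
  assumes "x \<in> X" "y \<in> X" "0 < r" "y = r \<odot> x" shows "y = x"
proof -
  have "\<exists>!z. z \<in> X \<and> (\<exists>t>0. z = t \<odot> x)"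
    using reps assms X_extreme unfolding ray_representatives_def by blast
  moreover have "x \<in> X \<and> (\<exists>t>0. x = t \<odot> x)"
    using assms X_carrier scale_one by (metis subsetD zero_less_one)
  moreover have "y \<in> X \<and> (\<exists>t>0. y = t \<odot> x)" using assms by blast
  ultimately show ?thesis by blast
qed

abbreviation P :: "'a \<Rightarrow> 'a set" where "P w \<equiv> pos_set C X w"

lemma P_iff: "x \<in> P w \<longleftrightarrow> x \<in> X \<and> \<not> x \<preceq> w \<and> \<epsilon> x \<preceq> w"
  by (auto simp: pos_set_def outer_set_def)

lemma P_subset_X: "P w \<subseteq> X" by (auto simp: P_iff)

lemma coordinate_le_X:
  assumes w: "w \<in> idems C" and S: "finite S" "S \<subseteq> P w" and x: "x \<in> P w"
    and a: "\<And>y. y \<in> S \<Longrightarrow> 0 \<le> a y" and t: "t \<star> x \<preceq> comb a S \<oplus> w"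
  shows "t \<le> (if x \<in> S then a x else 0)"
proof (rule coordinate_le[OF w S(1)])
  show "S \<subseteq> extreme_extensions C" "x \<in> extreme_extensions C"
    using S x subsetD[OF X_extreme] by (auto simp: P_iff subset_iff)
  show "\<not> (\<exists>r>0. y = r \<odot> x)" if "y \<in> S" "y \<noteq> x" for y
    using X_not_proportional[of x y] that S x by (auto simp: P_iff)
qed (use S x a t in \<open>auto simp: P_iff subset_iff\<close>)

text \<open>The minimum extension of \<open>g \<oplus> w\<close> agrees with \<open>g\<close> modulo
  \<open>w\<close>, and \<open>X\<close> contains a positive multiple of it.\<close>

lemma extreme_in_rep:
  assumes w: "w \<in> idems C" and g: "g \<in> carrier C" "extreme_in C w (g \<oplus> w)"
  shows "\<exists>x\<in>P w. \<exists>t>0. g \<oplus> w = t \<star> x \<oplus> w"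
proof -
  have wC: "w \<in> carrier C" using w by (rule idems_closed)
  define m where "m = min_extension C w (g \<oplus> w)"
  have e: "\<epsilon> (g \<oplus> w) = w" "g \<oplus> w \<noteq> w" using g(2) by (auto simp: extreme_in_def cone_at_def)
  note m = min_extension_props[OF w a_closed[OF g(1) wC] e(1), folded m_def]
  have "m \<in> extreme_extensions C"
    using w g by (auto simp: extreme_extensions_def m_def)
  then obtain x t where x: "x \<in> X" "0 < t" "x = t \<odot> m"
    using reps unfolding ray_representatives_def by blast
  then have xm: "x = t \<star> m" by (simp add: scale0_pos)
  have xC: "x \<in> carrier C" using x X_closed by blast
  have xw: "x \<oplus> w = t \<star> (g \<oplus> w)"
    unfolding xm m(2)[symmetric] using m(1) w x by (simp add: scale0_add_idem)
  have "m \<preceq> g \<oplus> w" using le_add1[OF m(1) wC] m(2) by simp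
  then have "\<epsilon> m \<preceq> w" using supp_mono[of m "g \<oplus> w"] m(1) g wC e by simp
  then have "\<epsilon> x \<preceq> w" unfolding xm using x m(1) by simp
  moreover have "\<not> x \<preceq> w"
  proof
    assume "x \<preceq> w"
    then have "t \<star> (g \<oplus> w) = w" using xw w xC by (simp add: le_idem_absorb)
    then have "(1/t) \<star> (t \<star> (g \<oplus> w)) = w" using w x by (simp add: scale0_idem)
    then show False using e x g wC by (simp add: scale0_inverse)
  qed
  ultimately have "x \<in> P w" using x by (simp add: P_iff)
  moreover have "g \<oplus> w = (1/t) \<star> (x \<oplus> w)"
    unfolding xw using x g wC by (simp add: scale0_inverse)
  then have "g \<oplus> w = (1/t) \<star> x \<oplus> w" using x xC w by (simp add: scale0_add_idem)
  ultimately show ?thesis using x by (intro bexI[of _ x] exI[of _ "1/t"]) auto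
qed

text \<open>A minimal generating set can be replaced by representatives \<open>F\<close> in
  \<open>P w\<close>. Finiteness follows because \<open>F\<close> is all of
  \<open>P w\<close>.\<close>

lemma P_generates:
  assumes w: "w \<in> idems C" shows "finite (P w)" "cone_at C w \<subseteq> gen w (P w)"
proof -
  have wC: "w \<in> carrier C" using w by (rule idems_closed)
  obtain G where G: "generates w G" "\<forall>g\<in>G. extreme_in C w (g \<oplus> w)"
    using exists_extreme_generates[OF w] by blast
  have GC: "finite G" "G \<subseteq> carrier C" "cone_at C w \<subseteq> gen w G"
    using G by (auto simp: generates_def)
  have "\<forall>g\<in>G. \<exists>x. x \<in> P w \<and> (\<exists>t>0. g \<oplus> w = t \<star> x \<oplus> w)"
    using extreme_in_rep[OF w] G GC by blast
  then obtain r where r: "\<And>g. g \<in> G \<Longrightarrow> r g \<in> P w \<and> (\<exists>t>0. g \<oplus> w = t \<star> r g \<oplus> w)"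
    by (metis (no_types))
  define F where "F = r ` G"
  have F: "finite F" "F \<subseteq> P w" using GC(1) r by (auto simp: F_def)
  then have "F \<subseteq> carrier C" using P_subset_X X_carrier by (meson subset_trans)
  note F = F this
  have gen: "x \<in> gen w F" if x: "x \<in> cone_at C w" for x
  proof -
    obtain a where a: "\<forall>z. 0 \<le> a z" "x = comb a G \<oplus> w"
      using subsetD[OF GC(3) x] by (auto simp: gen_def)
    have "g \<oplus> w \<in> gen w F" if g: "g \<in> G" for g
    proof -
      obtain t where "0 < t" "g \<oplus> w = t \<star> r g \<oplus> w" using r[OF g] by blast
      then show ?thesis using gen_single[OF F(1,3), of "r g" t w] g by (simp add: F_def)
    qed
    then show ?thesis unfolding a(2) using w F GC a by (intro gen_trans) auto
  qed
  \<comment> \<open>\<open>x \<oplus> w\<close> is a combination of \<open>F\<close> above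
    \<open>1 \<star> x\<close>; by the coordinate bound \<open>x\<close> has coefficient at least
    \<open>1\<close> there, so it belongs to \<open>F\<close>.\<close>
  have "P w \<subseteq> F"
  proof
    fix x assume x: "x \<in> P w"
    then have xC: "x \<in> carrier C" "\<epsilon> x \<preceq> w" using X_closed by (auto simp: P_iff)
    then have "x \<oplus> w \<in> cone_at C w" using w wC by (simp add: cone_at_def supp_add_idem)
    then obtain a where a: "\<forall>z. 0 \<le> a z" "x \<oplus> w = comb a F \<oplus> w"
      using gen by (auto simp: gen_def)
    have "1 \<star> x \<preceq> comb a F \<oplus> w" using le_add1[OF xC(1) wC] a xC by simp
    then have "1 \<le> (if x \<in> F then a x else 0)"
      using a by (intro coordinate_le_X[OF w F(1,2) x]) auto
    then show "x \<in> F" by (auto split: if_splits)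
  qed
  then have "P w = F" using F by auto
  then show "finite (P w)" "cone_at C w \<subseteq> gen w (P w)" using F gen by auto
qed

text \<open>No extreme element lies below its own support idempotent, so each \<open>x\<close>
  belongs to \<open>P (\<epsilon> x)\<close>.\<close>

lemma finite_X: "finite X"
proof -
  have "X \<subseteq> (\<Union>w\<in>idems C. P w)"
  proof
    fix x assume x: "x \<in> X"
    then have "x \<in> P (\<epsilon> x)"
      using extreme_not_le_supp X_extreme X_closed by (auto simp: P_iff le_refl)
    then show "x \<in> (\<Union>w\<in>idems C. P w)" using X_closed[OF x] by auto
  qed
  then show ?thesis using finite_idems P_generates(1) by (meson finite_UN_I finite_subset)
qed

text \<open>Total functions vanishing off \<open>P w\<close>: uniqueness of the representation
  becomes plain equality of functions.\<close>

definition coeffs :: "'a \<Rightarrow> ('a \<Rightarrow> real) \<Rightarrow> bool" where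
  "coeffs w a \<longleftrightarrow> (\<forall>x. 0 \<le> a x) \<and> (\<forall>x. x \<notin> P w \<longrightarrow> a x = 0)"

lemma exists_coeffs:
  assumes "y \<in> carrier C"
  shows "\<exists>a. coeffs (\<epsilon> y) a \<and> y = comb a X \<oplus> \<epsilon> y"
proof -
  have "y \<in> gen (\<epsilon> y) (P (\<epsilon> y))"
    using P_generates(2)[of "\<epsilon> y"] assms by (auto simp: cone_at_def)
  then obtain a where a: "\<forall>x. 0 \<le> a x" "y = comb a (P (\<epsilon> y)) \<oplus> \<epsilon> y"
    by (auto simp: gen_def)
  define b where "b x = (if x \<in> P (\<epsilon> y) then a x else 0)" for x
  have "comb b X = comb b (P (\<epsilon> y))"
    using finite_X X_carrier P_subset_X by (intro comb_mono_neutral) (auto simp: b_def)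
  also have "\<dots> = comb a (P (\<epsilon> y))"
    using X_carrier P_subset_X by (intro comb_cong) (auto simp: b_def)
  finally show ?thesis using a by (intro exI[of _ b]) (auto simp: coeffs_def b_def)
qed

lemma supp_comb_coeffs:
  assumes "w \<in> idems C" "\<And>x. x \<in> X \<Longrightarrow> 0 < a x \<Longrightarrow> \<epsilon> x \<preceq> w"
  shows "\<epsilon> (comb a X \<oplus> w) = w"
  using assms X_carrier by (intro supp_comb_add) auto

lemma coeffs_supp: "coeffs w a \<Longrightarrow> 0 < a x \<Longrightarrow> \<epsilon> x \<preceq> w"
  unfolding coeffs_def P_iff by (metis less_irrefl)

text \<open>Each coefficient of \<open>a\<close> gives a multiple of \<open>x\<close> below the
  common element, and \<open>coordinate_le_X\<close> bounds it by the coefficient of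
  \<open>b\<close>; the roles are then exchanged.\<close>

lemma coeffs_unique:
  assumes w: "w \<in> idems C" and a: "coeffs w a" and b: "coeffs w b"
    and eq: "comb a X \<oplus> w = comb b X \<oplus> w"
  shows "a = b"
proof
  fix x
  have wC: "w \<in> carrier C" using w by (rule idems_closed)
  have le: "a x \<le> b x" if x: "x \<in> P w" and a: "coeffs w a" and b: "coeffs w b"
    and eq: "comb a X \<oplus> w = comb b X \<oplus> w" for a b
  proof -
    have "comb b X = comb b (P w)"
      using finite_X X_carrier P_subset_X b by (intro comb_mono_neutral) (auto simp: coeffs_def)
    moreover have "a x \<star> x \<preceq> comb a X"
      using scale0_le_comb[OF finite_X X_carrier, of x] x P_subset_X by blast
    then have "a x \<star> x \<preceq> comb a X \<oplus> w"
      by (rule le_trans[OF _ le_add1]) (use x wC X_carrier X_closed in \<open>auto simp: P_iff\<close>)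
    ultimately have "a x \<star> x \<preceq> comb b (P w) \<oplus> w" using eq by simp
    then show ?thesis
      using coordinate_le_X[OF w P_generates(1)[OF w] subset_refl x] b x by (auto simp: coeffs_def)
  qed
  show "a x = b x"
  proof (cases "x \<in> P w")
    case True
    then show ?thesis using le[OF _ a b eq] le[OF _ b a eq[symmetric]] by force
  qed (use a b in \<open>auto simp: coeffs_def\<close>)
qed

end

section \<open>Positive functions and the pairing\<close>

locale strongly_connected_fg_cone = fg_choquet_cone_reps C X
  for C :: "('a, 'm) top_cone_scheme" (structure) and X :: "'a set" +
  assumes conn: "strongly_connected C"
begin

text \<open>Some term in the representation of \<open>y\<close> is not below \<open>w\<close>, since
  otherwise \<open>y\<close> itself would be. The support of that term lies below
  \<open>\<epsilon> y\<close>, hence below \<open>w\<close>.\<close>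

lemma P_between:
  assumes w: "w \<in> idems C" and y: "y \<in> carrier C" "\<epsilon> y \<preceq> w" "\<not> y \<preceq> w"
  shows "\<exists>x\<in>P w. \<exists>t>0. t \<star> x \<preceq> y"
proof -
  obtain a where a: "coeffs (\<epsilon> y) a" "y = comb a X \<oplus> \<epsilon> y"
    using exists_coeffs[OF y(1)] by blast
  have "\<exists>x\<in>X. 0 < a x \<and> \<not> x \<preceq> w"
  proof (rule ccontr)
    assume "\<not> ?thesis"
    then have "comb a X \<preceq> w" using w X_carrier by (intro comb_le_idem) auto
    then have "comb a X \<oplus> \<epsilon> y \<preceq> w" using w y X_carrier by (intro idem_lub) auto
    then show False using a y by simp
  qed
  then obtain x where x: "x \<in> X" "0 < a x" "\<not> x \<preceq> w" by blast
  have "\<epsilon> x \<preceq> \<epsilon> y" using coeffs_supp[OF a(1) x(2)] .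
  then have "x \<in> P w" using x y X_closed le_trans by (auto simp: P_iff)
  moreover have "a x \<star> x \<preceq> comb a X \<oplus> \<epsilon> y"
    by (rule le_trans[OF scale0_le_comb[OF finite_X X_carrier x(1)] le_add1])
      (use y X_carrier X_closed[OF x(1)] in auto)
  ultimately show ?thesis using a(2) x(2) by auto
qed

text \<open>The only use of strong connectedness: since \<open>{y. u \<preceq> \<epsilon>(y)} = {y. u \<preceq> y}\<close> is closed for each
  of the finitely many idempotents \<open>u\<close>, the set \<open>{y \<preceq> w'. y \<preceq> w}\<close> would otherwise be clopen.\<close>

lemma P_below_idem:
  assumes w: "w \<in> idems C" and w': "w' \<in> idems C" and nle: "\<not> w' \<preceq> w"
  shows "\<exists>x\<in>P w. x \<preceq> w'"
proof (rule ccontr)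
  assume contra: "\<not> ?thesis"
  let ?D = "{x \<in> carrier C. x \<preceq> w'}"
  let ?A = "{x \<in> carrier C. x \<preceq> w}"
  let ?U = "{u \<in> idems C. \<not> u \<preceq> w}"
  let ?B = "\<Union>u\<in>?U. {v \<in> carrier C. u \<preceq> v}"
  have C: "w \<in> carrier C" "w' \<in> carrier C" using w w' by (auto simp: idems_closed)
  have "closedin (ctop C) ?A" using C by (intro closedin_below)
  moreover have "closedin (ctop C) ?B"
    using finite_idems by (intro closedin_Union) (auto intro: closedin_above idems_closed)
  moreover have "?D \<subseteq> ?A \<union> ?B"
  proof
    fix y assume y: "y \<in> ?D"
    show "y \<in> ?A \<union> ?B"
    proof (cases "\<epsilon> y \<preceq> w")
      case True
      \<comment> \<open>An element of \<open>P w\<close> below a multiple of \<open>y\<close> would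
        lie below the idempotent \<open>w'\<close>, which \<open>contra\<close> excludes. Thus
        points of \<open>?D\<close> outside \<open>?A\<close> have a support not below
        \<open>w\<close> and fall into \<open>?B\<close>.\<close>
      have "y \<preceq> w"
      proof (rule ccontr)
        assume "\<not> y \<preceq> w"
        then obtain x t where x: "x \<in> P w" "0 < t" "t \<star> x \<preceq> y"
          using P_between[OF w _ True] y by blast
        then have xC: "x \<in> carrier C" using X_closed by (simp add: P_iff)
        have "t \<star> x \<preceq> w'" by (rule le_trans[OF x(3)]) (use y xC in auto)
        then have "x \<preceq> w'" using x xC scale0_le_idem_iff[OF w'] by simp
        then show False using contra x by blast
      qed
      then show ?thesis using y by simp
    next
      case False
      then have "\<epsilon> y \<in> ?U" "y \<in> carrier C" "\<epsilon> y \<preceq> y" using y supp_le by auto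
      then show ?thesis by blast
    qed
  qed
  moreover have "?A \<inter> ?B \<inter> ?D = {}"
    using le_trans idems_closed by blast
  moreover have "\<zero> \<in> ?A \<inter> ?D" using C by (simp add: zero_le)
  moreover have "w' \<in> ?B \<inter> ?D" using C w' nle by (auto simp: le_refl)
  ultimately have "\<not> connectedin (ctop C) ?D"
    unfolding connectedin_closedin by (metis (no_types, lifting) empty_iff)
  then show False using conn w' by (auto simp: strongly_connected_def)
qed

section \<open>Supports of positive functions\<close>

lemma positive_at_iff:
  "positive_at C X f w \<longleftrightarrow> w \<in> idems C \<and> (\<forall>x\<in>X. x \<preceq> w \<longrightarrow> f x = 0) \<and> (\<forall>x\<in>P w. 0 < f x)"
  by (auto simp: positive_at_def outer_set_def)

text \<open>If \<open>\<not> v \<preceq> w\<close>, then \<open>P_below_idem\<close> yields a point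
  of \<open>P w\<close> below \<open>v\<close>, where \<open>f\<close> would be both positive and
  zero.\<close>

lemma positive_at_unique:
  assumes "positive_at C X f v" "positive_at C X f w" shows "v = w"
proof -
  have le: "v \<preceq> w" if vw: "positive_at C X f v" "positive_at C X f w" for v w
  proof (rule ccontr)
    assume "\<not> v \<preceq> w"
    then obtain x where "x \<in> P w" "x \<preceq> v"
      using P_below_idem[of w v] vw by (auto simp: positive_at_iff)
    then show False using vw unfolding positive_at_iff by (metis P_iff less_irrefl)
  qed
  show ?thesis
    using le[OF assms] le[OF assms(2,1)] assms
    by (intro le_antisym) (auto simp: positive_at_iff idems_closed)
qed

lemma fun_supp_eq: "positive_at C X f w \<Longrightarrow> fun_supp C X f = w"
  unfolding fun_supp_def using positive_at_unique by blast

abbreviation V :: "('a \<Rightarrow> real) set" where "V \<equiv> carrier (pos_funs C X)"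

lemma V_iff: "f \<in> V \<longleftrightarrow> f \<in> X \<rightarrow>\<^sub>E UNIV \<and> (\<exists>w. positive_at C X f w)"
  by (simp add: pos_funs_def fun_space_def)

lemma V_add: "f \<oplus>\<^bsub>pos_funs C X\<^esub> g = (\<lambda>x\<in>X. f x + g x)"
  by (simp add: pos_funs_def fun_space_def)

lemma V_scale: "t \<odot>\<^bsub>pos_funs C X\<^esub> f = (\<lambda>x\<in>X. t * f x)"
  by (simp add: pos_funs_def fun_space_def)

lemma V_zero: "\<zero>\<^bsub>pos_funs C X\<^esub> = (\<lambda>x\<in>X. 0)"
  by (simp add: pos_funs_def fun_space_def)

lemma positive_at_supp: "f \<in> V \<Longrightarrow> positive_at C X f (fun_supp C X f)"
  using V_iff fun_supp_eq by blast

lemma supp_in_idems: "f \<in> V \<Longrightarrow> fun_supp C X f \<in> idems C"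
  using positive_at_supp by (auto simp: positive_at_iff)

lemma positive_at_in_V: "positive_at C X f w \<Longrightarrow> f \<in> X \<rightarrow>\<^sub>E UNIV \<Longrightarrow> f \<in> V"
  using V_iff by blast

lemma positive_at_nonneg:
  assumes "positive_at C X f w" "x \<in> X" "\<epsilon> x \<preceq> w" shows "0 \<le> f x"
  using assms by (cases "x \<preceq> w") (auto simp: positive_at_iff P_iff less_imp_le)

text \<open>A point of \<open>P (v \<sqinter>\<^sub>C w)\<close> has support below \<open>v\<close>
  and below \<open>w\<close>, so neither function is negative there; the point escapes
  \<open>v\<close> or \<open>w\<close>, and the corresponding function is positive.\<close>

lemma positive_at_add:
  assumes f: "positive_at C X f v" and g: "positive_at C X g w"
  shows "positive_at C X (\<lambda>x\<in>X. f x + g x) (v \<sqinter>\<^sub>C w)"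
proof -
  have vw: "v \<in> idems C" "w \<in> idems C" "v \<in> carrier C" "w \<in> carrier C"
    using f g by (auto simp: positive_at_iff idems_closed)
  have below: "z \<preceq> v \<sqinter>\<^sub>C w \<longleftrightarrow> z \<preceq> v \<and> z \<preceq> w" if "z \<in> carrier C" for z
    using vw that by (simp add: le_meet_iff)
  show ?thesis
    unfolding positive_at_iff
  proof (intro conjI ballI impI)
    fix x assume x: "x \<in> P (v \<sqinter>\<^sub>C w)"
    then have xX: "x \<in> X" "x \<in> carrier C" using X_closed by (auto simp: P_iff)
    have "\<epsilon> x \<preceq> v" "\<epsilon> x \<preceq> w" "\<not> (x \<preceq> v \<and> x \<preceq> w)"
      using x below xX by (auto simp: P_iff)
    moreover have "0 \<le> f x" "0 \<le> g x"
      using calculation xX positive_at_nonneg f g by auto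
    ultimately have "0 < f x \<or> 0 < g x"
      using f g xX by (auto simp: positive_at_iff P_iff)
    then show "0 < (\<lambda>x\<in>X. f x + g x) x"
      using xX \<open>0 \<le> f x\<close> \<open>0 \<le> g x\<close> by auto
  next
    fix x assume "x \<in> X" "x \<preceq> v \<sqinter>\<^sub>C w"
    then show "(\<lambda>x\<in>X. f x + g x) x = 0"
      using f g below X_closed by (auto simp: positive_at_iff)
  qed (use vw idems_meet in auto)
qed

lemma positive_at_scale:
  "positive_at C X f w \<Longrightarrow> 0 < t \<Longrightarrow> positive_at C X (\<lambda>x\<in>X. t * f x) w"
  using P_subset_X by (auto simp: positive_at_iff)

lemma V_add_closed:
  assumes "f \<in> V" "g \<in> V" shows "(\<lambda>x\<in>X. f x + g x) \<in> V"
  by (rule positive_at_in_V[OF positive_at_add[OF assms[THEN positive_at_supp]]]) auto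

lemma le_supp_add_iff:
  assumes "f \<in> V" "g \<in> V" "w \<in> carrier C"
  shows "w \<preceq> fun_supp C X (\<lambda>x\<in>X. f x + g x) \<longleftrightarrow> w \<preceq> fun_supp C X f \<and> w \<preceq> fun_supp C X g"
proof -
  let ?u = "fun_supp C X f" and ?v = "fun_supp C X g"
  have "fun_supp C X (\<lambda>x\<in>X. f x + g x) = ?u \<sqinter>\<^sub>C ?v"
    using assms positive_at_supp by (intro fun_supp_eq positive_at_add) auto
  moreover have "?u \<in> carrier C" "?v \<in> carrier C" using assms supp_in_idems idems_closed by auto
  ultimately show ?thesis
    using assms(3) by (simp add: le_meet_iff)
qed

lemma supp_scale:
  "f \<in> V \<Longrightarrow> 0 < t \<Longrightarrow> fun_supp C X (\<lambda>x\<in>X. t * f x) = fun_supp C X f"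
  by (intro fun_supp_eq positive_at_scale positive_at_supp)

lemma V_scale_closed: "f \<in> V \<Longrightarrow> 0 < t \<Longrightarrow> (\<lambda>x\<in>X. t * f x) \<in> V"
  by (rule positive_at_in_V[OF positive_at_scale[OF positive_at_supp]]) auto

lemma zero_fun:
  shows "(\<lambda>x\<in>X. 0) \<in> V" "w \<in> carrier C \<Longrightarrow> w \<preceq> fun_supp C X (\<lambda>x\<in>X. 0)"
proof -
  obtain u where u: "u \<in> idems C" "\<forall>x\<in>carrier C. x \<preceq> u" using exists_top_idem by blast
  then have *: "positive_at C X (\<lambda>x\<in>X. 0) u"
    using X_closed by (auto simp: positive_at_iff P_iff)
  then show "(\<lambda>x\<in>X. 0) \<in> V" by (rule positive_at_in_V) auto
  show "w \<preceq> fun_supp C X (\<lambda>x\<in>X. 0)" if "w \<in> carrier C"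
    using fun_supp_eq[OF *] u that by simp
qed

section \<open>Values of the pairing\<close>

lemma representation_coeffs:
  assumes "representation C X y S \<alpha> w"
  defines "a \<equiv> \<lambda>x. if x \<in> S then \<alpha> x else 0"
  shows "y \<in> carrier C" "\<epsilon> y = w" "coeffs w a" "y = comb a X \<oplus> w"
    "(\<Sum>x\<in>S. \<alpha> x * f x) = (\<Sum>x\<in>X. a x * f x)"
proof -
  have S: "finite S" "S \<subseteq> X" "\<And>x. x \<in> S \<Longrightarrow> 0 < \<alpha> x" "w \<in> idems C"
    "\<And>x. x \<in> S \<Longrightarrow> \<epsilon> x \<preceq> w \<and> \<not> x \<preceq> w" "y = (\<Oplus>x\<in>S. \<alpha> x \<odot> x) \<oplus> w"
    using assms(1) by (auto simp: representation_def)
  have "comb a X = comb a S"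
    using finite_X X_carrier S by (intro comb_mono_neutral) (auto simp: a_def)
  also have "\<dots> = (\<Oplus>x\<in>S. \<alpha> x \<odot> x)"
    using S X_closed by (intro finsum_cong') (auto simp: a_def scale0_pos scale_closed)
  finally show y: "y = comb a X \<oplus> w" using S by simp
  show "y \<in> carrier C" unfolding y using X_carrier S by (simp add: idems_closed)
  show "coeffs w a" using S by (auto simp: coeffs_def a_def P_iff less_imp_le)
  show "\<epsilon> y = w" unfolding y using S by (intro supp_comb_coeffs) (auto simp: a_def split: if_splits)
  have "(\<Sum>x\<in>X. a x * f x) = (\<Sum>x\<in>S. a x * f x)"
    using finite_X S by (intro sum.mono_neutral_right) (auto simp: a_def)
  then show "(\<Sum>x\<in>S. \<alpha> x * f x) = (\<Sum>x\<in>X. a x * f x)" by (simp add: a_def)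
qed

lemma coeffs_representation:
  assumes w: "w \<in> idems C" and a: "coeffs w a"
  shows "representation C X (comb a X \<oplus> w) {x \<in> X. 0 < a x} a w"
proof -
  let ?S = "{x \<in> X. 0 < a x}"
  have "comb a X = comb a ?S"
    using finite_X X_carrier a by (intro comb_mono_neutral) (auto simp: coeffs_def not_less intro: order_antisym)
  also have "\<dots> = (\<Oplus>x\<in>?S. a x \<odot> x)"
    using X_closed by (intro finsum_cong') (auto simp: scale0_pos scale_closed)
  finally have "comb a X = (\<Oplus>x\<in>?S. a x \<odot> x)" .
  moreover have "\<epsilon> x \<preceq> w \<and> \<not> x \<preceq> w" if "x \<in> ?S" for x
    using a that unfolding coeffs_def P_iff by (metis (mono_tags) less_irrefl mem_Collect_eq)
  ultimately show ?thesis using finite_X w by (auto simp: representation_def)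
qed

text \<open>The description in \<open>pairing\<close> denotes: the idempotent of a representation is
  recovered as \<open>\<epsilon> ?y\<close>, and its coefficients are unique.\<close>

lemma pairing_coeffs:
  assumes w: "w \<in> idems C" and a: "coeffs w a"
  shows "pairing C X (comb a X \<oplus> w) f =
    (if w \<preceq> fun_supp C X f then ennreal (\<Sum>x\<in>X. a x * f x) else \<infinity>)"
proof -
  let ?y = "comb a X \<oplus> w"
  let ?val = "\<lambda>S \<alpha> w. if w \<preceq> fun_supp C X f then ennreal (\<Sum>x\<in>S. \<alpha> x * f x) else \<infinity>"
  have ey: "\<epsilon> ?y = w" using w coeffs_supp[OF a] by (intro supp_comb_coeffs) auto
  have val: "?val S \<alpha> v = ?val X a w" if "representation C X ?y S \<alpha> v" for S \<alpha> v
  proof -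
    note r = representation_coeffs[OF that]
    have v: "v = w" using r(2) ey by simp
    have "(\<lambda>x. if x \<in> S then \<alpha> x else 0) = a"
      using r(3,4) unfolding v by (intro coeffs_unique[OF w _ a]) auto
    then have "(if x \<in> S then \<alpha> x else 0) = a x" for x by (rule fun_cong)
    then show ?thesis using r(5)[of f] v by simp
  qed
  show ?thesis
    unfolding pairing_def
  proof (rule the_equality)
    show "\<exists>S \<alpha> v. representation C X ?y S \<alpha> v \<and> ?val X a w = ?val S \<alpha> v"
    proof (intro exI conjI)
      show rep: "representation C X ?y {x \<in> X. 0 < a x} a w"
        by (rule coeffs_representation[OF w a])
      show "?val X a w = ?val {x \<in> X. 0 < a x} a w"
        by (rule val[OF rep, symmetric])
    qed
  next
    fix r assume "\<exists>S \<alpha> v. representation C X ?y S \<alpha> v \<and> r = ?val S \<alpha> v"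
    then obtain S \<alpha> v where "representation C X ?y S \<alpha> v" "r = ?val S \<alpha> v"
      by (elim exE conjE)
    then show "r = ?val X a w" using val by simp
  qed
qed

lemma pairing_eq:
  assumes w: "w \<in> idems C" and a: "\<And>x. x \<in> X \<Longrightarrow> 0 \<le> a x" "\<And>x. x \<in> X \<Longrightarrow> 0 < a x \<Longrightarrow> \<epsilon> x \<preceq> w"
    and f: "f \<in> V"
  shows "pairing C X (comb a X \<oplus> w) f =
    (if w \<preceq> fun_supp C X f then ennreal (\<Sum>x\<in>X. a x * f x) else \<infinity>)"
proof -
  define b where "b x = (if x \<in> X \<and> \<not> x \<preceq> w then a x else 0)" for x
  have wC: "w \<in> carrier C" using w by (rule idems_closed)
  have b: "coeffs w b" using a by (auto simp: coeffs_def b_def P_iff less_le)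
  have "comb a X = comb (\<lambda>x. b x + (a x - b x)) X" by simp
  also have "\<dots> = comb b X \<oplus> comb (\<lambda>x. a x - b x) X"
    using X_carrier a by (intro comb_add[symmetric]) (auto simp: b_def)
  finally have eq: "comb a X = comb b X \<oplus> comb (\<lambda>x. a x - b x) X" .
  have "comb (\<lambda>x. a x - b x) X \<preceq> w"
    using w X_carrier by (intro comb_le_idem) (auto simp: b_def split: if_splits)
  then have "comb a X \<oplus> w = comb b X \<oplus> w"
    unfolding eq using w wC X_carrier by (simp add: a_assoc le_idem_absorb)
  moreover have "(\<Sum>x\<in>X. a x * f x) = (\<Sum>x\<in>X. b x * f x)" if "w \<preceq> fun_supp C X f"
  proof (rule sum.cong[OF refl])
    fix x assume x: "x \<in> X"
    have "f x = 0" if "x \<preceq> w"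
      using positive_at_supp[OF f] le_trans[OF that \<open>w \<preceq> fun_supp C X f\<close>] x X_closed
      by (auto simp: positive_at_iff)
    then show "a x * f x = b x * f x" using x by (auto simp: b_def)
  qed
  ultimately show ?thesis using pairing_coeffs[OF w b] by simp
qed

text \<open>\<open>f\<close> may be negative somewhere, but not where \<open>a\<close> is positive.
  Without this, \<open>ennreal\<close> would truncate and additivity would fail.\<close>

lemma pairing_sum_nonneg:
  assumes "w \<in> idems C" "\<And>x. x \<in> X \<Longrightarrow> 0 \<le> a x" "\<And>x. x \<in> X \<Longrightarrow> 0 < a x \<Longrightarrow> \<epsilon> x \<preceq> w"
    and f: "f \<in> V" "w \<preceq> fun_supp C X f"
  shows "0 \<le> (\<Sum>x\<in>X. a x * f x)"
proof (rule sum_nonneg)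
  fix x assume x: "x \<in> X"
  show "0 \<le> a x * f x"
  proof (cases "a x = 0")
    case False
    then have "0 < a x" using assms(2)[OF x] by simp
    then have "\<epsilon> x \<preceq> fun_supp C X f"
      using le_trans[OF assms(3)[OF x] f(2)] X_closed[OF x] by simp
    then have "0 \<le> f x" using positive_at_supp f x by (intro positive_at_nonneg) auto
    then show ?thesis using \<open>0 < a x\<close> by simp
  qed simp
qed

lemma exists_nonneg_coeffs:
  assumes "y \<in> carrier C"
  obtains a where "\<And>x. 0 \<le> a x" "\<And>x. 0 < a x \<Longrightarrow> \<epsilon> x \<preceq> \<epsilon> y" "y = comb a X \<oplus> \<epsilon> y" "coeffs (\<epsilon> y) a"
proof -
  from exists_coeffs[OF assms] obtain a where a: "coeffs (\<epsilon> y) a" "y = comb a X \<oplus> \<epsilon> y" by blast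
  show ?thesis
    by (rule that[OF _ coeffs_supp[OF a(1)] a(2,1)]) (use a in \<open>auto simp: coeffs_def\<close>)
qed

section \<open>Bilinearity of the pairing\<close>

lemma pairing_add_left:
  assumes y: "y \<in> carrier C" and z: "z \<in> carrier C" and f: "f \<in> V"
  shows "pairing C X (y \<oplus> z) f = pairing C X y f + pairing C X z f"
proof -
  obtain a where a: "\<And>x. 0 \<le> a x" "\<And>x. 0 < a x \<Longrightarrow> \<epsilon> x \<preceq> \<epsilon> y" "y = comb a X \<oplus> \<epsilon> y"
    by (rule exists_nonneg_coeffs[OF y]) blast
  obtain b where b: "\<And>x. 0 \<le> b x" "\<And>x. 0 < b x \<Longrightarrow> \<epsilon> x \<preceq> \<epsilon> z" "z = comb b X \<oplus> \<epsilon> z"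
    by (rule exists_nonneg_coeffs[OF z]) blast
  let ?w = "\<epsilon> y \<oplus> \<epsilon> z" and ?s = "fun_supp C X f"
  have w: "?w \<in> idems C" using y z by (intro idems_add) auto
  have s: "?s \<in> idems C" using f by (rule supp_in_idems)
  \<comment> \<open>The pairing with the sum is thus infinite exactly when one of the two pairings
    is.\<close>
  have le: "?w \<preceq> ?s \<longleftrightarrow> \<epsilon> y \<preceq> ?s \<and> \<epsilon> z \<preceq> ?s"
    using idem_lub[OF s] le_trans[OF le_add1[of "\<epsilon> y" "\<epsilon> z"]] le_trans[OF le_add2[of "\<epsilon> y" "\<epsilon> z"]] y z
    by auto
  have ab: "\<epsilon> x \<preceq> ?w" if x: "x \<in> X" and "0 < a x + b x" for x
  proof -
    have "0 < a x \<or> 0 < b x" using \<open>0 < a x + b x\<close> by auto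
    then show ?thesis
    proof
      assume "0 < a x"
      from le_trans[OF a(2)[OF this] le_add1] show ?thesis using y z X_closed[OF x] by simp
    next
      assume "0 < b x"
      from le_trans[OF b(2)[OF this] le_add2] show ?thesis using y z X_closed[OF x] by simp
    qed
  qed
  have "y \<oplus> z = (comb a X \<oplus> \<epsilon> y) \<oplus> (comb b X \<oplus> \<epsilon> z)" using a(3) b(3) by simp
  also have "\<dots> = comb (\<lambda>x. a x + b x) X \<oplus> ?w"
    using y z X_carrier a(1) b(1) by (subst comb_add[symmetric]) (auto simp: a_ac)
  finally have "pairing C X (y \<oplus> z) f = (if ?w \<preceq> ?s then ennreal (\<Sum>x\<in>X. (a x + b x) * f x) else \<infinity>)"
    using pairing_eq[OF w _ ab f] a(1) b(1) by simp
  moreover have "pairing C X y f = (if \<epsilon> y \<preceq> ?s then ennreal (\<Sum>x\<in>X. a x * f x) else \<infinity>)"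
    by (subst a(3), rule pairing_eq) (use y f a in auto)
  moreover have "pairing C X z f = (if \<epsilon> z \<preceq> ?s then ennreal (\<Sum>x\<in>X. b x * f x) else \<infinity>)"
    by (subst b(3), rule pairing_eq) (use z f b in auto)
  moreover have "ennreal (\<Sum>x\<in>X. (a x + b x) * f x) = ennreal (\<Sum>x\<in>X. a x * f x) + ennreal (\<Sum>x\<in>X. b x * f x)"
    if "\<epsilon> y \<preceq> ?s" "\<epsilon> z \<preceq> ?s"
    using pairing_sum_nonneg[of "\<epsilon> y" a f] pairing_sum_nonneg[of "\<epsilon> z" b f] a b y z f that
    by (simp add: distrib_right sum.distrib)
  ultimately show ?thesis using le by auto
qed

lemma pairing_scale_left:
  assumes y: "y \<in> carrier C" and f: "f \<in> V" and t: "0 < t"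
  shows "pairing C X (t \<odot> y) f = ennreal t * pairing C X y f"
proof -
  obtain a where a: "\<And>x. 0 \<le> a x" "\<And>x. 0 < a x \<Longrightarrow> \<epsilon> x \<preceq> \<epsilon> y" "y = comb a X \<oplus> \<epsilon> y"
    by (rule exists_nonneg_coeffs[OF y]) blast
  let ?s = "fun_supp C X f"
  have "t \<odot> y = t \<star> (comb a X \<oplus> \<epsilon> y)" using t a(3) by (simp add: scale0_pos)
  also have "\<dots> = comb (\<lambda>x. t * a x) X \<oplus> \<epsilon> y"
    using y t X_carrier a(1) by (simp add: scale0_add_idem comb_scale0)
  finally have "pairing C X (t \<odot> y) f = (if \<epsilon> y \<preceq> ?s then ennreal (\<Sum>x\<in>X. t * a x * f x) else \<infinity>)"
    using pairing_eq[of "\<epsilon> y" "\<lambda>x. t * a x" f] y f a t by (simp add: zero_less_mult_iff)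
  moreover have "pairing C X y f = (if \<epsilon> y \<preceq> ?s then ennreal (\<Sum>x\<in>X. a x * f x) else \<infinity>)"
    by (subst a(3), rule pairing_eq) (use y f a in auto)
  moreover have "ennreal (\<Sum>x\<in>X. t * a x * f x) = ennreal t * ennreal (\<Sum>x\<in>X. a x * f x)"
    using t by (simp add: ennreal_mult' sum_distrib_left mult.assoc flip: ennreal_mult')
  ultimately show ?thesis using t by (auto simp: ennreal_mult_top)
qed

lemma pairing_add_right:
  assumes y: "y \<in> carrier C" and f: "f \<in> V" and g: "g \<in> V"
  shows "pairing C X y (\<lambda>x\<in>X. f x + g x) = pairing C X y f + pairing C X y g"
proof -
  obtain a where a: "\<And>x. 0 \<le> a x" "\<And>x. 0 < a x \<Longrightarrow> \<epsilon> x \<preceq> \<epsilon> y" "y = comb a X \<oplus> \<epsilon> y"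
    by (rule exists_nonneg_coeffs[OF y]) blast
  have *: "pairing C X y h = (if \<epsilon> y \<preceq> fun_supp C X h then ennreal (\<Sum>x\<in>X. a x * h x) else \<infinity>)" if "h \<in> V" for h
    by (subst a(3), rule pairing_eq) (use y that a in auto)
  have "ennreal (\<Sum>x\<in>X. a x * (\<lambda>x\<in>X. f x + g x) x) = ennreal (\<Sum>x\<in>X. a x * f x) + ennreal (\<Sum>x\<in>X. a x * g x)"
    if "\<epsilon> y \<preceq> fun_supp C X f" "\<epsilon> y \<preceq> fun_supp C X g"
    using pairing_sum_nonneg[of "\<epsilon> y" a f] pairing_sum_nonneg[of "\<epsilon> y" a g] a y f g that
    by (simp add: distrib_left sum.distrib)
  then show ?thesis
    using f g y by (auto simp: * V_add_closed le_supp_add_iff)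
qed

lemma pairing_scale_right:
  assumes y: "y \<in> carrier C" and f: "f \<in> V" and t: "0 < t"
  shows "pairing C X y (\<lambda>x\<in>X. t * f x) = ennreal t * pairing C X y f"
proof -
  obtain a where a: "\<And>x. 0 \<le> a x" "\<And>x. 0 < a x \<Longrightarrow> \<epsilon> x \<preceq> \<epsilon> y" "y = comb a X \<oplus> \<epsilon> y"
    by (rule exists_nonneg_coeffs[OF y]) blast
  have *: "pairing C X y h = (if \<epsilon> y \<preceq> fun_supp C X h then ennreal (\<Sum>x\<in>X. a x * h x) else \<infinity>)" if "h \<in> V" for h
    by (subst a(3), rule pairing_eq) (use y that a in auto)
  have "(\<Sum>x\<in>X. a x * (\<lambda>x\<in>X. t * f x) x) = t * (\<Sum>x\<in>X. a x * f x)"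
    by (simp add: sum_distrib_left mult.left_commute)
  then show ?thesis
    using f t by (simp add: * V_scale_closed supp_scale ennreal_mult_top ennreal_mult')
qed

lemma pairing_zero_right:
  assumes y: "y \<in> carrier C" shows "pairing C X y (\<lambda>x\<in>X. 0) = 0"
proof -
  obtain a where a: "\<And>x. 0 \<le> a x" "\<And>x. 0 < a x \<Longrightarrow> \<epsilon> x \<preceq> \<epsilon> y" "y = comb a X \<oplus> \<epsilon> y"
    by (rule exists_nonneg_coeffs[OF y]) blast
  show ?thesis
    by (subst a(3), subst pairing_eq) (use y a zero_fun in auto)
qed

end

section \<open>Monoid morphisms and continuity\<close>

text \<open>Cauchy's functional equation for a monotone function. Comparing \<open>n * t\<close>
  with its integer part bounds \<open>n\<close> times the defect of linearity by \<open>h 1\<close>,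
  for every \<open>n\<close>.\<close>

lemma additive_nonneg_linear:
  fixes h :: "real \<Rightarrow> real"
  assumes add: "\<And>s t. 0 \<le> s \<Longrightarrow> 0 \<le> t \<Longrightarrow> h (s + t) = h s + h t"
    and nonneg: "\<And>t. 0 \<le> t \<Longrightarrow> 0 \<le> h t" and t: "0 \<le> t"
  shows "h t = t * h 1"
proof (rule ccontr)
  assume "h t \<noteq> t * h 1"
  then have "0 < \<bar>h t - t * h 1\<bar>" by simp
  then obtain n where n: "h 1 < real n * \<bar>h t - t * h 1\<bar>"
    using reals_Archimedean3 by blast
  have mono: "h r \<le> h s" if "0 \<le> r" "r \<le> s" for r s
    using add[of r "s - r"] nonneg[of "s - r"] that by simp
  have mult: "h (real m * s) = real m * h s" if "0 \<le> s" for m s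
  proof (induction m)
    case 0
    show ?case using add[of 0 0] by simp
  next
    case (Suc m)
    have "h (real (Suc m) * s) = h (real m * s + s)" by (simp add: algebra_simps)
    also have "\<dots> = h (real m * s) + h s" using that by (intro add) auto
    finally show ?case using Suc by (simp add: algebra_simps)
  qed
  define k where "k = nat \<lfloor>real n * t\<rfloor>"
  have k: "real k \<le> real n * t" "real n * t \<le> real (Suc k)"
    using t by (auto simp: k_def) linarith
  have "h (real k * 1) \<le> h (real n * t)" "h (real n * t) \<le> h (real (Suc k) * 1)"
    using k t by (intro mono; simp)+
  then have 1: "real k * h 1 \<le> real n * h t" "real n * h t \<le> real (Suc k) * h 1"
    using mult[of 1 k] mult[of t n] mult[of 1 "Suc k"] t by simp_all
  have "real k * h 1 \<le> (real n * t) * h 1" "(real n * t) * h 1 \<le> real (Suc k) * h 1"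
    using k nonneg[of 1] by (intro mult_right_mono; simp)+
  then have "\<bar>real n * h t - real n * t * h 1\<bar> \<le> h 1"
    using 1 by (simp add: abs_le_iff algebra_simps)
  moreover have "\<bar>real n * h t - real n * t * h 1\<bar> = real n * \<bar>h t - t * h 1\<bar>"
  proof -
    have "real n * h t - real n * t * h 1 = real n * (h t - t * h 1)" by (simp add: algebra_simps)
    then show ?thesis by (simp add: abs_mult)
  qed
  ultimately show False using n by simp
qed

text \<open>Open rays generate the topology of \<open>ennreal\<close>. Only finite thresholds are
  needed, since the set where \<open>g\<close> is infinite is the intersection of the sets where
  \<open>g\<close> is at least \<open>n\<close>.\<close>

lemma continuous_map_ennrealI:
  fixes g :: "'a \<Rightarrow> ennreal"
  assumes le: "\<And>M. 0 \<le> M \<Longrightarrow> closedin T {x \<in> topspace T. g x \<le> ennreal M}"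
    and ge: "\<And>M. 0 \<le> M \<Longrightarrow> closedin T {x \<in> topspace T. ennreal M \<le> g x}"
  shows "continuous_map T euclidean g"
proof -
  have compl: "openin T {x \<in> topspace T. \<not> Q x}" if "closedin T {x \<in> topspace T. Q x}" for Q
  proof -
    have "{x \<in> topspace T. \<not> Q x} = topspace T - {x \<in> topspace T. Q x}" by auto
    then show ?thesis using that by (simp add: closedin_def)
  qed
  have "openin T {x \<in> topspace T. g x \<in> U}" if "open U" for U
    using that unfolding open_generated_order
  proof (induction rule: generate_topology.induct)
    case UNIV
    then show ?case by simp
  next
    case (Int A B)
    have eq: "{x \<in> topspace T. g x \<in> A \<inter> B} = {x \<in> topspace T. g x \<in> A} \<inter> {x \<in> topspace T. g x \<in> B}"
      by auto
    show ?case unfolding eq by (intro openin_Int Int.IH)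
  next
    case (UN K)
    have "{x \<in> topspace T. g x \<in> \<Union>K} = (\<Union>A\<in>K. {x \<in> topspace T. g x \<in> A})"
      by auto
    then show ?case using UN by auto
  next
    case (Basis A)
    then obtain a where "A = {..<a} \<or> A = {a<..}" by auto
    then show ?case
    proof
      assume A: "A = {..<a}"
      have "closedin T {x \<in> topspace T. a \<le> g x}"
      proof (cases a)
        case (real M)
        then show ?thesis using ge by simp
      next
        case top
        have "{x \<in> topspace T. a \<le> g x} = (\<Inter>n::nat. {x \<in> topspace T. ennreal (real n) \<le> g x})"
        proof -
          have "g x = \<infinity>" if *: "\<And>n::nat. ennreal (real n) \<le> g x" for x
          proof (cases "g x")
            case (real r)
            obtain n :: nat where "r < real n" using reals_Archimedean2 by blast
            then show ?thesis using *[of n] real by (simp add: ennreal_le_iff)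
          qed simp
          then show ?thesis using top by (auto simp: top_unique)
        qed
        then show ?thesis by (auto intro!: closedin_Inter ge)
      qed
      then show ?thesis using compl[of "\<lambda>x. a \<le> g x"] A by (simp add: not_le)
    next
      assume A: "A = {a<..}"
      show ?thesis
      proof (cases a)
        case (real M)
        then show ?thesis using compl[OF le[of M]] A by (simp add: not_le)
      next
        case top
        then show ?thesis using A by simp
      qed
    qed
  qed
  then show ?thesis by (auto simp: continuous_map_def)
qed

context strongly_connected_fg_cone
begin

text \<open>For \<open>s = 0\<close> and \<open>c = 1\<close> this is the indicator function of \<open>O\<^sub>w\<close>.\<close>

definition bump :: "'a \<Rightarrow> real \<Rightarrow> 'a \<Rightarrow> real \<Rightarrow> 'a \<Rightarrow> real" where
  "bump w c z s = (\<lambda>x\<in>X. if x \<preceq> w then 0 else c + (if x = z then s else 0))"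

abbreviation ind :: "'a \<Rightarrow> 'a \<Rightarrow> real" where "ind w \<equiv> bump w 1 \<zero> 0"

text \<open>The height at \<open>z\<close> is constrained only for \<open>z\<close> in
  \<open>P w\<close>; elsewhere \<open>s\<close> may be any real number. Both cases are exploited in
  \<open>hom_representable\<close>.\<close>

lemma positive_at_bump:
  assumes "w \<in> idems C" "0 < c" "z \<in> P w \<Longrightarrow> 0 < c + s"
  shows "positive_at C X (bump w c z s) w"
  using assms by (auto simp: positive_at_iff bump_def P_iff)

lemma bump_in_V:
  assumes "w \<in> idems C" "0 < c" "z \<in> P w \<Longrightarrow> 0 < c + s"
  shows "bump w c z s \<in> V" "fun_supp C X (bump w c z s) = w"
proof -
  show "bump w c z s \<in> V"
    by (rule positive_at_in_V[OF positive_at_bump[OF assms]]) (auto simp: bump_def)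
  show "fun_supp C X (bump w c z s) = w"
    by (rule fun_supp_eq[OF positive_at_bump[OF assms]])
qed

lemma ind_in_V: "w \<in> idems C \<Longrightarrow> ind w \<in> V" "w \<in> idems C \<Longrightarrow> fun_supp C X (ind w) = w"
  by (simp_all add: bump_in_V)

lemma sum_bump:
  assumes "z \<in> A" "finite A" "A \<subseteq> X" "\<And>x. x \<in> A \<Longrightarrow> x \<preceq> w \<Longrightarrow> a x = 0"
  shows "(\<Sum>x\<in>A. a x * bump w c z s x) = c * (\<Sum>x\<in>A. a x) + s * a z"
proof -
  have "(\<Sum>x\<in>A. a x * bump w c z s x) = (\<Sum>x\<in>A. c * a x + (if x = z then s * a z else 0))"
    using assms by (intro sum.cong) (auto simp: bump_def algebra_simps)
  also have "\<dots> = c * (\<Sum>x\<in>A. a x) + s * a z"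
    using assms by (simp add: sum.distrib sum_distrib_left)
  finally show ?thesis .
qed

lemma pairing_infinite_iff:
  assumes y: "y \<in> carrier C"
  shows "pairing C X y f = \<infinity> \<longleftrightarrow> \<not> \<epsilon> y \<preceq> fun_supp C X f"
proof -
  obtain a where a: "y = comb a X \<oplus> \<epsilon> y" "coeffs (\<epsilon> y) a"
    by (rule exists_nonneg_coeffs[OF y]) blast
  show ?thesis
    by (subst a(1), subst pairing_coeffs[OF _ a(2)]) (use y in auto)
qed

lemma coeffs_le_zero: "coeffs w a \<Longrightarrow> x \<preceq> w \<Longrightarrow> a x = 0"
  by (auto simp: coeffs_def P_iff)

text \<open>The functions \<open>ind w\<close> detect through infinite values which idempotents
  dominate \<open>\<epsilon> y\<close>. Once the supports agree, changing the height of
  \<open>bump\<close> at \<open>x\<close> isolates the coefficient of \<open>x\<close>.\<close>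

lemma pairing_injective:
  assumes y: "y \<in> carrier C" and z: "z \<in> carrier C"
    and eq: "\<And>f. f \<in> V \<Longrightarrow> pairing C X y f = pairing C X z f"
  shows "y = z"
proof -
  have "\<epsilon> y \<preceq> w \<longleftrightarrow> \<epsilon> z \<preceq> w" if "w \<in> idems C" for w
    using pairing_infinite_iff[OF y, of "ind w"] pairing_infinite_iff[OF z, of "ind w"]
      eq[of "ind w"] ind_in_V[OF that] by simp
  from this[of "\<epsilon> y"] this[of "\<epsilon> z"] have e: "\<epsilon> z = \<epsilon> y"
    using y z by (intro le_antisym) (auto simp: le_refl)
  have w: "\<epsilon> y \<in> idems C" using y by simp
  obtain a where a: "y = comb a X \<oplus> \<epsilon> y" "coeffs (\<epsilon> y) a"
    by (rule exists_nonneg_coeffs[OF y]) blast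
  obtain b where b: "z = comb b X \<oplus> \<epsilon> y" "coeffs (\<epsilon> y) b"
    unfolding e[symmetric] by (rule exists_nonneg_coeffs[OF z]) blast
  have "a x = b x" for x
  proof (cases "x \<in> P (\<epsilon> y)")
    case True
    then have xX: "x \<in> X" by (simp add: P_iff)
    have val: "pairing C X (comb d X \<oplus> \<epsilon> y) (bump (\<epsilon> y) 1 x s) = ennreal ((\<Sum>x\<in>X. d x) + s * d x)"
      if "coeffs (\<epsilon> y) d" "0 \<le> s" for d s
      using pairing_coeffs[OF w that(1)] bump_in_V[OF w, of 1 x s] that y
        sum_bump[of x X "\<epsilon> y" d 1 s, OF xX finite_X subset_refl] coeffs_le_zero[OF that(1)]
      by (simp add: le_refl)
    have "(\<Sum>x\<in>X. a x) + s * a x = (\<Sum>x\<in>X. b x) + s * b x" if "0 \<le> s" for s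
    proof -
      have "pairing C X y (bump (\<epsilon> y) 1 x s) = pairing C X z (bump (\<epsilon> y) 1 x s)"
        using bump_in_V[OF w, of 1 x s] that by (intro eq) auto
      then have "ennreal ((\<Sum>x\<in>X. a x) + s * a x) = ennreal ((\<Sum>x\<in>X. b x) + s * b x)"
        using val[OF a(2) that] val[OF b(2) that] by (simp only: a(1)[symmetric] b(1)[symmetric])
      moreover have "0 \<le> (\<Sum>x\<in>X. a x) + s * a x" "0 \<le> (\<Sum>x\<in>X. b x) + s * b x"
        using a(2) b(2) that by (auto simp: coeffs_def intro!: add_nonneg_nonneg sum_nonneg)
      ultimately show ?thesis by simp
    qed
    from this[of 0] this[of 1] show ?thesis by simp
  next
    case False
    then show ?thesis using a(2) b(2) by (auto simp: coeffs_def)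
  qed
  then have "a = b" by blast
  then show ?thesis using a b by simp
qed

section \<open>Monoid morphisms come from points of the cone\<close>

context
  fixes \<phi> :: "('a \<Rightarrow> real) \<Rightarrow> ennreal"
  assumes hom: "\<phi> \<in> hom_carrier (pos_funs C X)"
begin

lemma hom_zero: "\<phi> (\<lambda>x\<in>X. 0) = 0"
  using hom by (simp add: hom_carrier_def V_zero)

lemma hom_add: "f \<in> V \<Longrightarrow> g \<in> V \<Longrightarrow> \<phi> (\<lambda>x\<in>X. f x + g x) = \<phi> f + \<phi> g"
  using hom by (simp add: hom_carrier_def V_add)

lemma hom_multiple:
  assumes f: "f \<in> V" "\<phi> f \<noteq> \<infinity>"
  shows "(\<lambda>x\<in>X. real n * f x) \<in> V \<and> \<phi> (\<lambda>x\<in>X. real n * f x) \<noteq> \<infinity>"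
proof (induction n)
  case 0
  have "(\<lambda>x\<in>X. real 0 * f x) = (\<lambda>x\<in>X. 0)" by simp
  then show ?case using zero_fun(1) hom_zero by (metis ennreal_zero_neq_top infinity_ennreal_def)
next
  case (Suc n)
  let ?g = "\<lambda>x\<in>X. real n * f x"
  have eq: "(\<lambda>x\<in>X. real (Suc n) * f x) = (\<lambda>x\<in>X. ?g x + f x)"
    by (auto simp: algebra_simps)
  have g: "?g \<in> V" "\<phi> ?g \<noteq> \<infinity>" using Suc by blast+
  then have "\<phi> ?g + \<phi> f \<noteq> \<infinity>" using f(2) by (metis ennreal_add_eq_top infinity_ennreal_def)
  then show ?case
    unfolding eq using V_add_closed[OF g(1) f(1)] hom_add[OF g(1) f(1)] by (simp only: simp_thms)
qed

text \<open>For large \<open>n\<close> the function \<open>n * f - g\<close> is again positive with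
  the support of \<open>f\<close>, and adding \<open>g\<close> to it gives \<open>n * f\<close>,
  where the morphism is finite.\<close>

lemma hom_finite_mono:
  assumes f: "f \<in> V" "\<phi> f \<noteq> \<infinity>" and g: "g \<in> V" and le: "fun_supp C X f \<preceq> fun_supp C X g"
  shows "\<phi> g \<noteq> \<infinity>"
proof -
  let ?w = "fun_supp C X f"
  have fw: "positive_at C X f ?w" and gw: "positive_at C X g (fun_supp C X g)"
    using f g positive_at_supp by auto
  have w: "?w \<in> idems C" by (rule supp_in_idems[OF f(1)])
  have fin: "finite (P ?w)" using w by (rule P_generates)
  \<comment> \<open>The sum of the finitely many ratios exceeds each of them, so a single
    \<open>n\<close> works at every point of \<open>P ?w\<close>.\<close>
  obtain n where n: "(\<Sum>x\<in>P ?w. \<bar>g x\<bar> / f x) < real n" using reals_Archimedean2 by blast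
  have less: "g x < real n * f x" if x: "x \<in> P ?w" for x
  proof -
    have pos: "0 < f y" if "y \<in> P ?w" for y using fw that by (simp add: positive_at_iff)
    have "\<bar>g x\<bar> / f x \<le> (\<Sum>x\<in>P ?w. \<bar>g x\<bar> / f x)"
      using fin x pos by (intro member_le_sum) (auto intro: divide_nonneg_pos)
    then have "\<bar>g x\<bar> / f x < real n" using n by simp
    then show ?thesis using pos[OF x] by (simp add: divide_less_eq)
  qed
  define h where "h = (\<lambda>x\<in>X. real n * f x - g x)"
  have "positive_at C X h ?w"
    unfolding positive_at_iff
  proof (intro conjI ballI impI w)
    fix x assume x: "x \<in> X" "x \<preceq> ?w"
    have "x \<preceq> fun_supp C X g" using le_trans[OF x(2) le X_closed[OF x(1)]] .
    then show "h x = 0" using x fw gw by (simp add: positive_at_iff h_def)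
  qed (use less in \<open>auto simp: h_def P_iff\<close>)
  then have h: "h \<in> V" by (rule positive_at_in_V) (auto simp: h_def)
  have "(\<lambda>x\<in>X. h x + g x) = (\<lambda>x\<in>X. real n * f x)" by (auto simp: h_def)
  then have "\<phi> h + \<phi> g \<noteq> \<infinity>" using hom_multiple[OF f, of n] hom_add[OF h g] by simp
  then show ?thesis by (auto simp: ennreal_add_eq_top)
qed

text \<open>The idempotents \<open>v\<close> with a finite value at \<open>ind v\<close> are stable
  under meets, because \<open>ind v + ind w\<close> has support the meet of \<open>v\<close> and
  \<open>w\<close>. Being finite in number, they have a least element.\<close>

lemma hom_finite_iff:
  "\<exists>w\<in>idems C. \<forall>f\<in>V. \<phi> f \<noteq> \<infinity> \<longleftrightarrow> w \<preceq> fun_supp C X f"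
proof -
  define F where "F = {w \<in> idems C. \<phi> (ind w) \<noteq> \<infinity>}"
  have in_F: "fun_supp C X f \<in> F" if "f \<in> V" "\<phi> f \<noteq> \<infinity>" for f
  proof -
    have s: "fun_supp C X f \<in> idems C" by (rule supp_in_idems[OF that(1)])
    then have "fun_supp C X f \<preceq> fun_supp C X f" using idems_closed le_refl by blast
    then have "\<phi> (ind (fun_supp C X f)) \<noteq> \<infinity>"
      using s by (intro hom_finite_mono[OF that]) (auto simp: ind_in_V)
    then show ?thesis using s by (simp add: F_def)
  qed
  have meet: "v \<sqinter>\<^sub>C w \<in> F" if "v \<in> F" "w \<in> F" for v w
  proof -
    have vw: "v \<in> idems C" "w \<in> idems C" using that by (auto simp: F_def)
    let ?f = "\<lambda>x\<in>X. ind v x + ind w x"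
    have "?f \<in> V" using vw by (intro V_add_closed ind_in_V)
    moreover have "\<phi> ?f \<noteq> \<infinity>"
      using that vw ind_in_V hom_add[of "ind v" "ind w"] by (auto simp: F_def ennreal_add_eq_top)
    moreover have "fun_supp C X ?f = v \<sqinter>\<^sub>C w"
      using vw by (intro fun_supp_eq positive_at_add positive_at_bump) auto
    ultimately show ?thesis using in_F[of ?f] by simp
  qed
  have fin: "finite F" using finite_idems by (simp add: F_def)
  have ne: "F \<noteq> {}" using in_F[OF zero_fun(1)] hom_zero by auto
  have FC: "w \<in> carrier C" if "w \<in> F" for w using that idems_closed by (simp add: F_def)
  have "\<exists>m\<in>F. \<forall>w\<in>A. m \<preceq> w" if "finite A" "A \<noteq> {}" "A \<subseteq> F" for A
    using that
  proof (induction rule: finite_ne_induct)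
    case (singleton x)
    then show ?case using FC le_refl by auto
  next
    case (insert x A)
    then obtain m where m: "m \<in> F" "\<forall>w\<in>A. m \<preceq> w" by auto
    have xF: "x \<in> F" using insert by simp
    have "m \<sqinter>\<^sub>C x \<preceq> w" if w: "w \<in> insert x A" for w
    proof (cases "w = x")
      case True
      then show ?thesis using meet_le FC m xF by simp
    next
      case False
      then have "m \<preceq> w" using m w by simp
      with meet_le(1) show ?thesis by (rule le_trans) (use FC m xF in auto)
    qed
    then show ?case using meet[OF m(1) xF] by blast
  qed
  from this[OF fin ne subset_refl] obtain m where m: "m \<in> F" "\<forall>w\<in>F. m \<preceq> w" by blast
  then have mi: "m \<in> idems C" "\<phi> (ind m) \<noteq> \<infinity>" by (auto simp: F_def)
  have "\<phi> f \<noteq> \<infinity> \<longleftrightarrow> m \<preceq> fun_supp C X f" if f: "f \<in> V" for f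
  proof
    assume "m \<preceq> fun_supp C X f"
    then show "\<phi> f \<noteq> \<infinity>" using mi f by (intro hom_finite_mono[of "ind m" f]) (auto simp: ind_in_V)
  qed (use in_F f m in auto)
  then show ?thesis using mi by blast
qed

lemma hom_representable: "\<exists>y\<in>carrier C. \<forall>f\<in>V. \<phi> f = pairing C X y f"
proof -
  obtain w where w: "w \<in> idems C" and finite_iff: "\<And>f. f \<in> V \<Longrightarrow> \<phi> f \<noteq> \<infinity> \<longleftrightarrow> w \<preceq> fun_supp C X f"
    using hom_finite_iff by blast
  have wC: "w \<in> carrier C" using w by (rule idems_closed)
  \<comment> \<open>Outside \<open>V0\<close> both sides of the claim are infinite; on
    \<open>V0\<close> the morphism is a real additive function \<open>L\<close>.\<close>
  define V0 where "V0 = {f \<in> V. w \<preceq> fun_supp C X f}"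
  define L where "L f = enn2real (\<phi> f)" for f
  have \<phi>_L: "\<phi> f = ennreal (L f)" if "f \<in> V0" for f
    using that finite_iff[of f] by (simp add: V0_def L_def less_top)
  have L_nonneg: "0 \<le> L f" for f by (simp add: L_def)
  have add: "(\<lambda>x\<in>X. f x + g x) \<in> V0" "L (\<lambda>x\<in>X. f x + g x) = L f + L g"
    if f: "f \<in> V0" and g: "g \<in> V0" for f g
  proof -
    show fg: "(\<lambda>x\<in>X. f x + g x) \<in> V0"
      using f g wC by (simp add: V0_def V_add_closed le_supp_add_iff)
    have "ennreal (L (\<lambda>x\<in>X. f x + g x)) = ennreal (L f + L g)"
      using \<phi>_L[OF f] \<phi>_L[OF g] \<phi>_L[OF fg] hom_add[of f g] f g L_nonneg by (simp add: V0_def)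
    then show "L (\<lambda>x\<in>X. f x + g x) = L f + L g"
      by (rule ennreal_inj[THEN iffD1, rotated 2]) (auto intro: L_nonneg add_nonneg_nonneg)
  qed
  have zero: "(\<lambda>x\<in>X. 0) \<in> V0" "L (\<lambda>x\<in>X. 0) = 0"
    using zero_fun wC hom_zero by (auto simp: V0_def L_def)
  have scale_V0: "(\<lambda>x\<in>X. t * f x) \<in> V0" if "f \<in> V0" "0 \<le> t" for f t
    using that zero by (cases "t = 0") (auto simp: V0_def V_scale_closed supp_scale)
  have scale_L: "L (\<lambda>x\<in>X. t * f x) = t * L f" if f: "f \<in> V0" and t: "0 \<le> t" for f t
  proof -
    have "L (\<lambda>x\<in>X. t * f x) = t * L (\<lambda>x\<in>X. 1 * f x)"
    proof (rule additive_nonneg_linear[OF _ _ t, where h = "\<lambda>t. L (\<lambda>x\<in>X. t * f x)"])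
      fix r s :: real assume "0 \<le> r" "0 \<le> s"
      moreover have "(\<lambda>x\<in>X. (r + s) * f x) = (\<lambda>x\<in>X. (\<lambda>x\<in>X. r * f x) x + (\<lambda>x\<in>X. s * f x) x)"
        by (auto simp: algebra_simps)
      ultimately show "L (\<lambda>x\<in>X. (r + s) * f x) = L (\<lambda>x\<in>X. r * f x) + L (\<lambda>x\<in>X. s * f x)"
        using add(2)[OF scale_V0[OF f] scale_V0[OF f]] by simp
    qed (rule L_nonneg)
    moreover have "(\<lambda>x\<in>X. 1 * f x) = f"
      using f by (auto simp: V0_def V_iff PiE_iff extensional_def)
    ultimately show ?thesis by simp
  qed
  have sums: "(\<lambda>x\<in>X. \<Sum>i\<in>A. c i * h i x) \<in> V0 \<and> L (\<lambda>x\<in>X. \<Sum>i\<in>A. c i * h i x) = (\<Sum>i\<in>A. c i * L (h i))"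
    if "finite A" "\<And>i. i \<in> A \<Longrightarrow> 0 \<le> c i" "\<And>i. i \<in> A \<Longrightarrow> h i \<in> V0"
    for A :: "'a set" and c h
    using that
  proof (induction A)
    case (insert i A)
    let ?f = "\<lambda>x\<in>X. c i * h i x" and ?g = "\<lambda>x\<in>X. \<Sum>i\<in>A. c i * h i x"
    have f: "?f \<in> V0" "L ?f = c i * L (h i)" using scale_V0 scale_L insert.prems by auto
    have "?g \<in> V0 \<and> L ?g = (\<Sum>i\<in>A. c i * L (h i))"
      using insert.prems by (intro insert.IH) auto
    then have g: "?g \<in> V0" "L ?g = (\<Sum>i\<in>A. c i * L (h i))" by blast+
    have eq: "(\<lambda>x\<in>X. \<Sum>i\<in>insert i A. c i * h i x) = (\<lambda>x\<in>X. ?f x + ?g x)"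
      using insert.hyps by auto
    show ?case
      unfolding eq unfolding sum.insert[OF insert.hyps]
      using add[OF f(1) g(1)] f(2) g(2) by (simp only: simp_thms)
  qed (use zero in simp)
  let ?O = "{x \<in> X. \<not> x \<preceq> w}"
  have finO: "finite ?O" using finite_X by simp
  \<comment> \<open>\<open>e z\<close> exceeds \<open>ind w\<close> by the point mass at
    \<open>z\<close> when \<open>z\<close> is in \<open>?O\<close>. Both have support
    \<open>w\<close>, so \<open>L\<close> is defined on them, and their difference under
    \<open>L\<close> is the candidate coefficient.\<close>
  define e where "e z = bump w 1 z 1" for z
  have e: "e z \<in> V0" for z
    using bump_in_V[OF w, of 1 z 1] wC by (simp add: e_def V0_def le_refl)
  have ind: "ind w \<in> V0" using ind_in_V[OF w] wC by (simp add: V0_def le_refl)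
  define \<alpha> where "\<alpha> z = L (e z) - L (ind w)" for z
  have L_eq: "L f = (\<Sum>z\<in>?O. \<alpha> z * f z)" if f: "f \<in> V0" for f
  proof -
    \<comment> \<open>\<open>L\<close> respects only nonnegative combinations inside
      \<open>V0\<close>, so negative parts change sides. The identity used is \<open>f + (\<Sum> n z
      * e z) + (\<Sum> p z) * ind w = (\<Sum> p z * e z) + (\<Sum> n z) * ind w\<close>.\<close>
    define p where "p z = max 0 (f z)" for z
    define n where "n z = max 0 (- f z)" for z
    have pn: "f z = p z - n z" "0 \<le> p z" "0 \<le> n z" for z by (auto simp: p_def n_def)
    let ?comb = "\<lambda>c x. \<Sum>z\<in>?O. c z * e z x"
    let ?S1 = "\<lambda>x\<in>X. ?comb n x" and ?S2 = "\<lambda>x\<in>X. (\<Sum>z\<in>?O. p z) * ind w x"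
    let ?S3 = "\<lambda>x\<in>X. ?comb p x" and ?S4 = "\<lambda>x\<in>X. (\<Sum>z\<in>?O. n z) * ind w x"
    note S1 = sums[OF finO, of n e, OF pn(3) e] and S3 = sums[OF finO, of p e, OF pn(2) e]
    have P0: "0 \<le> (\<Sum>z\<in>?O. p z)" "0 \<le> (\<Sum>z\<in>?O. n z)" using pn by (auto intro: sum_nonneg)
    note S2 = scale_V0[OF ind P0(1)] scale_L[OF ind P0(1)]
    note S4 = scale_V0[OF ind P0(2)] scale_L[OF ind P0(2)]
    let ?fS = "\<lambda>x\<in>X. f x + ?S1 x"
    note fS = add[OF f conjunct1[OF S1]]
    have comb: "?comb c x = (\<Sum>z\<in>?O. c z) + c x" if "x \<in> ?O" for c x
    proof -
      have "?comb c x = (\<Sum>z\<in>?O. c z + (if x = z then c z else 0))"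
        using that by (intro sum.cong) (auto simp: e_def bump_def)
      also have "\<dots> = (\<Sum>z\<in>?O. c z) + c x" using that finO by (simp add: sum.distrib)
      finally show ?thesis .
    qed
    have eq: "(\<lambda>x\<in>X. ?fS x + ?S2 x) = (\<lambda>x\<in>X. ?S3 x + ?S4 x)"
    proof (rule restrict_ext)
      fix x assume x: "x \<in> X"
      show "?fS x + ?S2 x = ?S3 x + ?S4 x"
      proof (cases "x \<preceq> w")
        case True
        have "x \<preceq> fun_supp C X f"
          using le_trans[OF True _ X_closed[OF x]] f by (simp add: V0_def)
        then have "f x = 0" using positive_at_supp[of f] f x by (auto simp: V0_def positive_at_iff)
        moreover have "e z x = 0" "ind w x = 0" for z using True x by (auto simp: e_def bump_def)
        ultimately show ?thesis using x by simp
      next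
        case False
        then have xO: "x \<in> ?O" using x by simp
        have "ind w x = 1" using False x by (simp add: bump_def)
        then show ?thesis using x comb[OF xO, of p] comb[OF xO, of n] pn(1)[of x] by simp
      qed
    qed
    have "L f + L ?S1 + L ?S2 = L (\<lambda>x\<in>X. ?fS x + ?S2 x)"
      using add(2)[OF fS(1) S2(1)] fS(2) by simp
    also have "\<dots> = L ?S3 + L ?S4" unfolding eq using add(2)[OF _ S4(1)] S3 by blast
    finally have "L f + (\<Sum>z\<in>?O. n z * L (e z)) + (\<Sum>z\<in>?O. p z) * L (ind w)
        = (\<Sum>z\<in>?O. p z * L (e z)) + (\<Sum>z\<in>?O. n z) * L (ind w)"
      using S1 S2 S3 S4 by simp
    then have "L f = (\<Sum>z\<in>?O. p z * L (e z)) - (\<Sum>z\<in>?O. n z * L (e z))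
        - ((\<Sum>z\<in>?O. p z) * L (ind w) - (\<Sum>z\<in>?O. n z) * L (ind w))" by simp
    also have "\<dots> = (\<Sum>z\<in>?O. (p z * L (e z) - n z * L (e z)) - (p z * L (ind w) - n z * L (ind w)))"
      by (simp only: sum_subtractf sum_distrib_right)
    also have "\<dots> = (\<Sum>z\<in>?O. \<alpha> z * f z)"
      by (intro sum.cong) (auto simp: \<alpha>_def pn(1) algebra_simps)
    finally show ?thesis .
  qed
  have \<alpha>_bump: "0 \<le> c * (\<Sum>x\<in>?O. \<alpha> x) + s * \<alpha> z"
    if z: "z \<in> ?O" and c: "0 < c" "z \<in> P w \<Longrightarrow> 0 < c + s" for c s z
  proof -
    have "bump w c z s \<in> V0" using bump_in_V[OF w c] wC by (simp add: V0_def le_refl)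
    then have "L (bump w c z s) = c * (\<Sum>x\<in>?O. \<alpha> x) + s * \<alpha> z"
      using L_eq sum_bump[OF z finO, of w \<alpha> c s] by simp
    then show ?thesis using L_nonneg[of "bump w c z s"] by simp
  qed
  have \<alpha>_nonneg: "0 \<le> \<alpha> z" if "z \<in> P w" for z
  proof (rule ccontr)
    assume neg: "\<not> 0 \<le> \<alpha> z"
    have z: "z \<in> ?O" using that by (simp add: P_iff)
    let ?S = "\<Sum>x\<in>?O. \<alpha> x"
    \<comment> \<open>\<open>q\<close> is a positive bound for the total \<open>?S\<close>. The
      choice of \<open>c\<close> makes \<open>c * ?S\<close> at most
      \<open>- \<alpha> z / 2\<close>, so the bump of height \<open>1\<close> would get a value of
      at most \<open>\<alpha> z / 2\<close>, which is negative.\<close>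
    define q where "q = \<bar>?S\<bar> + 1"
    have q: "0 < q" "?S \<le> q" by (auto simp: q_def)
    define c where "c = - \<alpha> z / (2 * q)"
    have c: "0 < c" unfolding c_def by (rule divide_pos_pos) (use neg q in auto)
    have "c * ?S \<le> c * q" using c q by (intro mult_left_mono) auto
    also have "\<dots> = - \<alpha> z / 2" using q by (simp add: c_def)
    finally have "c * ?S + 1 * \<alpha> z < 0" using neg by simp
    then show False using \<alpha>_bump[OF z c, of 1] c by simp
  qed
  have \<alpha>_zero: "\<alpha> z = 0" if z: "z \<in> ?O" "z \<notin> P w" for z
  proof (rule ccontr)
    assume nz: "\<alpha> z \<noteq> 0"
    let ?S = "\<Sum>x\<in>?O. \<alpha> x"
    \<comment> \<open>Outside \<open>P w\<close> any height is allowed; this one gives the value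
      \<open>?S - \<bar>?S\<bar> - 1\<close>, which is negative.\<close>
    have "0 \<le> 1 * ?S + (- (\<bar>?S\<bar> + 1) / \<alpha> z) * \<alpha> z" using z by (intro \<alpha>_bump) auto
    then show False using nz by simp
  qed
  define a where "a x = (if x \<in> P w then \<alpha> x else 0)" for x
  have a: "coeffs w a" using \<alpha>_nonneg by (auto simp: coeffs_def a_def)
  have "\<phi> f = pairing C X (comb a X \<oplus> w) f" if f: "f \<in> V" for f
  proof (cases "w \<preceq> fun_supp C X f")
    case True
    have "(\<Sum>x\<in>X. a x * f x) = (\<Sum>x\<in>?O. a x * f x)"
      using finite_X by (intro sum.mono_neutral_right) (auto simp: a_def P_iff)
    also have "\<dots> = (\<Sum>x\<in>?O. \<alpha> x * f x)"
      using \<alpha>_zero by (intro sum.cong) (auto simp: a_def)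
    also have "\<dots> = L f" using L_eq f True by (simp add: V0_def)
    finally show ?thesis using True f \<phi>_L pairing_coeffs[OF w a] by (simp add: V0_def)
  next
    case False
    then show ?thesis using finite_iff[OF f] pairing_coeffs[OF w a] by simp
  qed
  then show ?thesis using wC X_carrier by (intro bexI[of _ "comb a X \<oplus> w"]) auto
qed

end

section \<open>Continuity of the pairing in the point\<close>

lemma continuous_scale0_add_idem:
  assumes x: "x \<in> carrier C" and w: "w \<in> idems C" "\<epsilon> x \<preceq> w"
  shows "continuous_map (top_of_set {0..}) (ctop C) (\<lambda>t. t \<star> x \<oplus> w)"
proof -
  have wC: "w \<in> carrier C" using w by (simp add: idems_closed)
  have pos: "continuous_map (top_of_set {0<..}) (ctop C) (\<lambda>t. t \<odot> x \<oplus> w)"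
  proof -
    have "continuous_map (top_of_set {0<..}) (ctop C) (\<lambda>r. case (r, x) of (t, x) \<Rightarrow> t \<odot> x)"
      using continuous_map_compose[OF _ continuous_scale, of "top_of_set {0<..}" "\<lambda>r. (r, x)"] x
      by (simp add: o_def continuous_map_pairedI)
    then show ?thesis using wC by (intro continuous_map_add) auto
  qed
  have "openin (top_of_set {0..}) {t \<in> {0..}. t \<star> x \<oplus> w \<in> U}" if U: "openin (ctop C) U" for U
  proof (subst openin_subopen, intro ballI)
    fix t assume t: "t \<in> {t \<in> {0..}. t \<star> x \<oplus> w \<in> U}"
    show "\<exists>T. openin (top_of_set {0..}) T \<and> t \<in> T \<and> T \<subseteq> {t \<in> {0..}. t \<star> x \<oplus> w \<in> U}"
    proof (cases "t = 0")
      case True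
      \<comment> \<open>At \<open>t = 0\<close> the value is \<open>w\<close>, and nearby values
        tend to \<open>\<epsilon> x \<oplus> w = w\<close>. Adding \<open>w\<close> repairs the jump
        of \<open>\<star>\<close> at \<open>0\<close>.\<close>
      have "openin (ctop C) {u \<in> topspace (ctop C). u \<oplus> w \<in> U}"
        using continuous_map_add_const[OF wC] U by (rule openin_continuous_map_preimage)
      moreover have "\<epsilon> x \<in> {u \<in> topspace (ctop C). u \<oplus> w \<in> U}"
        using t True x w wC by (simp add: le_idem_absorb)
      ultimately obtain r where r: "r > 0" "\<And>s. 0 < s \<Longrightarrow> s \<le> r \<Longrightarrow> s \<star> x \<oplus> w \<in> U"
        using scale0_small_in_open[OF x] by blast
      have "openin (top_of_set {0..}) ({0..} \<inter> {..<r})" by (simp add: openin_open_Int)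
      moreover have "{0..} \<inter> {..<r} \<subseteq> {t \<in> {0..}. t \<star> x \<oplus> w \<in> U}"
        using r(2) t True by (force simp: less_le)
      ultimately show ?thesis using r(1) True by (intro exI[of _ "{0..} \<inter> {..<r}"]) auto
    next
      case False
      let ?T = "{s \<in> topspace (top_of_set {0<..}). s \<odot> x \<oplus> w \<in> U}"
      have "openin (top_of_set {0<..}) ?T"
        using pos U by (rule openin_continuous_map_preimage)
      then have "open ?T" by (simp add: openin_open_eq)
      moreover have "?T \<subseteq> {t \<in> {0..}. t \<star> x \<oplus> w \<in> U}" by (auto simp: scale0_pos)
      moreover have "t \<in> ?T" using t False by (auto simp: scale0_pos)
      ultimately show ?thesis
        by (intro exI[of _ ?T]) (auto intro!: open_subset)
    qed
  qed
  then show ?thesis using x wC by (auto simp: continuous_map_def Pi_iff)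
qed

text \<open>Positivity of \<open>f\<close> on \<open>P w\<close> bounds each coefficient
  \<open>a x\<close> by \<open>M / f x\<close>, so the coefficient functions form a closed subset of
  a compact box. The map to the cone is continuous because each term can carry its own copy of
  \<open>w\<close>.\<close>

lemma compactin_comb:
  assumes w: "w \<in> idems C" and f: "\<And>x. x \<in> P w \<Longrightarrow> 0 < f x" and T: "closed T" "T \<subseteq> {0..M}"
  shows "compactin (ctop C) {comb a X \<oplus> w | a. coeffs w a \<and> (\<Sum>x\<in>X. a x * f x) \<in> T}"
proof -
  have wC: "w \<in> carrier C" using w by (rule idems_closed)
  let ?A = "{a. coeffs w a \<and> (\<Sum>x\<in>X. a x * f x) \<in> T}"
  let ?B = "PiE UNIV (\<lambda>x. if x \<in> P w then {0..M / f x} else {0})"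
  have "compactin (product_topology (\<lambda>_. euclidean) UNIV) ?B"
    by (subst compactin_PiE) auto
  then have B: "compact ?B" by (simp add: euclidean_product_topology)
  have "?A = ?B \<inter> (\<lambda>a. \<Sum>x\<in>X. a x * f x) -` T"
  proof (intro equalityI subsetI)
    fix a assume a: "a \<in> ?A"
    have "a x \<le> M / f x" if x: "x \<in> P w" for x
    proof -
      have nn: "0 \<le> a y * f y" for y
        using a f[of y] by (cases "y \<in> P w") (auto simp: coeffs_def)
      have "a x * f x \<le> (\<Sum>x\<in>X. a x * f x)"
        using x nn finite_X by (intro member_le_sum[of x X "\<lambda>x. a x * f x"]) (auto simp: P_iff)
      also have "\<dots> \<le> M" using a T by auto
      finally show ?thesis using f[OF x] by (simp add: pos_le_divide_eq)
    qed
    then show "a \<in> ?B \<inter> (\<lambda>a. \<Sum>x\<in>X. a x * f x) -` T" using a by (auto simp: coeffs_def)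
  next
    fix a assume a: "a \<in> ?B \<inter> (\<lambda>a. \<Sum>x\<in>X. a x * f x) -` T"
    have *: "a x \<in> (if x \<in> P w then {0..M / f x} else {0})" for x
      using a by (simp only: Int_iff PiE_iff UNIV_I)
    have "0 \<le> a x" "x \<notin> P w \<Longrightarrow> a x = 0" for x
      using *[of x] by (auto split: if_splits)
    then show "a \<in> ?A" using a by (simp add: coeffs_def)
  qed
  moreover have "closed ((\<lambda>a. \<Sum>x\<in>X. a x * f x) -` T)"
    using T(1) by (intro closed_vimage continuous_intros continuous_on_product_coordinates) auto
  ultimately have "compact ?A" using B by (simp add: compact_Int_closed)
  have cont: "continuous_map (top_of_set ?A) (ctop C) (\<lambda>a. comb a F \<oplus> w)" if "finite F" "F \<subseteq> P w" for F
    using that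
  proof (induction F)
    case empty
    then show ?case using wC by simp
  next
    case (insert x F)
    have xF: "x \<in> P w" "x \<in> carrier C" "F \<subseteq> carrier C" "\<epsilon> x \<preceq> w"
      using insert.prems X_closed by (auto simp: P_iff subset_iff)
    have "continuous_map (top_of_set ?A) (top_of_set {0..}) (\<lambda>a. a x)"
      by (auto simp: continuous_map_in_subtopology coeffs_def
          intro!: continuous_on_subset[OF continuous_on_product_coordinates subset_UNIV])
    from continuous_map_compose[OF this continuous_scale0_add_idem[OF xF(2) w xF(4)]]
    have "continuous_map (top_of_set ?A) (ctop C) (\<lambda>a. a x \<star> x \<oplus> w)" by (simp add: o_def)
    moreover have "continuous_map (top_of_set ?A) (ctop C) (\<lambda>a. comb a F \<oplus> w)"
      using insert by simp
    ultimately have "continuous_map (top_of_set ?A) (ctop C) (\<lambda>a. (a x \<star> x \<oplus> w) \<oplus> (comb a F \<oplus> w))"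
      by (rule continuous_map_add)
    moreover have "(a x \<star> x \<oplus> w) \<oplus> (comb a F \<oplus> w) = comb a (insert x F) \<oplus> w" for a
    proof -
      have "comb a (insert x F) = a x \<star> x \<oplus> comb a F"
        using xF insert.hyps by (intro finsum_insert) auto
      then show ?thesis using xF w by (simp add: idem_sum_absorb)
    qed
    ultimately show ?case by simp
  qed
  have "compactin (top_of_set ?A) ?A"
    using \<open>compact ?A\<close> by (simp add: compactin_subtopology)
  from image_compactin[OF this cont[OF P_generates(1)[OF w] subset_refl]]
  have "compactin (ctop C) ((\<lambda>a. comb a (P w) \<oplus> w) ` ?A)" .
  moreover have "comb a (P w) = comb a X" if "a \<in> ?A" for a
    using that finite_X X_carrier P_subset_X by (intro comb_mono_neutral[symmetric]) (auto simp: coeffs_def)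
  then have "(\<lambda>a. comb a (P w) \<oplus> w) ` ?A = {comb a X \<oplus> w | a. coeffs w a \<and> (\<Sum>x\<in>X. a x * f x) \<in> T}"
    by auto
  ultimately show ?thesis by simp
qed

lemma pairing_add_supp:
  assumes y: "y \<in> carrier C" and f: "f \<in> V"
  shows "pairing C X (y \<oplus> fun_supp C X f) f = pairing C X y f"
proof -
  have w: "fun_supp C X f \<in> idems C" using f by (rule supp_in_idems)
  have "coeffs (fun_supp C X f) (\<lambda>x. 0)" by (simp add: coeffs_def)
  from pairing_coeffs[OF w this, of f] have "pairing C X (fun_supp C X f) f = 0"
    using w idems_closed by (simp add: le_refl)
  then show ?thesis using pairing_add_left[OF y _ f] w idems_closed by simp
qed

text \<open>A finite value forces \<open>\<epsilon> y \<preceq> ?w\<close>, so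
  \<open>y \<oplus> ?w\<close> has support \<open>?w\<close> and a representation with coefficients
  in the polytope. The set is the preimage of the compact \<open>?K\<close> under translation by
  \<open>?w\<close>.\<close>

lemma closedin_pairing_le:
  assumes f: "f \<in> V" and M: "0 \<le> M"
  shows "closedin (ctop C) {y \<in> carrier C. pairing C X y f \<le> ennreal M}"
proof -
  let ?w = "fun_supp C X f"
  have w: "?w \<in> idems C" "?w \<in> carrier C" using f supp_in_idems idems_closed by auto
  let ?K = "{comb a X \<oplus> ?w | a. coeffs ?w a \<and> (\<Sum>x\<in>X. a x * f x) \<in> {0..M}}"
  have "closedin (ctop C) ?K"
    using positive_at_supp[OF f] by (intro compactin_imp_closed compactin_comb[OF w(1)]) (auto simp: positive_at_iff)
  then have "closedin (ctop C) {y \<in> carrier C. y \<oplus> ?w \<in> ?K}"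
    by (rule closedin_preimage[OF continuous_map_add_const[OF w(2)]])
  moreover have "pairing C X y f \<le> ennreal M \<longleftrightarrow> y \<oplus> ?w \<in> ?K" if y: "y \<in> carrier C" for y
  proof
    assume "y \<oplus> ?w \<in> ?K"
    then obtain a where a: "y \<oplus> ?w = comb a X \<oplus> ?w" "coeffs ?w a" "(\<Sum>x\<in>X. a x * f x) \<le> M"
      by auto
    have "pairing C X y f = ennreal (\<Sum>x\<in>X. a x * f x)"
      using pairing_coeffs[OF w(1) a(2), of f] w(2)
      by (simp add: le_refl flip: pairing_add_supp[OF y f] a(1))
    then show "pairing C X y f \<le> ennreal M" using a M by (simp add: ennreal_leI)
  next
    assume le: "pairing C X y f \<le> ennreal M"
    then have "pairing C X y f \<noteq> \<infinity>" by (auto simp: top_unique)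
    then have "\<epsilon> y \<preceq> ?w" using pairing_infinite_iff[OF y] by blast
    then have e: "\<epsilon> (y \<oplus> ?w) = ?w" using supp_add_idem[OF w(1) y] by simp
    have yw: "y \<oplus> ?w \<in> carrier C" using y w by simp
    obtain a where a: "\<And>x. 0 \<le> a x" "\<And>x. 0 < a x \<Longrightarrow> \<epsilon> x \<preceq> ?w" "y \<oplus> ?w = comb a X \<oplus> ?w" "coeffs ?w a"
      by (rule exists_nonneg_coeffs[OF yw, unfolded e]) blast
    have "pairing C X y f = ennreal (\<Sum>x\<in>X. a x * f x)"
      using pairing_coeffs[OF w(1) a(4), of f] w(2)
      by (simp add: le_refl flip: pairing_add_supp[OF y f] a(3))
    moreover have "0 \<le> (\<Sum>x\<in>X. a x * f x)"
      using a w f by (intro pairing_sum_nonneg[of ?w]) (auto simp: le_refl)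
    ultimately have "(\<Sum>x\<in>X. a x * f x) \<in> {0..M}" using le M by (simp add: ennreal_le_iff)
    then show "y \<oplus> ?w \<in> ?K" using a by blast
  qed
  then have "{y \<in> carrier C. pairing C X y f \<le> ennreal M} = {y \<in> carrier C. y \<oplus> ?w \<in> ?K}"
    by blast
  ultimately show ?thesis by simp
qed

text \<open>Every \<open>y\<close> with \<open>(y, f) \<ge> M\<close> dominates, up to \<open>supp f\<close>, an element of the simplex
  \<open>(\<cdot>, f) = M\<close> in \<open>C\<^sub>w\<close>; this needs \<open>P_below_idem\<close> when \<open>(y, f) = \<infinity>\<close>.\<close>

lemma closedin_pairing_ge:
  assumes f: "f \<in> V" and M: "0 \<le> M"
  shows "closedin (ctop C) {y \<in> carrier C. ennreal M \<le> pairing C X y f}"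
proof -
  let ?w = "fun_supp C X f"
  have w: "?w \<in> idems C" "?w \<in> carrier C" using f supp_in_idems idems_closed by auto
  have pos: "0 < f x" if "x \<in> P ?w" for x
    using positive_at_supp[OF f] that by (simp add: positive_at_iff)
  let ?K = "{comb a X \<oplus> ?w | a. coeffs ?w a \<and> (\<Sum>x\<in>X. a x * f x) \<in> {M}}"
  let ?Q = "{x \<oplus> y | x y. x \<in> ?K \<and> y \<in> carrier C}"
  have "compactin (ctop C) ?K"
    using pos M by (intro compactin_comb[OF w(1), of _ _ M]) auto
  then have "closedin (ctop C) ?Q" using compactin_carrier by (rule closedin_add)
  then have "closedin (ctop C) {y \<in> carrier C. y \<oplus> ?w \<in> ?Q}"
    by (rule closedin_preimage[OF continuous_map_add_const[OF w(2)]])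
  moreover have "ennreal M \<le> pairing C X y f \<longleftrightarrow> y \<oplus> ?w \<in> ?Q" if y: "y \<in> carrier C" for y
  proof
    assume "y \<oplus> ?w \<in> ?Q"
    then obtain a c where a: "y \<oplus> ?w = (comb a X \<oplus> ?w) \<oplus> c" "coeffs ?w a" "(\<Sum>x\<in>X. a x * f x) = M"
      and c: "c \<in> carrier C" by auto
    have "pairing C X y f = pairing C X (comb a X \<oplus> ?w) f + pairing C X c f"
      using pairing_add_left[OF _ c f, of "comb a X \<oplus> ?w"] w(2) X_carrier
      by (simp flip: pairing_add_supp[OF y f] add: a(1))
    also have "pairing C X (comb a X \<oplus> ?w) f = ennreal M"
      using pairing_coeffs[OF w(1) a(2), of f] w(2) a(3) by (simp add: le_refl)
    finally show "ennreal M \<le> pairing C X y f" by simp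
  next
    assume ge: "ennreal M \<le> pairing C X y f"
    have yw: "y \<oplus> ?w \<in> carrier C" using y w by simp
    have K_below: "y \<oplus> ?w \<in> ?Q" if k: "k \<in> ?K" and le: "k \<preceq> y \<oplus> ?w" for k
    proof -
      obtain c where "c \<in> carrier C" "y \<oplus> ?w = k \<oplus> c" using le by (rule leE)
      then show ?thesis using k by blast
    qed
    show "y \<oplus> ?w \<in> ?Q"
    proof (cases "\<epsilon> y \<preceq> ?w")
      case True
      then have e: "\<epsilon> (y \<oplus> ?w) = ?w" using supp_add_idem[OF w(1) y] by simp
      obtain a where a: "\<And>x. 0 \<le> a x" "\<And>x. 0 < a x \<Longrightarrow> \<epsilon> x \<preceq> ?w" "y \<oplus> ?w = comb a X \<oplus> ?w" "coeffs ?w a"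
        by (rule exists_nonneg_coeffs[OF yw, unfolded e]) blast
      define r where "r = (\<Sum>x\<in>X. a x * f x)"
      have "pairing C X y f = ennreal r"
        using pairing_coeffs[OF w(1) a(4), of f] w(2)
        by (simp add: le_refl r_def flip: pairing_add_supp[OF y f] a(3))
      moreover have "0 \<le> r"
        unfolding r_def using a w f by (intro pairing_sum_nonneg[of ?w]) (auto simp: le_refl)
      ultimately have r: "M \<le> r" using ge by (simp add: ennreal_le_iff)
      \<comment> \<open>Shrinking all coefficients by \<open>M / r\<close> moves
        \<open>y \<oplus> ?w\<close> down onto the simplex; \<open>M \<le> r\<close> ensures that
        the result lies below it.\<close>
      define s where "s = (if M = 0 then 0 else M / r)"
      have s: "0 \<le> s" "s \<le> 1" "s * r = M" using r M by (auto simp: s_def)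
      have "coeffs ?w (\<lambda>x. s * a x)" using a(4) s by (auto simp: coeffs_def)
      moreover have "(\<Sum>x\<in>X. s * a x * f x) = M"
        using s by (simp add: r_def sum_distrib_left mult.assoc)
      ultimately have "comb (\<lambda>x. s * a x) X \<oplus> ?w \<in> ?K"
        by (intro CollectI exI[of _ "\<lambda>x. s * a x"]) simp
      moreover have "comb (\<lambda>x. s * a x) X \<oplus> ?w \<preceq> y \<oplus> ?w"
      proof -
        have "comb (\<lambda>x. s * a x) X = s \<star> comb a X"
          using X_carrier a s by (intro comb_scale0[symmetric]) auto
        also have "s \<star> comb a X \<preceq> 1 \<star> comb a X" using s X_carrier by (intro scale0_mono_left) auto
        finally show ?thesis unfolding a(3) using X_carrier w by (intro add_mono le_refl) auto
      qed
      ultimately show ?thesis by (rule K_below)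
    next
      case False
      then obtain x where x: "x \<in> P ?w" "x \<preceq> \<epsilon> y"
        using P_below_idem[OF w(1), of "\<epsilon> y"] y by auto
      have xX: "x \<in> X" "x \<in> carrier C" using x X_closed by (auto simp: P_iff)
      \<comment> \<open>Every multiple of \<open>x\<close> lies below the idempotent
        \<open>\<epsilon> y\<close>, in particular the multiple whose pairing with \<open>f\<close>
        is \<open>M\<close>.\<close>
      define b where "b = (\<lambda>z. if z = x then M / f x else 0)"
      have "coeffs ?w b" using x M pos[OF x(1)] by (auto simp: coeffs_def b_def)
      moreover have "(\<Sum>z\<in>X. b z * f z) = M"
        using finite_X xX pos[OF x(1)] by (simp add: b_def if_distrib[of "\<lambda>u. u * _"] cong: if_cong)
      ultimately have "comb b X \<oplus> ?w \<in> ?K"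
        by (intro CollectI exI[of _ b]) simp
      moreover have "comb b X \<oplus> ?w \<preceq> y \<oplus> ?w"
      proof -
        have "comb b X = (M / f x) \<star> x"
          unfolding b_def using finite_X X_carrier xX(1) by (rule comb_single)
        also have "(M / f x) \<star> x \<preceq> \<epsilon> y" using x xX y by (intro scale0_le_idem) auto
        also have "\<epsilon> y \<preceq> y" using y by (rule supp_le)
        finally show ?thesis using xX y w X_carrier by (intro add_mono[OF _ le_refl]) auto
      qed
      ultimately show ?thesis by (rule K_below)
    qed
  qed
  then have "{y \<in> carrier C. ennreal M \<le> pairing C X y f} = {y \<in> carrier C. y \<oplus> ?w \<in> ?Q}"
    by blast
  ultimately show ?thesis by simp
qed

lemma continuous_map_pairing:
  assumes "f \<in> V" shows "continuous_map (ctop C) euclidean (\<lambda>y. pairing C X y f)"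
  using closedin_pairing_le[OF assms] closedin_pairing_ge[OF assms]
  by (intro continuous_map_ennrealI) auto

end

section \<open>The isomorphism\<close>

lemma greatest_Lower_iso:
  assumes h: "bij_betw h (carrier L) (carrier M)"
    and le: "\<And>x y. x \<in> carrier L \<Longrightarrow> y \<in> carrier L \<Longrightarrow> h x \<sqsubseteq>\<^bsub>M\<^esub> h y \<longleftrightarrow> x \<sqsubseteq>\<^bsub>L\<^esub> y"
    and xy: "x \<in> carrier L" "y \<in> carrier L" and i: "greatest L i (Lower L {x, y})"
  shows "greatest M (h i) (Lower M {h x, h y})"
proof -
  have hM: "carrier M = h ` carrier L" using h by (simp add: bij_betw_def)
  show ?thesis
    using i xy unfolding greatest_def Lower_def hM by (auto simp: le)
qed

lemma least_Upper_iso: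
  assumes h: "bij_betw h (carrier L) (carrier M)"
    and le: "\<And>x y. x \<in> carrier L \<Longrightarrow> y \<in> carrier L \<Longrightarrow> h x \<sqsubseteq>\<^bsub>M\<^esub> h y \<longleftrightarrow> x \<sqsubseteq>\<^bsub>L\<^esub> y"
    and xy: "x \<in> carrier L" "y \<in> carrier L" and i: "least L i (Upper L {x, y})"
  shows "least M (h i) (Upper M {h x, h y})"
proof -
  have hM: "carrier M = h ` carrier L" using h by (simp add: bij_betw_def)
  show ?thesis
    using i xy unfolding least_def Upper_def hM by (auto simp: le)
qed

lemma (in lattice) meet_eqI:
  assumes "greatest L i (Lower L {x, y})" shows "x \<sqinter> y = i"
  unfolding meet_def inf_def
  by (rule some_equality, rule assms, rule greatest_unique[OF _ assms])

lemma (in lattice) join_eqI: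
  assumes "least L i (Upper L {x, y})" shows "x \<squnion> y = i"
  unfolding join_def sup_def
  by (rule some_equality, rule assms, rule least_unique[OF _ assms])

text \<open>Meets and joins in these order structures are chosen by description, so their transport
  needs the uniqueness of greatest lower and least upper bounds on both sides.\<close>

lemma (in lattice) lattice_iso:
  fixes M :: "('c, 'n) gorder_scheme"
  assumes h: "bij_betw h (carrier L) (carrier M)"
    and le: "\<And>x y. x \<in> carrier L \<Longrightarrow> y \<in> carrier L \<Longrightarrow> h x \<sqsubseteq>\<^bsub>M\<^esub> h y \<longleftrightarrow> x \<sqsubseteq> y"
    and eq: "eq M = (=)"
  shows "lattice M"
    "\<And>x y. x \<in> carrier L \<Longrightarrow> y \<in> carrier L \<Longrightarrow> h x \<sqinter>\<^bsub>M\<^esub> h y = h (x \<sqinter> y)"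
    "\<And>x y. x \<in> carrier L \<Longrightarrow> y \<in> carrier L \<Longrightarrow> h x \<squnion>\<^bsub>M\<^esub> h y = h (x \<squnion> y)"
proof -
  have hM: "carrier M = h ` carrier L" using h by (simp add: bij_betw_def)
  have inj: "h x = h y \<longleftrightarrow> x = y" if "x \<in> carrier L" "y \<in> carrier L" for x y
    using h that by (auto simp: bij_betw_def inj_on_eq_iff)
  have M: "partial_order M"
  proof
    fix x y z
    show "x \<sqsubseteq>\<^bsub>M\<^esub> z" if xyz: "x \<sqsubseteq>\<^bsub>M\<^esub> y" "y \<sqsubseteq>\<^bsub>M\<^esub> z" "x \<in> carrier M" "y \<in> carrier M" "z \<in> carrier M"
    proof -
      obtain a b c where "a \<in> carrier L" "b \<in> carrier L" "c \<in> carrier L" "x = h a" "y = h b" "z = h c"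
        using xyz hM by auto
      then show ?thesis using xyz le le_trans by metis
    qed
    show "x .=\<^bsub>M\<^esub> y" if xy: "x \<sqsubseteq>\<^bsub>M\<^esub> y" "y \<sqsubseteq>\<^bsub>M\<^esub> x" "x \<in> carrier M" "y \<in> carrier M"
    proof -
      obtain a b where "a \<in> carrier L" "b \<in> carrier L" "x = h a" "y = h b"
        using xy hM by auto
      then show ?thesis using xy le le_antisym eq by metis
    qed
  qed (auto simp: eq hM le)
  interpret M: partial_order M by (rule M)
  show lattice: "lattice M"
  proof
    fix x y assume "x \<in> carrier M" "y \<in> carrier M"
    then obtain a b where ab: "a \<in> carrier L" "b \<in> carrier L" "x = h a" "y = h b"
      using hM by auto
    show "\<exists>s. least M s (Upper M {x, y})"
      using least_Upper_iso[OF h le ab(1,2)] sup_of_two_exists[OF ab(1,2)] ab by blast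
    show "\<exists>s. greatest M s (Lower M {x, y})"
      using greatest_Lower_iso[OF h le ab(1,2)] inf_of_two_exists[OF ab(1,2)] ab by blast
  qed
  interpret M: lattice M by (rule lattice)
  fix x y assume xy: "x \<in> carrier L" "y \<in> carrier L"
  obtain i where i: "greatest L i (Lower L {x, y})" using inf_of_two_exists[OF xy] by blast
  show "h x \<sqinter>\<^bsub>M\<^esub> h y = h (x \<sqinter> y)"
    using M.meet_eqI[OF greatest_Lower_iso[OF h le xy i]] meet_eqI[OF i] by simp
  obtain s where s: "least L s (Upper L {x, y})" using sup_of_two_exists[OF xy] by blast
  show "h x \<squnion>\<^bsub>M\<^esub> h y = h (x \<squnion> y)"
    using M.join_eqI[OF least_Upper_iso[OF h le xy s]] join_eqI[OF s] by simp
qed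

text \<open>No cone law is presupposed for \<open>D\<close>; each one is read off from
  \<open>C\<close> through \<open>h\<close>. For the cone of morphisms this spares a direct
  construction of its lattice operations.\<close>

lemma extended_choquet_cone_transport:
  fixes C :: "('a, 'm) top_cone_scheme" and D :: "('b, 'n) top_cone_scheme"
  assumes C: "extended_choquet_cone C" and homeo: "homeomorphic_map (ctop C) (ctop D) h"
    and D: "topspace (ctop D) = carrier D" and zero: "h \<zero>\<^bsub>C\<^esub> = \<zero>\<^bsub>D\<^esub>"
    and add: "\<And>x y. x \<in> carrier C \<Longrightarrow> y \<in> carrier C \<Longrightarrow> h (x \<oplus>\<^bsub>C\<^esub> y) = h x \<oplus>\<^bsub>D\<^esub> h y"
    and scale: "\<And>t x. 0 < t \<Longrightarrow> x \<in> carrier C \<Longrightarrow> h (t \<odot>\<^bsub>C\<^esub> x) = t \<odot>\<^bsub>D\<^esub> h x"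
  shows "extended_choquet_cone D"
proof -
  interpret C: extended_choquet_cone C by (rule C)
  interpret LC: lattice "alg_order C" by (rule C.alg_lattice)
  have DC: "carrier D = h ` carrier C"
    using homeomorphic_imp_surjective_map[OF homeo] D by simp
  have inj: "inj_on h (carrier C)"
    using homeomorphic_imp_injective_map[OF homeo] by simp
  have bij: "bij_betw h (carrier C) (carrier D)" using DC inj by (simp add: bij_betw_def)
  obtain g where g: "homeomorphic_maps (ctop C) (ctop D) h g"
    using homeo homeomorphic_map_maps by blast
  have contg: "continuous_map (ctop D) (ctop C) g" and conth: "continuous_map (ctop C) (ctop D) h"
    and gh: "\<And>x. x \<in> carrier C \<Longrightarrow> g (h x) = x" and hg: "\<And>y. y \<in> carrier D \<Longrightarrow> h (g y) = y"
    using g D by (auto simp: homeomorphic_maps_def)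
  have gC: "g y \<in> carrier C" if "y \<in> carrier D" for y using that DC gh by auto
  have le: "h x \<preceq>[D] h y \<longleftrightarrow> x \<preceq>[C] y" if "x \<in> carrier C" "y \<in> carrier C" for x y
    using that inj unfolding alg_order_def by (auto simp: DC inj_on_eq_iff simp flip: add)
  have "bij_betw h (carrier (alg_order C)) (carrier (alg_order D))"
    using bij by (simp add: alg_order_def)
  note iso = LC.lattice_iso[OF this, unfolded C.carrier_alg_order, OF le]
  have lat: "lattice (alg_order D)"
    and meet: "\<And>x y. x \<in> carrier C \<Longrightarrow> y \<in> carrier C \<Longrightarrow> h x \<sqinter>\<^bsub>alg_order D\<^esub> h y = h (x \<sqinter>\<^bsub>alg_order C\<^esub> y)"
    and join: "\<And>x y. x \<in> carrier C \<Longrightarrow> y \<in> carrier C \<Longrightarrow> h x \<squnion>\<^bsub>alg_order D\<^esub> h y = h (x \<squnion>\<^bsub>alg_order C\<^esub> y)"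
    using iso by (auto simp: alg_order_def)
  have join_closed: "x \<squnion>\<^bsub>alg_order C\<^esub> y \<in> carrier C" if "x \<in> carrier C" "y \<in> carrier C" for x y
    using LC.join_closed[of x y] that by (simp add: C.carrier_alg_order)
  have monoid: "abelian_monoid D"
    by (rule abelian_monoidI)
      (auto simp: DC C.a_ac simp flip: add zero)
  show ?thesis
  proof (intro extended_choquet_cone.intro topological_cone.intro abstract_cone.intro
      abstract_cone_axioms.intro topological_cone_axioms.intro extended_choquet_cone_axioms.intro)
    show "abelian_monoid D" by (rule monoid)
    show "lattice (alg_order D)" by (rule lat)
    show "topspace (ctop D) = carrier D" by (rule D)
    show "compact_space (ctop D)"
      using C.compact_ctop homeo homeomorphic_compact_space homeomorphic_map_imp_homeomorphic_space by blast
    show "Hausdorff_space (ctop D)"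
      using C.Hausdorff_ctop homeo homeomorphic_Hausdorff_space homeomorphic_map_imp_homeomorphic_space by blast
  next
    fix t :: real and x assume "0 < t" "x \<in> carrier D"
    then show "t \<odot>\<^bsub>D\<^esub> x \<in> carrier D" by (auto simp: DC C.scale_closed simp flip: scale)
  next
    fix t :: real and x y assume "0 < t" "x \<in> carrier D" "y \<in> carrier D"
    then show "t \<odot>\<^bsub>D\<^esub> (x \<oplus>\<^bsub>D\<^esub> y) = t \<odot>\<^bsub>D\<^esub> x \<oplus>\<^bsub>D\<^esub> t \<odot>\<^bsub>D\<^esub> y"
      by (auto simp: DC C.scale_closed C.scale_add_right simp flip: scale add)
  next
    fix s t :: real and x assume "0 < s" "0 < t" "x \<in> carrier D"
    then show "(s + t) \<odot>\<^bsub>D\<^esub> x = s \<odot>\<^bsub>D\<^esub> x \<oplus>\<^bsub>D\<^esub> t \<odot>\<^bsub>D\<^esub> x"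
      "s \<odot>\<^bsub>D\<^esub> (t \<odot>\<^bsub>D\<^esub> x) = (s * t) \<odot>\<^bsub>D\<^esub> x"
      by (auto simp: DC C.scale_closed C.scale_add_left C.scale_scale simp flip: scale add)
  next
    fix x assume "x \<in> carrier D"
    then show "1 \<odot>\<^bsub>D\<^esub> x = x" by (auto simp: DC C.scale_one simp flip: scale)
  next
    have "continuous_map (prod_topology (ctop D) (ctop D)) (ctop C) (\<lambda>p. g (fst p) \<oplus>\<^bsub>C\<^esub> g (snd p))"
      by (intro C.continuous_map_add continuous_map_compose[OF continuous_map_fst contg, unfolded o_def]
          continuous_map_compose[OF continuous_map_snd contg, unfolded o_def])
    from continuous_map_compose[OF this conth]
    show "continuous_map (prod_topology (ctop D) (ctop D)) (ctop D) (\<lambda>(x, y). x \<oplus>\<^bsub>D\<^esub> y)"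
      by (rule continuous_map_eq) (auto simp: D add gC hg)
  next
    have "continuous_map (prod_topology (top_of_set {0<..}) (ctop D)) (prod_topology (top_of_set {0<..}) (ctop C))
        (\<lambda>p. (fst p, g (snd p)))"
      by (intro continuous_map_pairedI continuous_map_fst
          continuous_map_compose[OF continuous_map_snd contg, unfolded o_def])
    from continuous_map_compose[OF continuous_map_compose[OF this C.continuous_scale] conth]
    show "continuous_map (prod_topology (top_of_set {0<..}) (ctop D)) (ctop D) (\<lambda>(t, x). t \<odot>\<^bsub>D\<^esub> x)"
      by (rule continuous_map_eq) (auto simp: D scale gC hg)
  next
    fix x y z assume "x \<in> carrier D" "y \<in> carrier D" "z \<in> carrier D"
    then obtain a b c where abc: "a \<in> carrier C" "b \<in> carrier C" "c \<in> carrier C" "x = h a" "y = h b" "z = h c"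
      by (auto simp: DC)
    have "x \<oplus>\<^bsub>D\<^esub> (y \<sqinter>\<^bsub>alg_order D\<^esub> z) = h (a \<oplus>\<^bsub>C\<^esub> (b \<sqinter>\<^bsub>alg_order C\<^esub> c))"
      using abc by (simp add: meet add)
    also have "\<dots> = (x \<oplus>\<^bsub>D\<^esub> y) \<sqinter>\<^bsub>alg_order D\<^esub> (x \<oplus>\<^bsub>D\<^esub> z)"
      using abc by (simp add: C.add_meet_distrib meet flip: add)
    finally show "x \<oplus>\<^bsub>D\<^esub> (y \<sqinter>\<^bsub>alg_order D\<^esub> z) = (x \<oplus>\<^bsub>D\<^esub> y) \<sqinter>\<^bsub>alg_order D\<^esub> (x \<oplus>\<^bsub>D\<^esub> z)" .
    have "x \<oplus>\<^bsub>D\<^esub> (y \<squnion>\<^bsub>alg_order D\<^esub> z) = h (a \<oplus>\<^bsub>C\<^esub> (b \<squnion>\<^bsub>alg_order C\<^esub> c))"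
      using abc by (simp add: join add join_closed)
    also have "\<dots> = (x \<oplus>\<^bsub>D\<^esub> y) \<squnion>\<^bsub>alg_order D\<^esub> (x \<oplus>\<^bsub>D\<^esub> z)"
      using abc by (simp add: C.add_join_distrib join flip: add)
    finally show "x \<oplus>\<^bsub>D\<^esub> (y \<squnion>\<^bsub>alg_order D\<^esub> z) = (x \<oplus>\<^bsub>D\<^esub> y) \<squnion>\<^bsub>alg_order D\<^esub> (x \<oplus>\<^bsub>D\<^esub> z)" .
  next
    fix U x assume U: "openin (ctop D) U" "x \<in> U"
    have UD: "U \<subseteq> carrier D" using openin_subset[OF U(1)] D by simp
    have "openin (ctop C) {y \<in> topspace (ctop C). h y \<in> U}"
      using conth U(1) by (rule openin_continuous_map_preimage)
    moreover have "g x \<in> {y \<in> topspace (ctop C). h y \<in> U}"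
      using U(2) subsetD[OF UD U(2)] by (simp add: gC hg)
    ultimately obtain V where V: "openin (ctop C) V" "cone_convex C V" "g x \<in> V" "V \<subseteq> {y \<in> carrier C. h y \<in> U}"
      unfolding C.topspace_C using C.locally_convex by meson
    have VC: "V \<subseteq> carrier C" using V(4) by auto
    have "openin (ctop D) (h ` V)"
      using homeomorphic_map_openness[OF homeo, of V] V(1) VC by simp
    moreover have "cone_convex D (h ` V)"
      unfolding cone_convex_def
    proof (intro ballI allI impI)
      fix u v and t :: real assume uv: "u \<in> h ` V" "v \<in> h ` V" and t: "0 < t \<and> t < 1"
      then obtain a b where ab: "a \<in> V" "b \<in> V" "u = h a" "v = h b" by auto
      then have "a \<in> carrier C" "b \<in> carrier C" using VC by auto
      then have "t \<odot>\<^bsub>D\<^esub> u \<oplus>\<^bsub>D\<^esub> (1 - t) \<odot>\<^bsub>D\<^esub> v = h (t \<odot>\<^bsub>C\<^esub> a \<oplus>\<^bsub>C\<^esub> (1 - t) \<odot>\<^bsub>C\<^esub> b)"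
        using ab t by (simp add: add scale C.scale_closed)
      then show "t \<odot>\<^bsub>D\<^esub> u \<oplus>\<^bsub>D\<^esub> (1 - t) \<odot>\<^bsub>D\<^esub> v \<in> h ` V"
        using V(2) ab t by (auto simp: cone_convex_def)
    qed
    moreover have "x \<in> h ` V" using V(3) hg U(2) UD by (metis imageI subsetD)
    moreover have "h ` V \<subseteq> U" using V(4) by auto
    ultimately show "\<exists>V. openin (ctop D) V \<and> cone_convex D V \<and> x \<in> V \<and> V \<subseteq> U" by blast
  qed
qed

context strongly_connected_fg_cone
begin

section \<open>The pairing as an isomorphism onto the cone of morphisms\<close>

abbreviation pairing_map :: "'a \<Rightarrow> ('a \<Rightarrow> real) \<Rightarrow> ennreal" where
  "pairing_map \<equiv> \<lambda>y. \<lambda>f\<in>V. pairing C X y f"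

lemma pairing_map_in_hom:
  assumes "y \<in> carrier C" shows "pairing_map y \<in> hom_carrier (pos_funs C X)"
  using assms zero_fun(1)
  by (simp add: hom_carrier_def V_zero V_add V_add_closed pairing_zero_right pairing_add_right)

lemma homeomorphic_pairing_map:
  "homeomorphic_map (ctop C) (ctop (hom_cone (pos_funs C X))) pairing_map"
proof (rule continuous_imp_homeomorphic_map)
  let ?D = "hom_cone (pos_funs C X)"
  show "compact_space (ctop C)" by (rule compact_ctop)
  show "Hausdorff_space (ctop ?D)"
  proof -
    have "Hausdorff_space (euclidean :: ennreal topology)"
      unfolding Hausdorff_space_def disjnt_def using hausdorff by auto
    then show ?thesis
      by (auto simp: hom_cone_def Hausdorff_space_product_topology intro: Hausdorff_space_subtopology)
  qed
  have top: "topspace (ctop ?D) = hom_carrier (pos_funs C X)"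
    by (auto simp: hom_cone_def hom_carrier_def)
  show "continuous_map (ctop C) (ctop ?D) pairing_map"
    using continuous_map_pairing pairing_map_in_hom
    by (auto simp: hom_cone_def continuous_map_in_subtopology continuous_map_componentwise)
  show "pairing_map ` topspace (ctop C) = topspace (ctop ?D)"
    unfolding top
  proof (intro equalityI subsetI)
    fix \<phi> assume hom: "\<phi> \<in> hom_carrier (pos_funs C X)"
    then obtain y where y: "y \<in> carrier C" "\<forall>f\<in>V. \<phi> f = pairing C X y f"
      using hom_representable by blast
    have "\<phi> \<in> extensional V" using hom by (auto simp: hom_carrier_def PiE_def)
    then have "\<phi> = pairing_map y"
      using y by (intro extensionalityI[of _ V]) auto
    then show "\<phi> \<in> pairing_map ` topspace (ctop C)" using y by auto
  qed (use pairing_map_in_hom in auto)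
  show "inj_on pairing_map (topspace (ctop C))"
  proof (rule inj_onI)
    fix y z assume "y \<in> topspace (ctop C)" "z \<in> topspace (ctop C)" and eq: "pairing_map y = pairing_map z"
    moreover have "pairing C X y f = pairing C X z f" if "f \<in> V" for f
      using fun_cong[OF eq, of f] that by simp
    ultimately show "y = z" by (intro pairing_injective) auto
  qed
qed

lemma choquet_cone_iso_pairing_map:
  "choquet_cone_iso C (hom_cone (pos_funs C X)) pairing_map"
proof -
  let ?D = "hom_cone (pos_funs C X)"
  have add: "pairing_map (x \<oplus> y) = pairing_map x \<oplus>\<^bsub>?D\<^esub> pairing_map y"
    if "x \<in> carrier C" "y \<in> carrier C" for x y
    using that by (auto simp: hom_cone_def pairing_add_left)
  have scale: "pairing_map (t \<odot> x) = t \<odot>\<^bsub>?D\<^esub> pairing_map x" if "0 < t" "x \<in> carrier C" for t x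
    using that by (auto simp: hom_cone_def pairing_scale_left)
  have "pairing C X \<zero> f = 0" if "f \<in> V" for f
  proof -
    have "coeffs \<zero> (\<lambda>x. 0)" by (simp add: coeffs_def)
    from pairing_coeffs[OF zero_idems this, of f] show ?thesis
      using supp_in_idems[OF that] by (simp add: zero_le idems_closed)
  qed
  then have zero: "pairing_map \<zero> = \<zero>\<^bsub>?D\<^esub>" by (auto simp: hom_cone_def)
  have "topspace (ctop ?D) = carrier ?D" by (auto simp: hom_cone_def hom_carrier_def)
  then have "extended_choquet_cone ?D"
    using extended_choquet_cone_transport[OF extended_choquet_cone_axioms homeomorphic_pairing_map _ zero add scale]
    by blast
  then show ?thesis
    unfolding choquet_cone_iso_def
    using extended_choquet_cone_axioms homeomorphic_pairing_map add scale by blast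
qed

end

theorem theorem7p9:
  fixes C :: "'a top_cone" and X :: "'a set"
  assumes "extended_choquet_cone C"
    and "finitely_generated C"
    and "strongly_connected C"
    and "ray_representatives C X"
  shows "(\<forall>x\<in>carrier C. \<forall>y\<in>carrier C. \<forall>f\<in>carrier (pos_funs C X).
            pairing C X (x \<oplus>\<^bsub>C\<^esub> y) f = pairing C X x f + pairing C X y f)
       \<and> (\<forall>x\<in>carrier C. \<forall>f\<in>carrier (pos_funs C X). \<forall>g\<in>carrier (pos_funs C X).
            pairing C X x (f \<oplus>\<^bsub>pos_funs C X\<^esub> g) = pairing C X x f + pairing C X x g)
       \<and> (\<forall>t>0. \<forall>x\<in>carrier C. \<forall>f\<in>carrier (pos_funs C X).
            pairing C X (t \<odot>\<^bsub>C\<^esub> x) f = ennreal t * pairing C X x f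
          \<and> pairing C X x (t \<odot>\<^bsub>pos_funs C X\<^esub> f) = ennreal t * pairing C X x f)
       \<and> choquet_cone_iso C (hom_cone (pos_funs C X))
            (\<lambda>x. \<lambda>f\<in>carrier (pos_funs C X). pairing C X x f)"
proof -
  interpret strongly_connected_fg_cone C X
    using assms
    by (intro strongly_connected_fg_cone.intro fg_choquet_cone_reps.intro fg_choquet_cone.intro
        fg_choquet_cone_axioms.intro fg_choquet_cone_reps_axioms.intro
        strongly_connected_fg_cone_axioms.intro)
  show ?thesis
    using choquet_cone_iso_pairing_map
    by (auto simp: V_add V_scale pairing_add_left pairing_add_right pairing_scale_left
        pairing_scale_right)
qed

end
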